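(* Let $0<\epsilon<1$, and suppose that - $n/6\ge\max\{r_1,r_2,r'\}$; - $m_1\ge (r_1'+1)(n-r_1)$; - $m_2\ge (r_2'+1)(n-r_2)$; - $m_1+m_2\ge (r_1'+1)(n-r_1)+(r_2'+1)(n-r_2)+r'(n-r')$. Suppose also that every column of $\mathbf{\Omega}$ has at least $l$ nonzero entries, where $$l>\max\Big\{9\log\tfrac{n}{\epsilon}+3\max\{\log\tfrac{6r_1'}{\epsilon},\log\tfrac{6r_2'}{\epsilon},\log\tfrac{6r'}{\epsilon}\}+6,\;2r_1,\;2r_2\Big\}.$$ Then, with probability at least $1-\epsilon$, $\mathbf{U}$ has exactly one completion.
   Context: Setup: Let $n,m_1,m_2$ be positive integers and $r,r_1,r_2$ integers with $1\le r_1,r_2\le r\le \min\{n,r_1+r_2\}$. The matrix $\mathbf{U}=[\mathbf{U}_1|\mathbf{U}_2]\in\mathbb{R}^{n\times(m_1+m_2)}$ is generic (outside a Lebesgue-null set), with views $\mathbf{U}_1\in\mathbb{R}^{n\times m_1}$ and $\mathbf{U}_2\in\mathbb{R}^{n\times m_2}$, and satisfies $\mathrm{rank}(\mathbf{U}_1)=r_1$, $\mathrm{rank}(\mathbf{U}_2)=r_2$, $\mathrm{rank}(\mathbf{U})=r$. Set $r_1'=r-r_2$, $r_2'=r-r_1$, $r'=r_1+r_2-r$. Sampling pattern: $\mathbf{\Omega}\in\{0,1\}^{n\times(m_1+m_2)}$ marks the observed entries. Within each column, the locations of the observed entries are chosen uniformly at random, independently across columns. Completions: a completion is any matrix that agrees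 with $\mathbf{U}$ on the observed entries and satisfies the three rank constraints. *)

theory Defs
  imports "HOL-Probability.Probability" "Jordan_Normal_Form.DL_Rank"
begin

definition mrank :: "real mat \<Rightarrow> nat" where
  "mrank A = vec_space.rank (dim_row A) A"

definition view1 :: "nat \<Rightarrow> real mat \<Rightarrow> real mat" where
  "view1 m1 M = mat (dim_row M) m1 (\<lambda>(i,j). M $$ (i,j))"

definition view2 :: "nat \<Rightarrow> real mat \<Rightarrow> real mat" where
  "view2 m1 M = mat (dim_row M) (dim_col M - m1) (\<lambda>(i,j). M $$ (i, m1 + j))"

definition completions ::
  "nat \<Rightarrow> nat \<Rightarrow> nat \<Rightarrow> nat \<Rightarrow> real mat \<Rightarrow> (nat \<Rightarrow> nat set) \<Rightarrow> real mat set" where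
  "completions m1 r1 r2 r U \<Omega> =
     {X. X \<in> carrier_mat (dim_row U) (dim_col U) \<and>
         (\<forall>i<dim_row U. \<forall>j<dim_col U. i \<in> \<Omega> j \<longrightarrow> X $$ (i,j) = U $$ (i,j)) \<and>
         mrank (view1 m1 X) = r1 \<and> mrank (view2 m1 X) = r2 \<and> mrank X = r}"

definition has_unique_completion ::
  "nat \<Rightarrow> nat \<Rightarrow> nat \<Rightarrow> nat \<Rightarrow> real mat \<Rightarrow> (nat \<Rightarrow> nat set) \<Rightarrow> bool" where
  "has_unique_completion m1 r1 r2 r U \<Omega> = (\<exists>!X. X \<in> completions m1 r1 r2 r U \<Omega>)"

definition sampling :: "nat \<Rightarrow> nat \<Rightarrow> (nat \<Rightarrow> nat) \<Rightarrow> (nat \<Rightarrow> nat set) pmf" where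
  "sampling n m k = Pi_pmf {..<m} {} (\<lambda>j. pmf_of_set {S. S \<subseteq> {..<n} \<and> card S = k j})"

text \<open>Genericity: U is parametrised as U1 = [X|Y1] Theta1, U2 = [X|Y2] Theta2, with
  X : n x r', Y1 : n x r1', Y2 : n x r2', Theta1 : r1 x m1, Theta2 : r2 x m2
  (r' = r1+r2-r, r1' = r-r2, r2' = r-r1). Every matrix with the three rank constraints
  arises this way; "generic" means the parameter lies outside a Lebesgue-null set.
  Parameters are indexed by triples (block tag, row, column).\<close>
definition gen_index :: "nat \<Rightarrow> nat \<Rightarrow> nat \<Rightarrow> nat \<Rightarrow> nat \<Rightarrow> nat \<Rightarrow> (nat \<times> nat \<times> nat) set" where
  "gen_index n m1 m2 r1 r2 r =
     {(0,i,a) | i a. i < n \<and> a < r1 + r2 - r} \<union>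
     {(1,i,a) | i a. i < n \<and> a < r - r2} \<union>
     {(2,i,a) | i a. i < n \<and> a < r - r1} \<union>
     {(3,a,j) | a j. a < r1 \<and> j < m1} \<union>
     {(4,a,j) | a j. a < r2 \<and> j < m2}"

definition gen_param_space :: "nat \<Rightarrow> nat \<Rightarrow> nat \<Rightarrow> nat \<Rightarrow> nat \<Rightarrow> nat \<Rightarrow> (nat \<times> nat \<times> nat \<Rightarrow> real) measure" where
  "gen_param_space n m1 m2 r1 r2 r = PiM (gen_index n m1 m2 r1 r2 r) (\<lambda>_. lborel)"

definition gen_U :: "nat \<Rightarrow> nat \<Rightarrow> nat \<Rightarrow> nat \<Rightarrow> nat \<Rightarrow> nat \<Rightarrow> (nat \<times> nat \<times> nat \<Rightarrow> real) \<Rightarrow> real mat" where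
  "gen_U n m1 m2 r1 r2 r p =
     (let r' = r1 + r2 - r;
          B1 = (\<lambda>i a. if a < r' then p (0,i,a) else p (1,i,a - r'));
          B2 = (\<lambda>i a. if a < r' then p (0,i,a) else p (2,i,a - r'))
      in mat n (m1 + m2) (\<lambda>(i,j).
           if j < m1 then (\<Sum>a<r1. B1 i a * p (3,a,j))
           else (\<Sum>a<r2. B2 i a * p (4,a,j - m1))))"

end

theory Submission
  imports Defs
begin

text \<open>
  Outside a null set the parameters p are algebraically independent over the rationals, and everything
  is derived pointwise from that. For an observation pattern in which every nonempty set K of columns
  of a group G covers at least card K + \<rho> rows (a Hall condition with surplus \<rho>, which fails with
  probability at most \<epsilon>/(24 \<mu>), \<mu> being the largest of r - r2, r - r1 and r1 + r2 - r), a group of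
  n - \<rho> columns carries independent vectors
  (circuits) that are supported on the observed rows, orthogonal to the \<rho>-dimensional true column
  space and rational in the basis parameters.

  Take any completion and choose bases of its column spaces that are unit vectors on pivot rows.
  Consider a column together with the equations at its observed entries. Either these equations can be
  solved for every choice of the true coefficients; then the true basis, restricted to the observed rows,
  lies in the span of the candidate basis, so the circuit of the column is orthogonal to the candidate:
  one linear equation with known coefficients. Or elimination expresses one true coefficient rationally through the
  others and the candidate basis; call the column active. Assign to every unknown candidate vector as many
  columns as it has non-pivot entries. An active column in such a group accounts for one transcendental
  parameter, an inactive one removes one unknown entry, so one further active column outside the groups
  would make the transcendence degree too small. Hence all columns of a spare group are inactive, and
  their circuits force the candidate space to be the true one.

  If a view has enough columns, its space is found first and then the sum of the two spaces. Otherwise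
  the remaining columns of both views are distributed over mixed groups, one for each vector in the
  intersection of the two candidate spaces.
\<close>

section \<open>Linear algebra with finite families\<close>

text \<open>A candidate is an arbitrary solution, chosen after the parameters, so nothing about it
  may be assumed generic. What holds for every candidate is a count of transcendence degree, and
  pivots make it exact: a normalised vector of a \<open>k\<close>-dimensional space has
  \<open>n - k\<close> free entries, as many as a group has columns. This explains the bounds on the
  columns. In each view the private vectors and one spare group need
  \<open>(r1' + 1) * (n - r1)\<close> and \<open>(r2' + 1) * (n - r2)\<close> columns, the
  intersection needs \<open>r' * (n - r')\<close>. The obstacle is a mixed group: its columns must
  carry independent circuits although those of the two views are orthogonal to different spaces with
  only \<open>r'\<close> common dimensions. Independence is a polynomial condition, so one example
  suffices, and the example is built backwards, circuits before bases. The circuits must involve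
  basis parameters only, since the count treats the coefficient parameters as still unknown.\<close>

definition real_subfield :: "real set \<Rightarrow> bool" where
  "real_subfield C \<longleftrightarrow> 0 \<in> C \<and> 1 \<in> C \<and>
     (\<forall>x\<in>C. \<forall>y\<in>C. x + y \<in> C \<and> x - y \<in> C \<and> x * y \<in> C \<and> x / y \<in> C)"

lemma real_subfieldD:
  assumes "real_subfield C"
  shows "0 \<in> C" "1 \<in> C" "x \<in> C \<Longrightarrow> y \<in> C \<Longrightarrow> x + y \<in> C" "x \<in> C \<Longrightarrow> y \<in> C \<Longrightarrow> x - y \<in> C"
    "x \<in> C \<Longrightarrow> y \<in> C \<Longrightarrow> x * y \<in> C" "x \<in> C \<Longrightarrow> y \<in> C \<Longrightarrow> x / y \<in> C"
  using assms unfolding real_subfield_def by blast+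

lemma real_subfield_uminus: "real_subfield C \<Longrightarrow> x \<in> C \<Longrightarrow> - x \<in> C"
  using real_subfieldD(4)[of C 0 x] real_subfieldD(1)[of C] by simp

lemma real_subfield_sum:
  assumes "real_subfield C" "\<And>k. k \<in> K \<Longrightarrow> f k \<in> C"
  shows "sum f K \<in> C"
  using assms(2) by (induction K rule: infinite_finite_induct) (auto intro: real_subfieldD[OF assms(1)])

lemma real_subfield_UNIV: "real_subfield UNIV"
  by (simp add: real_subfield_def)

lemma real_subfield_Rats: "real_subfield \<rat>"
  by (simp add: real_subfield_def)

text \<open>Gaussian elimination: one equation is solved for \<open>k0\<close> and substituted into
  the others. The subfield \<open>C\<close> is tracked because the transcendence count needs a
  relation with rational coefficients, while the exchange lemmas work over all reals.\<close>

lemma homogeneous_system: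
  assumes C: "real_subfield C" and "finite L" "finite K" "card L < card K"
    and "\<And>l k. l \<in> L \<Longrightarrow> k \<in> K \<Longrightarrow> f l k \<in> C"
  shows "\<exists>c. (\<forall>k\<in>K. c k \<in> C) \<and> (\<exists>k\<in>K. c k \<noteq> 0) \<and> (\<forall>l\<in>L. (\<Sum>k\<in>K. f l k * c k) = 0)"
  using assms(2-)
proof (induction L arbitrary: K f rule: finite_induct)
  case empty
  then have "K \<noteq> {}" by auto
  then show ?case using real_subfieldD(2)[OF C] by (intro exI[of _ "\<lambda>_. 1"]) auto
next
  case (insert l L)
  note cl = real_subfieldD[OF C]
  show ?case
  proof (cases "\<forall>k\<in>K. f l k = 0")
    case True
    have "\<exists>c. (\<forall>k\<in>K. c k \<in> C) \<and> (\<exists>k\<in>K. c k \<noteq> 0) \<and> (\<forall>l\<in>L. (\<Sum>k\<in>K. f l k * c k) = 0)"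
      using insert.prems insert.hyps by (intro insert.IH) auto
    then show ?thesis using True by auto
  next
    case False
    then obtain k0 where k0: "k0 \<in> K" "f l k0 \<noteq> 0" by auto
    define f' where "f' = (\<lambda>m k. f m k - f m k0 * f l k / f l k0)"
    have "\<exists>c. (\<forall>k\<in>K-{k0}. c k \<in> C) \<and> (\<exists>k\<in>K-{k0}. c k \<noteq> 0) \<and> (\<forall>m\<in>L. (\<Sum>k\<in>K-{k0}. f' m k * c k) = 0)"
      using insert.prems insert.hyps k0 by (intro insert.IH) (auto simp: f'_def intro!: cl(4-6))
    then obtain c where c: "\<forall>k\<in>K-{k0}. c k \<in> C" "\<exists>k\<in>K-{k0}. c k \<noteq> 0"
       "\<And>m. m \<in> L \<Longrightarrow> (\<Sum>k\<in>K-{k0}. f' m k * c k) = 0" by auto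
    define s where "s = (\<Sum>k\<in>K-{k0}. f l k * c k)"
    define c' where "c' = c(k0 := - s / f l k0)"
    have sum': "(\<Sum>k\<in>K. f m k * c' k) = (\<Sum>k\<in>K-{k0}. f m k * c k) - f m k0 * s / f l k0" for m
    proof -
      have "(\<Sum>k\<in>K-{k0}. f m k * c' k) = (\<Sum>k\<in>K-{k0}. f m k * c k)"
        by (intro sum.cong) (auto simp: c'_def)
      then show ?thesis using insert.prems k0 by (simp add: sum.remove[of K k0] c'_def)
    qed
    have "s \<in> C" unfolding s_def using c insert.prems by (intro real_subfield_sum[OF C] cl) auto
    then have "\<forall>k\<in>K. c' k \<in> C" using c insert.prems k0
      by (auto simp: c'_def intro!: cl(6) real_subfield_uminus[OF C])
    moreover have "\<exists>k\<in>K. c' k \<noteq> 0" using c(2) by (auto simp: c'_def)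
    moreover have "(\<Sum>k\<in>K. f m k * c' k) = 0" if "m \<in> L" for m
    proof -
      have "(\<Sum>k\<in>K-{k0}. f m k * c k) - f m k0 * s / f l k0 = (\<Sum>k\<in>K-{k0}. f' m k * c k)"
        unfolding s_def f'_def by (simp add: algebra_simps sum_subtractf sum_distrib_left sum_divide_distrib)
      then show ?thesis using c(3)[OF that] sum' by simp
    qed
    moreover have "(\<Sum>k\<in>K. f l k * c' k) = 0" unfolding sum' using k0 by (simp add: s_def)
    ultimately show ?thesis by (intro exI[of _ c']) auto
  qed
qed

text \<open>Indexed families instead of sets of vectors, so that a repetition in a finite family
  counts as dependence. The row set is explicit because independence after restriction to the
  observed rows is the decisive property.\<close>

definition indep_on :: "'a set \<Rightarrow> 'k set \<Rightarrow> ('k \<Rightarrow> 'a \<Rightarrow> real) \<Rightarrow> bool" where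
  "indep_on R K v \<longleftrightarrow> (\<forall>c. (\<forall>i\<in>R. (\<Sum>k\<in>K. c k * v k i) = 0) \<longrightarrow> (\<forall>k\<in>K. c k = 0))"

definition in_span :: "'a set \<Rightarrow> 'k set \<Rightarrow> ('k \<Rightarrow> 'a \<Rightarrow> real) \<Rightarrow> ('a \<Rightarrow> real) \<Rightarrow> bool" where
  "in_span R K v u \<longleftrightarrow> (\<exists>c. \<forall>i\<in>R. u i = (\<Sum>k\<in>K. c k * v k i))"

lemma indep_onI: "(\<And>c k. (\<And>i. i \<in> R \<Longrightarrow> (\<Sum>k\<in>K. c k * v k i) = 0) \<Longrightarrow> k \<in> K \<Longrightarrow> c k = 0) \<Longrightarrow> indep_on R K v"
  unfolding indep_on_def by blast

lemma indep_onD: "indep_on R K v \<Longrightarrow> (\<And>i. i \<in> R \<Longrightarrow> (\<Sum>k\<in>K. c k * v k i) = 0) \<Longrightarrow> k \<in> K \<Longrightarrow> c k = 0"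
  unfolding indep_on_def by blast

lemma indep_on_mono: "indep_on R K v \<Longrightarrow> R \<subseteq> R' \<Longrightarrow> indep_on R' K v"
  unfolding indep_on_def by blast

lemma indep_on_cong: "(\<And>k i. k \<in> K \<Longrightarrow> i \<in> R \<Longrightarrow> v k i = w k i) \<Longrightarrow> indep_on R K v \<longleftrightarrow> indep_on R K w"
  unfolding indep_on_def by simp

lemma indep_on_subset:
  assumes "indep_on R K v" "J \<subseteq> K" "finite K"
  shows "indep_on R J v"
proof (rule indep_onI)
  fix c k assume c: "\<And>i. i \<in> R \<Longrightarrow> (\<Sum>k\<in>J. c k * v k i) = 0" and k: "k \<in> J"
  have eq: "(\<Sum>k\<in>K. (if k \<in> J then c k else 0) * v k i) = (\<Sum>k\<in>J. c k * v k i)" for i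
    using assms by (intro sum.mono_neutral_cong_right) auto
  have "(if k \<in> J then c k else 0) = 0"
    by (rule indep_onD[OF assms(1), of "\<lambda>k. if k \<in> J then c k else 0"]) (use eq c k assms in auto)
  then show "c k = 0" using k by simp
qed

lemma indep_on_reindex:
  assumes "bij_betw h J K"
  shows "indep_on R J (\<lambda>j. v (h j)) \<longleftrightarrow> indep_on R K v"
proof
  assume L: "indep_on R J (\<lambda>j. v (h j))"
  show "indep_on R K v"
  proof (rule indep_onI)
    fix c k assume c: "\<And>i. i \<in> R \<Longrightarrow> (\<Sum>k\<in>K. c k * v k i) = 0" and k: "k \<in> K"
    have eq: "(\<Sum>j\<in>J. c (h j) * v (h j) i) = (\<Sum>k\<in>K. c k * v k i)" for i
      by (rule sum.reindex_bij_betw[OF assms])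
    obtain j where "j \<in> J" "h j = k" using assms k by (auto simp: bij_betw_def)
    then show "c k = 0" using indep_onD[OF L, of "\<lambda>j. c (h j)" j] eq c by simp
  qed
next
  assume K: "indep_on R K v"
  show "indep_on R J (\<lambda>j. v (h j))"
  proof (rule indep_onI)
    fix c j assume c: "\<And>i. i \<in> R \<Longrightarrow> (\<Sum>j\<in>J. c j * v (h j) i) = 0" and j: "j \<in> J"
    have inv: "inv_into J h (h j) = j" if "j \<in> J" for j
      using assms that by (auto simp: bij_betw_def)
    have eq: "(\<Sum>k\<in>K. c (inv_into J h k) * v k i) = (\<Sum>j\<in>J. c j * v (h j) i)" for i
      by (subst sum.reindex_bij_betw[OF assms, symmetric]) (auto simp: inv intro: sum.cong)
    have hj: "h j \<in> K" using assms j by (auto simp: bij_betw_def)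
    have "c (inv_into J h (h j)) = 0"
      by (rule indep_onD[OF K, of "\<lambda>k. c (inv_into J h k)"]) (use eq c hj in auto)
    then show "c j = 0" using inv j by simp
  qed
qed

lemma in_span_byI: "(\<And>i. i \<in> R \<Longrightarrow> u i = (\<Sum>k\<in>K. c k * v k i)) \<Longrightarrow> in_span R K v u"
  unfolding in_span_def by blast

lemma in_span_unit: "finite R \<Longrightarrow> in_span R R (\<lambda>k i. if i = k then 1 else 0) u"
  by (rule in_span_byI[where c = u]) (simp add: if_distrib cong: if_cong)

lemma in_span_base: "finite K \<Longrightarrow> k \<in> K \<Longrightarrow> in_span R K v (v k)"
  by (rule in_span_byI[where c = "\<lambda>j. if j = k then 1 else 0"]) (simp add: if_distrib if_distribR cong: if_cong)

text \<open>The vector \<open>u\<close>, indexed by \<open>None\<close>, and the family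
  \<open>v\<close> are \<open>card K + 1\<close> vectors with \<open>card L\<close> coordinates with
  respect to \<open>w\<close>. They satisfy a nontrivial relation, and independence of
  \<open>v\<close> forces \<open>u\<close> to occur in it.\<close>

lemma in_span_exchange:
  assumes ind: "indep_on R K v" and fin: "finite K" "finite L" and card: "card L \<le> card K"
    and sub: "\<And>k. k \<in> K \<Longrightarrow> in_span R L w (v k)" and u: "in_span R L w u"
  shows "in_span R K v u"
proof -
  obtain F where F: "\<And>k i. k \<in> K \<Longrightarrow> i \<in> R \<Longrightarrow> v k i = (\<Sum>l\<in>L. F k l * w l i)"
    using sub unfolding in_span_def by metis
  obtain g where g: "\<And>i. i \<in> R \<Longrightarrow> u i = (\<Sum>l\<in>L. g l * w l i)"
    using u unfolding in_span_def by metis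
  define K' where "K' = insert None (Some ` K)"
  have K': "finite K'" "card L < card K'"
    unfolding K'_def using fin card by (auto simp: card_insert_if card_image)
  define f where "f = (\<lambda>l k'. case k' of None \<Rightarrow> g l | Some k \<Rightarrow> F k l)"
  obtain c where c: "\<exists>k\<in>K'. c k \<noteq> 0" "\<And>l. l \<in> L \<Longrightarrow> (\<Sum>k\<in>K'. f l k * c k) = 0"
    using homogeneous_system[OF real_subfield_UNIV fin(2) K', of f] by auto
  have sumK: "(\<Sum>k\<in>K'. h k) = h None + (\<Sum>k\<in>K. h (Some k))" for h :: "'b option \<Rightarrow> real"
    unfolding K'_def using fin by (simp add: sum.reindex)
  have rel: "c None * u i + (\<Sum>k\<in>K. c (Some k) * v k i) = 0" if "i \<in> R" for i
  proof -
    have "c None * u i + (\<Sum>k\<in>K. c (Some k) * v k i)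
        = (\<Sum>l\<in>L. c None * g l * w l i) + (\<Sum>k\<in>K. \<Sum>l\<in>L. c (Some k) * F k l * w l i)"
      using g[OF that] F[OF _ that] by (simp add: sum_distrib_left mult.assoc)
    also have "\<dots> = (\<Sum>l\<in>L. (c None * g l + (\<Sum>k\<in>K. c (Some k) * F k l)) * w l i)"
      by (subst sum.swap) (simp add: sum_distrib_right distrib_right sum.distrib)
    also have "\<dots> = 0"
      using c(2) by (intro sum.neutral) (auto simp: sumK f_def mult.commute)
    finally show ?thesis .
  qed
  have "c None \<noteq> 0"
  proof
    assume "c None = 0"
    have "c (Some k) = 0" if "k \<in> K" for k
      by (rule indep_onD[OF ind, of "\<lambda>k. c (Some k)"]) (use rel \<open>c None = 0\<close> that in auto)
    then show False using c(1) \<open>c None = 0\<close> by (auto simp: K'_def)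
  qed
  then have "u i = (\<Sum>k\<in>K. (- c (Some k) / c None) * v k i)" if "i \<in> R" for i
    using rel[OF that] by (simp add: sum_negf sum_divide_distrib[symmetric] field_simps)
  then show ?thesis by (rule in_span_byI)
qed

lemma indep_card_le:
  assumes ind: "indep_on R K v" and fin: "finite K" "finite L"
    and sub: "\<And>k. k \<in> K \<Longrightarrow> in_span R L w (v k)"
  shows "card K \<le> card L"
proof (rule ccontr)
  assume "\<not> card K \<le> card L"
  then have c: "card L < card K" by simp
  obtain F where F: "\<And>k i. k \<in> K \<Longrightarrow> i \<in> R \<Longrightarrow> v k i = (\<Sum>l\<in>L. F k l * w l i)"
    using sub unfolding in_span_def by metis
  obtain c where c: "\<exists>k\<in>K. c k \<noteq> 0" "\<And>l. l \<in> L \<Longrightarrow> (\<Sum>k\<in>K. F k l * c k) = 0"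
    using homogeneous_system[OF real_subfield_UNIV fin(2,1) c, of "\<lambda>l k. F k l"] by auto
  have "(\<Sum>k\<in>K. c k * v k i) = 0" if "i \<in> R" for i
  proof -
    have "(\<Sum>k\<in>K. c k * v k i) = (\<Sum>k\<in>K. \<Sum>l\<in>L. c k * F k l * w l i)"
      using F[OF _ that] by (simp add: sum_distrib_left mult.assoc)
    also have "\<dots> = (\<Sum>l\<in>L. (\<Sum>k\<in>K. c k * F k l) * w l i)"
      by (subst sum.swap) (simp add: sum_distrib_right)
    also have "\<dots> = 0" using c(2) by (intro sum.neutral) (auto simp: mult.commute)
    finally show ?thesis .
  qed
  then show False using indep_onD[OF ind] c(1) by blast
qed

lemma sum_square_combination:
  fixes v :: "'k \<Rightarrow> 'a \<Rightarrow> real"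
  shows "(\<Sum>i\<in>R. (\<Sum>k\<in>K. c k * v k i)\<^sup>2) = (\<Sum>s\<in>K. c s * (\<Sum>t\<in>K. c t * (\<Sum>i\<in>R. v s i * v t i)))"
proof -
  have "(\<Sum>i\<in>R. (\<Sum>k\<in>K. c k * v k i)\<^sup>2) = (\<Sum>i\<in>R. \<Sum>s\<in>K. \<Sum>t\<in>K. c s * (c t * (v s i * v t i)))"
    by (simp add: power2_eq_square sum_product algebra_simps)
  also have "\<dots> = (\<Sum>s\<in>K. \<Sum>t\<in>K. \<Sum>i\<in>R. c s * (c t * (v s i * v t i)))"
    by (subst sum.swap, rule sum.cong[OF refl], subst sum.swap) simp
  finally show ?thesis by (simp add: sum_distrib_left)
qed

text \<open>By hypothesis the combination is orthogonal to every \<open>v s\<close>, hence to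
  itself, and a real vector with vanishing sum of squares is zero.\<close>

lemma gram_combination_zero:
  assumes R: "finite R" and 0: "\<And>s. s \<in> K \<Longrightarrow> (\<Sum>t\<in>K. c t * (\<Sum>i\<in>R. v s i * v t i)) = 0"
    and i: "i \<in> R"
  shows "(\<Sum>k\<in>K. c k * v k i) = (0::real)"
proof -
  have "(\<Sum>i\<in>R. (\<Sum>k\<in>K. c k * v k i)\<^sup>2) = 0"
    unfolding sum_square_combination using 0 by simp
  then show ?thesis using R i by (simp add: sum_nonneg_eq_0_iff)
qed

text \<open>The solution is sought as a combination of the \<open>v t\<close> themselves. This
  replaces the system by one with the square Gram matrix, whose columns are independent by
  \<open>gram_combination_zero\<close>.\<close>

lemma indep_on_solve:
  assumes ind: "indep_on R K v" and fin: "finite R" "finite K"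
  shows "\<exists>x. \<forall>k\<in>K. (\<Sum>i\<in>R. v k i * x i) = (b k :: real)"
proof -
  define g where "g = (\<lambda>t s. \<Sum>i\<in>R. v s i * v t i)"
  have "indep_on K K g"
  proof (rule indep_onI)
    fix c k assume "\<And>s. s \<in> K \<Longrightarrow> (\<Sum>t\<in>K. c t * g t s) = 0" "k \<in> K"
    then show "c k = 0"
      using gram_combination_zero[OF fin(1), of K c v] indep_onD[OF ind, of c k] by (auto simp: g_def)
  qed
  then have "in_span K K g b"
    by (rule in_span_exchange[OF _ fin(2) fin(2) le_refl _ ]) (auto intro: in_span_unit fin)
  then obtain c where c: "\<And>s. s \<in> K \<Longrightarrow> b s = (\<Sum>t\<in>K. c t * g t s)" unfolding in_span_def by blast
  have "(\<Sum>i\<in>R. v s i * (\<Sum>t\<in>K. c t * v t i)) = b s" if "s \<in> K" for s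
    unfolding c[OF that] g_def sum_distrib_left by (subst sum.swap) (simp add: algebra_simps)
  then show ?thesis by (intro exI[of _ "\<lambda>i. \<Sum>t\<in>K. c t * v t i"]) auto
qed

text \<open>Orthogonal independent families of complementary sizes together span all vectors on
  \<open>R\<close>; orthogonality of \<open>u\<close> to the first family kills its part of the
  expansion. This is how sufficiently many circuits force a vector into the true column
  space.\<close>

lemma orthogonal_union_spans:
  assumes A: "indep_on R K a" and B: "indep_on R L b" and fin: "finite R" "finite K" "finite L"
    and orth: "\<And>k l. k \<in> K \<Longrightarrow> l \<in> L \<Longrightarrow> (\<Sum>i\<in>R. a k i * b l i) = 0"
    and card: "card R \<le> card K + card L"
    and u: "\<And>k. k \<in> K \<Longrightarrow> (\<Sum>i\<in>R. a k i * u i) = (0::real)"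
  shows "in_span R L b u"
proof -
  define w where "w = case_sum a b"
  have sumw: "(\<Sum>k\<in>K <+> L. c k * w k i) = (\<Sum>k\<in>K. c (Inl k) * a k i) + (\<Sum>l\<in>L. c (Inr l) * b l i)" for c i
    using fin by (simp add: sum.Plus w_def)
  have key: "(\<Sum>k\<in>K. c k * a k i) = 0"
    if c: "\<And>k. k \<in> K \<Longrightarrow> (\<Sum>i\<in>R. a k i * (\<Sum>k\<in>K. c k * a k i)) = 0" and i: "i \<in> R" for c i
  proof (rule gram_combination_zero[OF fin(1) _ i])
    fix s assume s: "s \<in> K"
    have "(\<Sum>t\<in>K. c t * (\<Sum>i\<in>R. a s i * a t i)) = (\<Sum>i\<in>R. a s i * (\<Sum>k\<in>K. c k * a k i))"
      unfolding sum_distrib_left by (subst sum.swap) (simp add: algebra_simps)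
    then show "(\<Sum>t\<in>K. c t * (\<Sum>i\<in>R. a s i * a t i)) = 0" using c[OF s] by simp
  qed
  have orth': "(\<Sum>i\<in>R. a k i * (\<Sum>l\<in>L. d l * b l i)) = 0" if "k \<in> K" for k d
  proof -
    have "(\<Sum>i\<in>R. a k i * (\<Sum>l\<in>L. d l * b l i)) = (\<Sum>l\<in>L. d l * (\<Sum>i\<in>R. a k i * b l i))"
      unfolding sum_distrib_left by (subst sum.swap) (simp add: algebra_simps)
    then show ?thesis using orth[OF that] by simp
  qed
  have "indep_on R (K <+> L) w"
  proof (rule indep_onI)
    fix c k assume c: "\<And>i. i \<in> R \<Longrightarrow> (\<Sum>k\<in>K <+> L. c k * w k i) = 0" and k: "k \<in> K <+> L"
    have c': "(\<Sum>k\<in>K. c (Inl k) * a k i) = - (\<Sum>l\<in>L. c (Inr l) * b l i)" if "i \<in> R" for i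
      using c[OF that] sumw by simp
    have z: "(\<Sum>k\<in>K. c (Inl k) * a k i) = 0" if "i \<in> R" for i
    proof (rule key[OF _ that, of "\<lambda>k. c (Inl k)"])
      fix k assume "k \<in> K"
      then show "(\<Sum>i\<in>R. a k i * (\<Sum>k\<in>K. c (Inl k) * a k i)) = 0"
        using orth'[of k "\<lambda>l. c (Inr l)"] c' by (simp add: sum_negf)
    qed
    have "c (Inl k) = 0" if "k \<in> K" for k
      by (rule indep_onD[OF A, of "\<lambda>k. c (Inl k)"]) (use z that in auto)
    moreover have "c (Inr l) = 0" if "l \<in> L" for l
      by (rule indep_onD[OF B, of "\<lambda>l. c (Inr l)"]) (use z c' that in auto)
    ultimately show "c k = 0" using k by auto
  qed
  then have "in_span R (K <+> L) w u"
    by (rule in_span_exchange[where L = R]) (use fin card in \<open>auto intro: in_span_unit simp: card_Plus\<close>)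
  then obtain c where c: "\<And>i. i \<in> R \<Longrightarrow> u i = (\<Sum>k\<in>K <+> L. c k * w k i)" unfolding in_span_def by blast
  have z: "(\<Sum>k\<in>K. c (Inl k) * a k i) = 0" if "i \<in> R" for i
  proof (rule key[OF _ that, of "\<lambda>k. c (Inl k)"])
    fix k assume k: "k \<in> K"
    have "0 = (\<Sum>i\<in>R. a k i * u i)" using u[OF k] by simp
    also have "\<dots> = (\<Sum>i\<in>R. a k i * (\<Sum>k\<in>K. c (Inl k) * a k i)) + (\<Sum>i\<in>R. a k i * (\<Sum>l\<in>L. c (Inr l) * b l i))"
      using c sumw by (simp add: distrib_left sum.distrib)
    finally show "(\<Sum>i\<in>R. a k i * (\<Sum>k\<in>K. c (Inl k) * a k i)) = 0" using orth'[OF k] by simp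
  qed
  show ?thesis by (rule in_span_byI[where c = "\<lambda>l. c (Inr l)"]) (use c sumw z in simp)
qed

section \<open>Gram determinants as a polynomial test of independence\<close>

definition gram :: "'a set \<Rightarrow> nat \<Rightarrow> (nat \<Rightarrow> 'a \<Rightarrow> real) \<Rightarrow> real" where
  "gram R k v = det (mat k k (\<lambda>(s,t). \<Sum>i\<in>R. v s i * v t i))"

text \<open>By positivity, a kernel vector of the Gram matrix is a relation among the
  \<open>v s\<close>. Independence becomes the nonvanishing of one polynomial, which can be verified
  at a single specialisation and transferred to generic points.\<close>

lemma gram_nonzero_iff:
  assumes R: "finite R"
  shows "gram R k v \<noteq> 0 \<longleftrightarrow> indep_on R {..<k} v"
proof -
  let ?M = "mat k k (\<lambda>(s,t). \<Sum>i\<in>R. v s i * v t i)"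
  have M: "?M \<in> carrier_mat k k" by simp
  have mv: "(?M *\<^sub>v x) $ s = (\<Sum>t<k. x $ t * (\<Sum>i\<in>R. v s i * v t i))" if "s < k" "x \<in> carrier_vec k" for s x
    using that by (simp add: scalar_prod_def atLeast0LessThan mult.commute)
  have "gram R k v = 0 \<longleftrightarrow> (\<exists>x\<in>carrier_vec k. x \<noteq> 0\<^sub>v k \<and> ?M *\<^sub>v x = 0\<^sub>v k)"
    unfolding gram_def using det_0_iff_vec_prod_zero_field[OF M] by blast
  also have "\<dots> \<longleftrightarrow> \<not> indep_on R {..<k} v"
  proof
    assume "\<exists>x\<in>carrier_vec k. x \<noteq> 0\<^sub>v k \<and> ?M *\<^sub>v x = 0\<^sub>v k"
    then obtain x where x: "x \<in> carrier_vec k" "x \<noteq> 0\<^sub>v k" "?M *\<^sub>v x = 0\<^sub>v k" by blast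
    have "(\<Sum>t<k. x $ t * (\<Sum>i\<in>R. v s i * v t i)) = 0" if "s < k" for s
      using mv[OF that x(1)] x(3) that by simp
    then have "(\<Sum>t<k. x $ t * v t i) = 0" if "i \<in> R" for i
      using gram_combination_zero[OF R, of "{..<k}" "\<lambda>t. x $ t" v i] that by simp
    moreover have "\<exists>t<k. x $ t \<noteq> 0" using x(1,2) by (metis carrier_vecD eq_vecI index_zero_vec(1) index_zero_vec(2))
    ultimately show "\<not> indep_on R {..<k} v" using indep_onD[of R "{..<k}" v "\<lambda>t. x $ t"] by auto
  next
    assume "\<not> indep_on R {..<k} v"
    then obtain c where c: "\<forall>i\<in>R. (\<Sum>t<k. c t * v t i) = 0" "\<exists>t<k. c t \<noteq> 0" unfolding indep_on_def by auto
    define x where "x = vec k c"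
    obtain t where t: "t < k" "c t \<noteq> 0" using c(2) by blast
    then have "x $ t \<noteq> 0" by (simp add: x_def)
    then have "x \<noteq> 0\<^sub>v k" using t(1) by force
    moreover have "x \<in> carrier_vec k" by (simp add: x_def)
    moreover from this have "?M *\<^sub>v x = 0\<^sub>v k"
    proof -
      assume xc: "x \<in> carrier_vec k"
      show ?thesis
    proof (rule eq_vecI)
      fix s assume "s < dim_vec (0\<^sub>v k :: real vec)"
      then have s: "s < k" by simp
      have "(\<Sum>t<k. x $ t * (\<Sum>i\<in>R. v s i * v t i)) = (\<Sum>i\<in>R. v s i * (\<Sum>t<k. c t * v t i))"
        unfolding sum_distrib_left by (subst sum.swap) (simp add: algebra_simps x_def)
      also have "\<dots> = 0" using c(1) by simp
      finally show "(?M *\<^sub>v x) $ s = 0\<^sub>v k $ s" using mv[OF s xc] s by simp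
    qed simp
    qed
    ultimately show "\<exists>x\<in>carrier_vec k. x \<noteq> 0\<^sub>v k \<and> ?M *\<^sub>v x = 0\<^sub>v k" by blast
  qed
  finally show ?thesis by blast
qed

section \<open>Subspaces and bases normalised on pivot rows\<close>

definition lin_subspace :: "('a \<Rightarrow> real) set \<Rightarrow> bool" where
  "lin_subspace V \<longleftrightarrow> (\<forall>u\<in>V. \<forall>w\<in>V. \<forall>c. (\<lambda>i. u i + c * w i) \<in> V) \<and> (\<lambda>_. 0) \<in> V"

lemma lin_subspaceD:
  assumes "lin_subspace V"
  shows "(\<lambda>_. 0) \<in> V" "u \<in> V \<Longrightarrow> w \<in> V \<Longrightarrow> (\<lambda>i. u i + c * w i) \<in> V"
proof -
  show "(\<lambda>_. 0) \<in> V" using assms unfolding lin_subspace_def by (rule conjunct2)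
  have "\<forall>u\<in>V. \<forall>w\<in>V. \<forall>c. (\<lambda>i. u i + c * w i) \<in> V" using assms unfolding lin_subspace_def by (rule conjunct1)
  then show "u \<in> V \<Longrightarrow> w \<in> V \<Longrightarrow> (\<lambda>i. u i + c * w i) \<in> V" by simp
qed

lemma lin_subspace_sum:
  assumes V: "lin_subspace V" and "finite K" and "\<And>k. k \<in> K \<Longrightarrow> v k \<in> V"
  shows "(\<lambda>i. \<Sum>k\<in>K. c k * v k i) \<in> V"
  using assms(2,3)
proof (induction K rule: finite_induct)
  case empty
  show ?case using lin_subspaceD(1)[OF V] by simp
next
  case (insert k K)
  have "(\<lambda>i. \<Sum>k\<in>K. c k * v k i) \<in> V" by (rule insert.IH) (rule insert.prems, simp)
  from lin_subspaceD(2)[OF V this insert.prems[OF insertI1], of "c k"]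
  show ?case using insert.hyps by (simp add: add.commute)
qed

definition delta_on :: "'a set \<Rightarrow> ('a \<Rightarrow> 'a \<Rightarrow> real) \<Rightarrow> bool" where
  "delta_on P v \<longleftrightarrow> (\<forall>q\<in>P. \<forall>i\<in>P. v q i = (if i = q then 1 else 0))"

text \<open>A basis in reduced echelon form: the coordinates of a vector are its own entries at the
  pivot rows \<open>P\<close>, so only the entries of a basis vector outside \<open>P\<close> are
  unknown. The spanning condition looks at the rows in \<open>N\<close> alone.\<close>

definition delta_basis :: "'a set \<Rightarrow> ('a \<Rightarrow> real) set \<Rightarrow> 'a set \<Rightarrow> ('a \<Rightarrow> 'a \<Rightarrow> real) \<Rightarrow> bool" where
  "delta_basis N V P v \<longleftrightarrow> P \<subseteq> N \<and> (\<forall>q\<in>P. v q \<in> V) \<and> delta_on P v \<and>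
     (\<forall>u\<in>V. \<forall>i\<in>N. u i = (\<Sum>q\<in>P. u q * v q i))"

lemma delta_on_combination:
  assumes "delta_on P v" "finite P" "i \<in> P"
  shows "(\<Sum>q\<in>P. c q * v q i) = c i"
proof -
  have "(\<Sum>q\<in>P. c q * v q i) = (\<Sum>q\<in>P. c q * (if i = q then 1 else 0))"
    using assms by (intro sum.cong) (auto simp: delta_on_def)
  then show ?thesis using assms by (simp add: if_distrib cong: if_cong)
qed

lemma delta_on_indep:
  assumes "delta_on P v" "finite P" "P \<subseteq> R"
  shows "indep_on R P v"
proof (rule indep_onI)
  fix c k assume c: "\<And>i. i \<in> R \<Longrightarrow> (\<Sum>k\<in>P. c k * v k i) = 0" and k: "k \<in> P"
  have "(\<Sum>q\<in>P. c q * v q k) = 0" by (rule c[OF subsetD[OF assms(3) k]])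
  then show "c k = 0" using delta_on_combination[OF assms(1,2) k, of c] by simp
qed

text \<open>Take a largest admissible pivot set. A vector that is not reproduced leaves a remainder
  that vanishes on the pivots but not at some row \<open>i\<close>, so \<open>i\<close> could be
  added. Only the pivot rows \<open>P0\<close> are preserved; the vectors at these pivots may
  change, which \<open>delta_basis_split\<close> repairs.\<close>

lemma delta_basis_extend:
  assumes N: "finite N" and V: "lin_subspace V" and P0: "P0 \<subseteq> N" "\<And>q. q \<in> P0 \<Longrightarrow> v0 q \<in> V" "delta_on P0 v0"
  shows "\<exists>P v. P0 \<subseteq> P \<and> delta_basis N V P v"
proof -
  define good where "good = (\<lambda>P. P0 \<subseteq> P \<and> P \<subseteq> N \<and> (\<exists>v. (\<forall>q\<in>P. v q \<in> V) \<and> delta_on P v))"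
  have "good P0" unfolding good_def by (intro conjI exI[of _ v0] ballI P0 subset_refl)
  moreover have goodN: "P \<subseteq> N" if "good P" for P using that unfolding good_def by (elim conjE)
  then have "\<forall>P. good P \<longrightarrow> card P < Suc (card N)" using card_mono[OF N] by (simp add: less_Suc_eq_le)
  ultimately obtain P where P: "good P" "\<And>P'. good P' \<Longrightarrow> card P' \<le> card P"
    using ex_has_greatest_nat[of good P0 card "Suc (card N)"] by auto
  from P(1) obtain v where v0: "P0 \<subseteq> P" "P \<subseteq> N" "\<forall>q\<in>P. v q \<in> V" "delta_on P v"
    unfolding good_def by (elim conjE exE)
  note v = v0(1,2) bspec[OF v0(3)] v0(4)
  have finP: "finite P" by (rule finite_subset[OF v(2) N])
  have add: "(\<lambda>i. u i + c * w i) \<in> V" if "u \<in> V" "w \<in> V" for u w c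
    using that by (rule lin_subspaceD(2)[OF V])
  have "u i = (\<Sum>q\<in>P. u q * v q i)" if u: "u \<in> V" and i: "i \<in> N" for u i
  proof (rule ccontr)
    assume ne: "u i \<noteq> (\<Sum>q\<in>P. u q * v q i)"
    define w where "w = (\<lambda>i. u i + (-1) * (\<Sum>q\<in>P. u q * v q i))"
    have wV: "w \<in> V" unfolding w_def by (intro add u lin_subspace_sum V finP v)
    have wP: "w q = 0" if "q \<in> P" for q
      unfolding w_def using delta_on_combination[OF v(4) finP that, of u] by simp
    have wi: "w i \<noteq> 0" using ne by (simp add: w_def)
    have iP: "i \<notin> P" using wP wi by auto
    \<comment> \<open>\<open>z\<close> is the remainder scaled to 1 at the new pivot
      \<open>i\<close>, and \<open>v'\<close> clears row \<open>i\<close> from the old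
      vectors.\<close>
    define z where "z = (\<lambda>j. w j / w i)"
    have zV: "z \<in> V"
      unfolding z_def using lin_subspaceD(2)[OF V lin_subspaceD(1)[OF V] wV, of "1 / w i"] by simp
    define v' where "v' = (\<lambda>q. if q = i then z else (\<lambda>j. v q j + (- v q i) * z j))"
    have v'V: "v' q \<in> V" if "q \<in> insert i P" for q
    proof (cases "q = i")
      case True then show ?thesis using zV by (simp add: v'_def)
    next
      case False
      then have "q \<in> P" using that by simp
      moreover have "v' q = (\<lambda>j. v q j + (- v q i) * z j)" using False by (simp add: v'_def)
      ultimately show ?thesis using add[OF v(3) zV, of q "- v q i"] by (simp only:)
    qed
    have "delta_on (insert i P) v'"
      unfolding delta_on_def
    proof (intro ballI)
      fix q j assume q: "q \<in> insert i P" and j: "j \<in> insert i P"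
      have vqj: "v q j = (if j = q then 1 else 0)" if "q \<in> P" "j \<in> P"
        using v(4) that by (simp add: delta_on_def)
      have zj: "z j = (if j = i then 1 else 0)" using j wP[of j] wi by (auto simp: z_def)
      show "v' q j = (if j = q then 1 else 0)"
        using q j vqj zj iP by (cases "q = i"; cases "j = i") (simp_all add: v'_def)
    qed
    moreover have "P0 \<subseteq> insert i P" "insert i P \<subseteq> N" using v(1,2) i by auto
    ultimately have "good (insert i P)" unfolding good_def by (intro conjI exI[of _ v'] ballI v'V)
    then show False using P(2)[of "insert i P"] iP finP by simp
  qed
  then show ?thesis unfolding delta_basis_def
    by (intro exI[of _ P] exI[of _ v] conjI ballI v)
qed

lemma delta_basis_exists: "finite N \<Longrightarrow> lin_subspace V \<Longrightarrow> \<exists>P v. delta_basis N V P v"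
  using delta_basis_extend[of N V "{}"] by (auto simp: delta_on_def)

section \<open>Polynomial functions and algebraic independence\<close>

text \<open>Polynomials enter as functions, with coefficients from \<open>C\<close> and variables
  from \<open>I\<close>. Over the reals the zero function represents the zero polynomial, so
  independence can be expressed without formal polynomials.\<close>

inductive_set polyfun :: "real set \<Rightarrow> 'i set \<Rightarrow> (('i \<Rightarrow> real) \<Rightarrow> real) set" for C I where
  pf_const: "c \<in> C \<Longrightarrow> (\<lambda>_. c) \<in> polyfun C I"
| pf_var: "i \<in> I \<Longrightarrow> (\<lambda>x. x i) \<in> polyfun C I"
| pf_add: "f \<in> polyfun C I \<Longrightarrow> g \<in> polyfun C I \<Longrightarrow> (\<lambda>x. f x + g x) \<in> polyfun C I"
| pf_mult: "f \<in> polyfun C I \<Longrightarrow> g \<in> polyfun C I \<Longrightarrow> (\<lambda>x. f x * g x) \<in> polyfun C I"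

lemma polyfun_mono: "f \<in> polyfun C I \<Longrightarrow> C \<subseteq> D \<Longrightarrow> I \<subseteq> J \<Longrightarrow> f \<in> polyfun D J"
  by (induction rule: polyfun.induct) (auto intro: polyfun.intros)

lemma polyfun_sum:
  assumes "0 \<in> C" "\<And>k. k \<in> K \<Longrightarrow> f k \<in> polyfun C I"
  shows "(\<lambda>x. \<Sum>k\<in>K. f k x) \<in> polyfun C I"
  using assms(2)
proof (induction K rule: infinite_finite_induct)
  case (insert k K)
  then have "(\<lambda>x. f k x + (\<Sum>k\<in>K. f k x)) \<in> polyfun C I" by (intro pf_add) auto
  then show ?case using insert.hyps by simp
qed (auto intro: pf_const assms(1))

lemma polyfun_prod:
  assumes "1 \<in> C" "\<And>k. k \<in> K \<Longrightarrow> f k \<in> polyfun C I"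
  shows "(\<lambda>x. \<Prod>k\<in>K. f k x) \<in> polyfun C I"
  using assms(2)
proof (induction K rule: infinite_finite_induct)
  case (insert k K)
  then have "(\<lambda>x. f k x * (\<Prod>k\<in>K. f k x)) \<in> polyfun C I" by (intro pf_mult) auto
  then show ?case using insert.hyps by simp
qed (auto intro: pf_const assms(1))

lemma polyfun_power: "1 \<in> C \<Longrightarrow> f \<in> polyfun C I \<Longrightarrow> (\<lambda>x. f x ^ n) \<in> polyfun C I"
  by (induction n) (auto intro: polyfun.intros)

lemma polyfun_diff:
  assumes "-1 \<in> C" "f \<in> polyfun C I" "g \<in> polyfun C I"
  shows "(\<lambda>x. f x - g x) \<in> polyfun C I"
  using pf_add[OF assms(2) pf_mult[OF pf_const[OF assms(1)] assms(3)]] by simp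

lemma polyfun_det:
  assumes "0 \<in> C" "1 \<in> C" "-1 \<in> C" "\<And>s t. s < k \<Longrightarrow> t < k \<Longrightarrow> f s t \<in> polyfun C I"
  shows "(\<lambda>x. det (mat k k (\<lambda>(s,t). f s t x))) \<in> polyfun C I"
proof -
  have "det (mat k k (\<lambda>(s,t). f s t x)) =
      (\<Sum>p \<in> {p. p permutes {0..<k}}. signof p * (\<Prod>s = 0..<k. f s (p s) x))" for x
    unfolding det_def by (auto intro!: sum.cong prod.cong dest!: permutes_in_image[THEN iffD2, rotated])
  moreover have "(\<lambda>x. \<Sum>p \<in> {p. p permutes {0..<k}}. signof p * (\<Prod>s = 0..<k. f s (p s) x)) \<in> polyfun C I"
  proof (intro polyfun_sum pf_mult polyfun_prod pf_const assms)
    fix p :: "nat \<Rightarrow> nat"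
    show "signof p \<in> C" using assms(2,3) by (cases "evenperm p") (auto simp: sign_def)
  next
    fix p s assume "p \<in> {p. p permutes {0..<k}}" "s \<in> {0..<k}"
    then show "s < k" "p s < k" using permutes_in_image[of p "{0..<k}" s] by auto
  qed
  ultimately show ?thesis by simp
qed

lemma polyfun_gram:
  assumes "0 \<in> C" "1 \<in> C" "-1 \<in> C" "\<And>s i. s < k \<Longrightarrow> i \<in> R \<Longrightarrow> (\<lambda>x. v x s i) \<in> polyfun C I"
  shows "(\<lambda>x. gram R k (v x)) \<in> polyfun C I"
  unfolding gram_def by (intro polyfun_det polyfun_sum pf_mult assms)

lemma polyfun_subst:
  assumes "f \<in> polyfun C I" "\<And>i. i \<in> I \<Longrightarrow> (\<lambda>x. s x i) \<in> polyfun C J"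
  shows "(\<lambda>x. f (s x)) \<in> polyfun C J"
  using assms(1) by (induction rule: polyfun.induct) (auto intro: polyfun.intros assms(2))

lemma polyfun_cong:
  assumes "f \<in> polyfun C I" "\<And>i. i \<in> I \<Longrightarrow> x i = y i"
  shows "f x = f y"
  using assms(1) by (induction rule: polyfun.induct) (auto simp: assms(2))

text \<open>Questions about nonroots and null sets are reduced to lines, where a nonzero univariate
  polynomial has finitely many roots.\<close>

lemma polyfun_line:
  assumes "f \<in> polyfun UNIV I"
  shows "\<exists>q. \<forall>t. f (\<lambda>i. u i + t * w i) = poly q t"
  using assms
proof (induction rule: polyfun.induct)
  case (pf_const c) show ?case by (intro exI[of _ "[:c:]"]) simp
next
  case (pf_var i) show ?case by (intro exI[of _ "[:u i, w i:]"]) simp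
next
  case (pf_add f g)
  then obtain q r where "\<forall>t. f (\<lambda>i. u i + t * w i) = poly q t" "\<forall>t. g (\<lambda>i. u i + t * w i) = poly r t" by blast
  then show ?case by (intro exI[of _ "q + r"]) simp
next
  case (pf_mult f g)
  then obtain q r where "\<forall>t. f (\<lambda>i. u i + t * w i) = poly q t" "\<forall>t. g (\<lambda>i. u i + t * w i) = poly r t" by blast
  then show ?case by (intro exI[of _ "q * r"]) simp
qed

lemma polyfun_update:
  assumes "f \<in> polyfun UNIV I"
  shows "\<exists>q. \<forall>t. f (x(i := t)) = poly q t"
proof -
  obtain q where "\<forall>t. f (\<lambda>j. (x(i := 0)) j + t * (if j = i then 1 else 0)) = poly q t"
    using polyfun_line[OF assms, of "x(i := 0)" "\<lambda>j. if j = i then 1 else 0"] by auto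
  moreover have "(\<lambda>j. (x(i := 0)) j + t * (if j = i then 1 else 0)) = x(i := t)" for t by auto
  ultimately show ?thesis by auto
qed

text \<open>Join a common nonroot of the earlier polynomials to a nonroot of the new one. On this
  line, which stays in \<open>V\<close>, all of them restrict to nonzero univariate polynomials, so
  all but finitely many points work.\<close>

lemma common_nonroot:
  assumes "finite F" "\<And>f. f \<in> F \<Longrightarrow> f \<in> polyfun UNIV I"
    and V: "\<And>x y t. x \<in> V \<Longrightarrow> y \<in> V \<Longrightarrow> (\<lambda>i. x i + t * (y i - x i)) \<in> V"
    and "\<And>f. f \<in> F \<Longrightarrow> \<exists>x\<in>V. f x \<noteq> 0" and "V \<noteq> {}"
  shows "\<exists>x\<in>V. \<forall>f\<in>F. f x \<noteq> 0"
  using assms(1,2,4)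
proof (induction F rule: finite_induct)
  case empty
  then show ?case using \<open>V \<noteq> {}\<close> by (simp add: ex_in_conv)
next
  case (insert f F)
  have "\<exists>x\<in>V. \<forall>f\<in>F. f x \<noteq> 0" by (rule insert.IH) (use insert.prems in simp_all)
  then obtain x where x: "x \<in> V" "\<And>f. f \<in> F \<Longrightarrow> f x \<noteq> 0" by (elim bexE) simp
  obtain y where y: "y \<in> V" "f y \<noteq> 0" using insert.prems(2)[OF insertI1] by (elim bexE)
  have "\<exists>q. q \<noteq> 0 \<and> (\<forall>t. g (\<lambda>i. x i + t * (y i - x i)) = poly q t)" if g: "g \<in> insert f F" for g
  proof -
    obtain q where q: "\<And>t. g (\<lambda>i. x i + t * (y i - x i)) = poly q t"
      using polyfun_line[OF insert.prems(1)[OF g], of x "\<lambda>i. y i - x i"] by auto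
    have "q \<noteq> 0"
    proof (cases "g = f")
      case True
      then have "poly q 1 \<noteq> 0" using q[of 1] y by simp
      then show ?thesis by auto
    next
      case False
      then have "g x \<noteq> 0" using x(2) g by simp
      then have "poly q 0 \<noteq> 0" using q[of 0] by simp
      then show ?thesis by auto
    qed
    then show ?thesis using q by blast
  qed
  then obtain Q where Q: "\<And>g. g \<in> insert f F \<Longrightarrow> Q g \<noteq> 0"
    "\<And>g t. g \<in> insert f F \<Longrightarrow> g (\<lambda>i. x i + t * (y i - x i)) = poly (Q g) t" by metis
  have "finite (\<Union>g\<in>insert f F. {t. poly (Q g) t = 0})"
    using insert.hyps Q(1) by (intro finite_UN_I poly_roots_finite) auto
  then obtain t where t: "t \<notin> (\<Union>g\<in>insert f F. {t. poly (Q g) t = 0})"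
    using ex_new_if_finite[OF infinite_UNIV_char_0[where 'a=real]] by blast
  show ?case
    by (rule bexI[OF _ V[OF x(1) y(1), of t]]) (use t Q(2) in auto)
qed

text \<open>One coordinate after another is moved to an integer that avoids finitely many roots.
  This later freezes auxiliary weights at rational values while all other variables stay
  put.\<close>

lemma rational_nonroot:
  assumes "finite J" "f \<in> polyfun UNIV I" "f x \<noteq> 0"
  shows "\<exists>y. (\<forall>i\<in>J. y i \<in> \<rat>) \<and> (\<forall>i. i \<notin> J \<longrightarrow> y i = x i) \<and> f y \<noteq> 0"
  using assms(1)
proof (induction J rule: finite_induct)
  case empty
  then show ?case using assms(3) by (intro exI[of _ x]) simp
next
  case (insert j J)
  then obtain y where y: "\<And>i. i \<in> J \<Longrightarrow> y i \<in> \<rat>" "\<And>i. i \<notin> J \<Longrightarrow> y i = x i" "f y \<noteq> 0" by blast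
  obtain q where q: "\<And>t. f (y(j := t)) = poly q t" using polyfun_update[OF assms(2)] by blast
  have "q \<noteq> 0" using q[of "y j"] y(3) by auto
  then have "finite {t. poly q t = 0}" by (rule poly_roots_finite)
  moreover have "infinite (\<int> :: real set)" 
    unfolding Ints_def using finite_imageD[of real_of_int UNIV] infinite_UNIV_int by (auto simp: inj_def)
  ultimately obtain t where t: "t \<in> \<int>" "poly q t \<noteq> 0" by (metis (mono_tags) finite_subset mem_Collect_eq subsetI)
  show ?case
  proof (intro exI[of _ "y(j := t)"] conjI ballI allI impI)
    fix i assume "i \<in> insert j J"
    then show "(y(j := t)) i \<in> \<rat>" using y(1) t(1) Ints_subset_Rats by auto
  next
    show "f (y(j := t)) \<noteq> 0" using t(2) q by simp
  qed (use y in auto)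
qed

section \<open>Zero sets are null sets; generic points\<close>

lemma polyfun_measurable:
  assumes "f \<in> polyfun UNIV I"
  shows "f \<in> borel_measurable (PiM I (\<lambda>_. lborel))"
  using assms by (induction rule: polyfun.induct) (auto intro: measurable_component_singleton[THEN measurable_compose])

text \<open>Fubini with one variable split off. Freezing it at \<open>x0 i\<close> gives a nonzero
  polynomial \<open>g\<close> in the other variables; off the null set of zeros of \<open>g\<close>,
  the slice in direction \<open>i\<close> is a nonzero univariate polynomial and has finitely many
  roots.\<close>

lemma polyfun_null_set:
  assumes "finite I" "f \<in> polyfun UNIV I" "f x0 \<noteq> 0"
  shows "{x \<in> space (PiM I (\<lambda>_. lborel)). f x = 0} \<in> null_sets (PiM I (\<lambda>_. lborel))"
  using assms
proof (induction I arbitrary: f x0 rule: finite_induct)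
  case empty
  have "f x = f x0" for x by (rule polyfun_cong[OF empty.prems(1)]) simp
  then have "{x \<in> space (PiM {} (\<lambda>_::'a. lborel :: real measure)). f x = 0} = {}"
    using empty.prems(2) by (metis (mono_tags, lifting) Collect_empty_eq)
  then show ?case by (simp only: null_sets.empty_sets)
next
  case (insert i I)
  interpret product_sigma_finite "\<lambda>_::'a. lborel :: real measure" by standard
  let ?M = "PiM I (\<lambda>_. lborel :: real measure)"
  let ?M' = "PiM (insert i I) (\<lambda>_. lborel :: real measure)"
  define A where "A = {x \<in> space ?M'. f x = 0}"
  have A[measurable]: "A \<in> sets ?M'"
    unfolding A_def using polyfun_measurable[OF insert.prems(1)] by measurable
  define g where "g = (\<lambda>x. f (x(i := x0 i)))"
  have g: "g \<in> polyfun UNIV I" unfolding g_def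
  proof (rule polyfun_subst[OF insert.prems(1), where s = "\<lambda>x. x(i := x0 i)"])
    fix j assume "j \<in> insert i I"
    then show "(\<lambda>x. (x(i := x0 i)) j) \<in> polyfun UNIV I"
      by (cases "j = i") (auto intro: pf_const pf_var)
  qed
  have "g x0 \<noteq> 0" using insert.prems(2) by (simp add: g_def)
  then have N: "{x \<in> space ?M. g x = 0} \<in> null_sets ?M" using insert.IH[OF g] by blast
  have "emeasure ?M' A = (\<integral>\<^sup>+ x. indicator A x \<partial>?M')" by (simp add: A)
  also have "\<dots> = (\<integral>\<^sup>+ x. (\<integral>\<^sup>+ y. indicator A (x(i := y)) \<partial>lborel) \<partial>?M)"
    by (rule product_nn_integral_insert) (use insert.hyps in auto)
  also have "\<dots> = (\<integral>\<^sup>+ x. 0 \<partial>?M)"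
  proof (rule nn_integral_cong_AE)
    have "AE x in ?M. \<not> g x = 0"
      using N by (auto intro!: AE_I'[OF N])
    then show "AE x in ?M. (\<integral>\<^sup>+ y. indicator A (x(i := y)) \<partial>lborel) = 0"
    proof (eventually_elim)
      case (elim x)
      obtain q where q: "\<And>t. f (x(i := t)) = poly q t" using polyfun_update[OF insert.prems(1)] by blast
      have "q \<noteq> 0" using q[of "x0 i"] elim by (auto simp: g_def)
      then have fin: "finite {t. poly q t = 0}" by (rule poly_roots_finite)
      have "(\<integral>\<^sup>+ y. indicator A (x(i := y)) \<partial>lborel) \<le> (\<integral>\<^sup>+ y. indicator {t. poly q t = 0} y \<partial>lborel)"
        by (rule nn_integral_mono) (auto simp: A_def q indicator_def)
      also have "\<dots> = emeasure lborel {t. poly q t = 0}" using fin by (simp add: borel_closed finite_imp_closed)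
      also have "\<dots> = 0" using fin by (rule emeasure_lborel_countable[OF countable_finite])
      finally show ?case by simp
    qed
  qed
  finally show ?case using A by (simp add: A_def null_sets_def)
qed

text \<open>Syntax trees witness that there are only countably many polynomial functions with
  rational coefficients.\<close>

datatype 'i polyterm = PConst rat | PVar 'i | PAdd "'i polyterm" "'i polyterm" | PMult "'i polyterm" "'i polyterm"

instance polyterm :: (countable) countable by countable_datatype

primrec polyterm_eval :: "'i polyterm \<Rightarrow> ('i \<Rightarrow> real) \<Rightarrow> real" where
  "polyterm_eval (PConst c) = (\<lambda>_. of_rat c)"
| "polyterm_eval (PVar i) = (\<lambda>x. x i)"
| "polyterm_eval (PAdd s t) = (\<lambda>x. polyterm_eval s x + polyterm_eval t x)"
| "polyterm_eval (PMult s t) = (\<lambda>x. polyterm_eval s x * polyterm_eval t x)"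

lemma countable_polyfun_Rats: "countable (polyfun \<rat> (I :: 'i :: countable set))"
proof (rule countable_subset)
  show "polyfun \<rat> I \<subseteq> range polyterm_eval"
  proof
    fix f assume "f \<in> polyfun \<rat> I"
    then show "f \<in> range polyterm_eval"
    proof (induction rule: polyfun.induct)
      case (pf_const c)
      then obtain q where "c = of_rat q" by (auto elim: Rats_cases)
      then show ?case by (intro range_eqI[of _ _ "PConst q"]) simp
    next
      case (pf_var i) then show ?case by (intro range_eqI[of _ _ "PVar i"]) simp
    next
      case (pf_add f g)
      from pf_add.IH obtain s t where "f = polyterm_eval s" "g = polyterm_eval t" by (elim rangeE)
      then show ?case by (intro range_eqI[of _ _ "PAdd s t"]) simp
    next
      case (pf_mult f g)
      from pf_mult.IH obtain s t where "f = polyterm_eval s" "g = polyterm_eval t" by (elim rangeE)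
      then show ?case by (intro range_eqI[of _ _ "PMult s t"]) simp
    qed
  qed
qed auto

text \<open>Algebraic independence over the rationals, phrased as a transfer principle: a rational
  polynomial that is nonzero anywhere is nonzero at \<open>p\<close>. In this way special examples
  give statements about the generic matrix.\<close>

definition alg_indep :: "'i set \<Rightarrow> ('i \<Rightarrow> real) \<Rightarrow> bool" where
  "alg_indep I p \<longleftrightarrow> (\<forall>f\<in>polyfun \<rat> I. f p = 0 \<longrightarrow> (\<forall>x. f x = 0))"

lemma alg_indepD: "alg_indep I p \<Longrightarrow> f \<in> polyfun \<rat> I \<Longrightarrow> f x \<noteq> 0 \<Longrightarrow> f p \<noteq> 0"
  unfolding alg_indep_def by auto

lemma alg_indep_mono: "alg_indep I p \<Longrightarrow> J \<subseteq> I \<Longrightarrow> alg_indep J p"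
  unfolding alg_indep_def using polyfun_mono[of _ \<rat> J \<rat> I] by auto

text \<open>A countable union of zero sets, one for each nonzero rational polynomial. It becomes the
  exceptional set of the main result and is independent of every sampling pattern.\<close>

lemma alg_dependent_null_set:
  fixes I :: "'i :: countable set"
  assumes "finite I"
  shows "{x \<in> space (PiM I (\<lambda>_. lborel)). \<not> alg_indep I x} \<in> null_sets (PiM I (\<lambda>_. lborel))"
proof -
  let ?M = "PiM I (\<lambda>_. lborel :: real measure)"
  define F where "F = {f \<in> polyfun \<rat> I. \<exists>x. f x \<noteq> 0}"
  have "countable F" unfolding F_def using countable_polyfun_Rats[of I] by (rule countable_subset[rotated]) auto
  then have "(\<Union>f\<in>F. {x \<in> space ?M. f x = 0}) \<in> null_sets ?M"
  proof (rule null_sets_UN')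
    fix f assume "f \<in> F"
    then have f: "f \<in> polyfun \<rat> I" "\<exists>x. f x \<noteq> 0" unfolding F_def by simp_all
    from f(2) obtain x0 where "f x0 \<noteq> 0" by (elim exE)
    moreover have "f \<in> polyfun UNIV I" by (rule polyfun_mono[OF f(1)]) simp_all
    ultimately show "{x \<in> space ?M. f x = 0} \<in> null_sets ?M"
      by (intro polyfun_null_set[OF assms])
  qed
  also have "(\<Union>f\<in>F. {x \<in> space ?M. f x = 0}) = {x \<in> space ?M. \<not> alg_indep I x}"
    unfolding F_def alg_indep_def by auto
  finally show ?thesis .
qed

text \<open>Otherwise the whole space would be null, although the unit cube has measure 1. The lemma
  supplies auxiliary generic entries unrelated to the given matrix.\<close>

lemma alg_indep_exists:
  fixes I :: "'i :: countable set"
  assumes "finite I"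
  shows "\<exists>x. alg_indep I x"
proof (rule ccontr)
  assume "\<not> ?thesis"
  then have "space (PiM I (\<lambda>_. lborel :: real measure)) \<in> null_sets (PiM I (\<lambda>_. lborel))"
    using alg_dependent_null_set[OF assms] by simp
  then have 0: "emeasure (PiM I (\<lambda>_. lborel :: real measure)) (space (PiM I (\<lambda>_. lborel))) = 0" by auto
  interpret product_sigma_finite "\<lambda>_::'i. lborel :: real measure" by standard
  have "emeasure (PiM I (\<lambda>_. lborel :: real measure)) (PiE I (\<lambda>_. {0..1})) = (\<Prod>i\<in>I. emeasure lborel {0..1::real})"
    by (rule emeasure_PiM[OF assms]) simp
  also have "\<dots> = 1" by simp
  finally have "1 \<le> emeasure (PiM I (\<lambda>_. lborel :: real measure)) (space (PiM I (\<lambda>_. lborel)))"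
    using emeasure_space[of "PiM I (\<lambda>_. lborel :: real measure)" "PiE I (\<lambda>_. {0..1})"] by simp
  then show False using 0 by simp
qed

section \<open>Generated fields and transcendence degree\<close>

text \<open>The subfield of the reals generated by \<open>Y\<close>; the convention
  \<open>inverse 0 = 0\<close> permits an unconditional rule for inverses.\<close>

inductive_set ratgen :: "real set \<Rightarrow> real set" for Y where
  ratgen_base: "y \<in> Y \<Longrightarrow> y \<in> ratgen Y"
| ratgen_one: "1 \<in> ratgen Y"
| ratgen_diff: "x \<in> ratgen Y \<Longrightarrow> y \<in> ratgen Y \<Longrightarrow> x - y \<in> ratgen Y"
| ratgen_mult: "x \<in> ratgen Y \<Longrightarrow> y \<in> ratgen Y \<Longrightarrow> x * y \<in> ratgen Y"
| ratgen_inverse: "x \<in> ratgen Y \<Longrightarrow> inverse x \<in> ratgen Y"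

lemma real_subfield_ratgen: "real_subfield (ratgen Y)"
proof -
  have 0: "0 \<in> ratgen Y" using ratgen_diff[OF ratgen_one ratgen_one] by simp
  have "x + y \<in> ratgen Y" if "x \<in> ratgen Y" "y \<in> ratgen Y" for x y
    using ratgen_diff[OF that(1) ratgen_diff[OF 0 that(2)]] by simp
  then show ?thesis
    unfolding real_subfield_def divide_inverse using 0 by (auto intro: ratgen.intros)
qed

lemmas ratgen_field = real_subfieldD[OF real_subfield_ratgen]
lemmas ratgen_uminus = real_subfield_uminus[OF real_subfield_ratgen]
lemmas ratgen_sum = real_subfield_sum[OF real_subfield_ratgen]

lemma ratgen_Rats: "c \<in> \<rat> \<Longrightarrow> c \<in> ratgen Y"
proof -
  have n: "real n \<in> ratgen Y" for n by (induction n) (auto intro: ratgen_field)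
  have "real_of_int z \<in> ratgen Y" for z
    by (cases z rule: int_cases2) (auto intro: n ratgen_uminus)
  then show "c \<in> \<rat> \<Longrightarrow> c \<in> ratgen Y" by (elim Rats_cases') (simp add: ratgen_field)
qed

lemma ratgen_least:
  assumes "Y \<subseteq> ratgen Z" "x \<in> ratgen Y"
  shows "x \<in> ratgen Z"
  using assms(2) by (induction rule: ratgen.induct) (use assms(1) in \<open>auto intro: ratgen.intros\<close>)

lemma ratgen_mono: "Y \<subseteq> Z \<Longrightarrow> x \<in> ratgen Y \<Longrightarrow> x \<in> ratgen Z"
  by (rule ratgen_least) (auto intro: ratgen_base)

lemma polyfun_in_ratgen:
  assumes "f \<in> polyfun \<rat> I" "\<And>i. i \<in> I \<Longrightarrow> p i \<in> ratgen Y"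
  shows "f p \<in> ratgen Y"
  using assms(1) by (induction rule: polyfun.induct) (auto intro: ratgen_Rats assms(2) ratgen_field)

section \<open>Transcendence degree by counting monomials\<close>

abbreviation monexp :: "'l set \<Rightarrow> nat \<Rightarrow> ('l \<Rightarrow> nat) set" where
  "monexp L D \<equiv> PiE L (\<lambda>_. {..D})"

text \<open>Bounding each exponent separately, instead of the total degree, gives exactly
  \<open>(D + 1) ^ card L\<close> exponent tuples, and the bounds simply add up under
  multiplication.\<close>

definition monomial_span :: "'l set \<Rightarrow> ('l \<Rightarrow> real) \<Rightarrow> nat \<Rightarrow> real set" where
  "monomial_span L y D = {s. \<exists>c. (\<forall>b. c b \<in> \<rat>) \<and> s = (\<Sum>b\<in>monexp L D. c b * (\<Prod>l\<in>L. y l ^ b l))}"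

context
  fixes L :: "'l set" and y :: "'l \<Rightarrow> real"
  assumes L: "finite L"
begin

lemma monomial_span_add:
  assumes "s \<in> monomial_span L y D" "t \<in> monomial_span L y D"
  shows "s + t \<in> monomial_span L y D"
proof -
  from assms obtain c d where "\<forall>b. c b \<in> \<rat>" "s = (\<Sum>b\<in>monexp L D. c b * (\<Prod>l\<in>L. y l ^ b l))"
    "\<forall>b. d b \<in> \<rat>" "t = (\<Sum>b\<in>monexp L D. d b * (\<Prod>l\<in>L. y l ^ b l))"
    unfolding monomial_span_def by blast
  then show ?thesis unfolding monomial_span_def
    by (intro CollectI exI[of _ "\<lambda>b. c b + d b"]) (simp add: distrib_right sum.distrib)
qed

lemma monomial_span_scale:
  assumes "s \<in> monomial_span L y D" "a \<in> \<rat>"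
  shows "a * s \<in> monomial_span L y D"
proof -
  from assms obtain c where "\<forall>b. c b \<in> \<rat>" "s = (\<Sum>b\<in>monexp L D. c b * (\<Prod>l\<in>L. y l ^ b l))"
    unfolding monomial_span_def by blast
  then show ?thesis unfolding monomial_span_def using assms(2)
    by (intro CollectI exI[of _ "\<lambda>b. a * c b"]) (simp add: sum_distrib_left mult.assoc)
qed

lemma monomial_span_monomial:
  assumes "b \<in> monexp L D"
  shows "(\<Prod>l\<in>L. y l ^ b l) \<in> monomial_span L y D"
  unfolding monomial_span_def
proof (intro CollectI exI[of _ "\<lambda>b'. if b' = b then 1 else 0"] conjI)
  have "finite (monexp L D)" using L by (simp add: finite_PiE)
  then show "(\<Prod>l\<in>L. y l ^ b l) = (\<Sum>b'\<in>monexp L D. (if b' = b then 1 else 0) * (\<Prod>l\<in>L. y l ^ b' l))"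
    using assms by (simp add: if_distrib if_distribR cong: if_cong)
qed auto

lemma monomial_span_0: "0 \<in> monomial_span L y D"
  unfolding monomial_span_def by (intro CollectI exI[of _ "\<lambda>_. 0"]) simp

lemma monomial_span_sum:
  assumes "finite K" "\<And>k. k \<in> K \<Longrightarrow> f k \<in> monomial_span L y D"
  shows "sum f K \<in> monomial_span L y D"
  using assms by (induction K rule: finite_induct) (auto intro: monomial_span_0 monomial_span_add)

lemma monomial_span_1: "1 \<in> monomial_span L y D"
  using monomial_span_monomial[of "\<lambda>l\<in>L. 0" D] by simp

lemma monomial_span_base:
  assumes "l \<in> L"
  shows "y l \<in> monomial_span L y 1"
proof -
  have "(\<Prod>m\<in>L. y m ^ (\<lambda>m\<in>L. if m = l then 1 else 0) m) = (\<Prod>m\<in>L. if m = l then y m else 1)"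
    by (intro prod.cong) auto
  also have "\<dots> = y l" using assms L by simp
  finally show ?thesis using monomial_span_monomial[of "\<lambda>m\<in>L. if m = l then 1 else 0" 1] by simp
qed

lemma monomial_span_mult:
  assumes "s \<in> monomial_span L y D" "t \<in> monomial_span L y E"
  shows "s * t \<in> monomial_span L y (D + E)"
proof -
  from assms(1) obtain c where c: "\<And>b. c b \<in> \<rat>" "s = (\<Sum>b\<in>monexp L D. c b * (\<Prod>l\<in>L. y l ^ b l))"
    unfolding monomial_span_def by blast
  from assms(2) obtain d where d: "\<And>b. d b \<in> \<rat>" "t = (\<Sum>b\<in>monexp L E. d b * (\<Prod>l\<in>L. y l ^ b l))"
    unfolding monomial_span_def by blast
  have "s * t = (\<Sum>b\<in>monexp L D. \<Sum>e\<in>monexp L E. (c b * d e) * ((\<Prod>l\<in>L. y l ^ b l) * (\<Prod>l\<in>L. y l ^ e l)))"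
    unfolding c(2) d(2) sum_product by (intro sum.cong refl) (simp only: ac_simps)
  also have "\<dots> \<in> monomial_span L y (D + E)"
  proof (intro monomial_span_sum)
    fix b e assume b: "b \<in> monexp L D" and e: "e \<in> monexp L E"
    have "(\<Prod>l\<in>L. y l ^ b l) * (\<Prod>l\<in>L. y l ^ e l) = (\<Prod>l\<in>L. y l ^ (\<lambda>l\<in>L. b l + e l) l)"
      by (subst prod.distrib[symmetric]) (intro prod.cong refl, simp add: power_add)
    also have "\<dots> \<in> monomial_span L y (D + E)"
      using b e by (intro monomial_span_monomial restrict_PiE_iff[THEN iffD2]) (auto simp: PiE_iff intro!: add_mono)
    finally show "(c b * d e) * ((\<Prod>l\<in>L. y l ^ b l) * (\<Prod>l\<in>L. y l ^ e l)) \<in> monomial_span L y (D + E)"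
      by (rule monomial_span_scale[OF _ Rats_mult[OF c(1) d(1)]])
  qed (use L in \<open>auto intro: finite_PiE\<close>)
  finally show ?thesis .
qed

lemma monomial_span_power: "s \<in> monomial_span L y D \<Longrightarrow> s ^ n \<in> monomial_span L y (n * D)"
  by (induction n) (auto intro: monomial_span_1 monomial_span_mult)

lemma monomial_span_prod:
  assumes "finite K" "\<And>k. k \<in> K \<Longrightarrow> f k \<in> monomial_span L y D"
  shows "prod f K \<in> monomial_span L y (card K * D)"
  using assms by (induction K rule: finite_induct) (auto intro: monomial_span_1 monomial_span_mult)

lemma ratgen_fraction:
  assumes "x \<in> ratgen (y ` L)"
  shows "\<exists>D g h. g \<in> monomial_span L y D \<and> h \<in> monomial_span L y D \<and> h \<noteq> 0 \<and> x = g / h"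
  using assms
proof (induction rule: ratgen.induct)
  case (ratgen_base v)
  then obtain l where "l \<in> L" "v = y l" by auto
  then show ?case using monomial_span_base monomial_span_1 by (intro exI[of _ 1] exI[of _ v] exI[of _ "1::real"]) auto
next
  case ratgen_one
  show ?case using monomial_span_1 by (intro exI[of _ 1] exI[of _ "1::real"]) auto
next
  case (ratgen_diff u v)
  then obtain D g h E g' h' where *: "g \<in> monomial_span L y D" "h \<in> monomial_span L y D" "h \<noteq> 0" "u = g / h"
    "g' \<in> monomial_span L y E" "h' \<in> monomial_span L y E" "h' \<noteq> 0" "v = g' / h'" by blast
  have "g * h' + (- 1) * (g' * h) \<in> monomial_span L y (D + E)"
    using monomial_span_mult[OF *(5,2)]
    by (intro monomial_span_add monomial_span_scale[of "g' * h"] monomial_span_mult[OF *(1,6)]) (auto simp: add.commute)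
  moreover have "u - v = (g * h' + (- 1) * (g' * h)) / (h * h')" "h * h' \<noteq> 0"
    using * by (simp_all add: field_simps)
  moreover have "h * h' \<in> monomial_span L y (D + E)" by (intro monomial_span_mult *)
  ultimately show ?case by blast
next
  case (ratgen_mult u v)
  then obtain D g h E g' h' where *: "g \<in> monomial_span L y D" "h \<in> monomial_span L y D" "h \<noteq> 0" "u = g / h"
    "g' \<in> monomial_span L y E" "h' \<in> monomial_span L y E" "h' \<noteq> 0" "v = g' / h'" by blast
  have "u * v = (g * g') / (h * h')" "h * h' \<noteq> 0"
    using * by simp_all
  moreover have "h * h' \<in> monomial_span L y (D + E)" "g * g' \<in> monomial_span L y (D + E)"
    by (intro monomial_span_mult *)+
  ultimately show ?case by blast
next
  case (ratgen_inverse u)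
  then obtain D g h where *: "g \<in> monomial_span L y D" "h \<in> monomial_span L y D" "h \<noteq> 0" "u = g / h" by blast
  show ?case
  proof (cases "g = 0")
    case True
    then show ?thesis using * monomial_span_0 by (intro exI[of _ D] exI[of _ "0::real"] exI[of _ h]) auto
  next
    case False
    then show ?thesis using * by (intro exI[of _ D] exI[of _ h] exI[of _ g]) auto
  qed
qed

lemma ratgen_common_denominator:
  assumes "finite K" "\<And>k. k \<in> K \<Longrightarrow> x k \<in> ratgen (y ` L)"
  shows "\<exists>D h. h \<in> monomial_span L y D \<and> h \<noteq> 0 \<and> (\<forall>k\<in>K. x k * h \<in> monomial_span L y D)"
  using assms
proof (induction K rule: finite_induct)
  case empty
  show ?case using monomial_span_1 by (intro exI[of _ 1] exI[of _ "1::real"]) auto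
next
  case (insert k K)
  then obtain D h where h: "h \<in> monomial_span L y D" "h \<noteq> 0" "\<And>k. k \<in> K \<Longrightarrow> x k * h \<in> monomial_span L y D"
    by auto
  obtain E g f where f: "g \<in> monomial_span L y E" "f \<in> monomial_span L y E" "f \<noteq> 0" "x k = g / f"
    using ratgen_fraction[OF insert.prems[OF insertI1]] by blast
  have "h * f \<in> monomial_span L y (D + E)" by (intro monomial_span_mult h f)
  moreover have "x k * (h * f) = h * g" using f(3,4) by simp
  then have "x k * (h * f) \<in> monomial_span L y (D + E)"
    using monomial_span_mult[OF h(1) f(1)] by (simp only:)
  moreover have "x j * (h * f) \<in> monomial_span L y (D + E)" if "j \<in> K" for j
    using monomial_span_mult[OF h(3)[OF that] f(2)] by (simp add: mult.assoc)
  ultimately show ?case using h(2) f(3) by (intro exI[of _ "D + E"] exI[of _ "h * f"]) auto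
qed

end

text \<open>Sort by powers of one variable: as a polynomial in its value \<open>t\<close> the sum
  vanishes identically, so every coefficient \<open>d m z\<close> is zero, and this is a relation in
  the remaining variables.\<close>

lemma monomials_independent:
  assumes "finite K" "\<And>z. (\<Sum>a\<in>monexp K k. c a * (\<Prod>i\<in>K. z i ^ a i)) = (0::real)" "a \<in> monexp K k"
  shows "c a = 0"
  using assms
proof (induction K arbitrary: c a rule: finite_induct)
  case empty
  then show ?case by simp
next
  case (insert i K)
  have inj: "inj_on (\<lambda>(m, a). a(i := m)) ({..k} \<times> monexp K k)"
    using inj_combinator[OF insert.hyps(2), of "\<lambda>_. {..k}"] by simp
  define d where "d = (\<lambda>m z. \<Sum>a\<in>monexp K k. c (a(i := m)) * (\<Prod>j\<in>K. z j ^ a j))"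
  have d0: "d m z = 0" if "m \<le> k" for m and z :: "'a \<Rightarrow> real"
  proof -
    have "(\<Sum>m\<le>k. d m z * t ^ m) = 0" for t
    proof -
      have "0 = (\<Sum>a\<in>monexp (insert i K) k. c a * (\<Prod>j\<in>insert i K. (z(i := t)) j ^ a j))"
        using insert.prems(1)[of "z(i := t)"] by simp
      also have "\<dots> = (\<Sum>(m, a)\<in>{..k} \<times> monexp K k. c (a(i := m)) * (\<Prod>j\<in>insert i K. (z(i := t)) j ^ (a(i := m)) j))"
        unfolding PiE_insert_eq sum.reindex[OF inj]
        by (intro sum.cong refl) (simp add: case_prod_unfold)
      also have "\<dots> = (\<Sum>(m, a)\<in>{..k} \<times> monexp K k. c (a(i := m)) * (t ^ m * (\<Prod>j\<in>K. z j ^ a j)))"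
      proof (intro sum.cong refl, clarify)
        fix m a
        have "(\<Prod>j\<in>K. (z(i := t)) j ^ (a(i := m)) j) = (\<Prod>j\<in>K. z j ^ a j)"
          using insert.hyps by (intro prod.cong) auto
        then show "c (a(i := m)) * (\<Prod>j\<in>insert i K. (z(i := t)) j ^ (a(i := m)) j) = c (a(i := m)) * (t ^ m * (\<Prod>j\<in>K. z j ^ a j))"
          using insert.hyps by simp
      qed
      also have "\<dots> = (\<Sum>m\<le>k. d m z * t ^ m)"
        unfolding d_def by (simp add: sum.cartesian_product[symmetric] sum_distrib_right sum_distrib_left algebra_simps)
      finally show ?thesis by simp
    qed
    then show ?thesis using polyfun_eq_0[of "\<lambda>m. d m z" k] that by blast
  qed
  have ai: "a i \<le> k" using insert.prems(2) by (auto simp: PiE_iff)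
  have "restrict a K \<in> monexp K k" using insert.prems(2) by (auto simp: PiE_iff)
  then have "c ((restrict a K)(i := a i)) = 0"
    using d0[OF ai] unfolding d_def by (intro insert.IH[of "\<lambda>b. c (b(i := a i))"]) auto
  moreover have "(restrict a K)(i := a i) = a"
    using insert.prems(2) by (auto simp: PiE_iff extensional_def fun_eq_iff restrict_def)
  ultimately show ?case by simp
qed

text \<open>A dimension count. After clearing denominators, the \<open>(k + 1) ^ card K\<close>
  monomials in the \<open>x i\<close> with exponents up to \<open>k\<close> lie in the rational span
  of \<open>(E + 1) ^ card L\<close> monomials in the \<open>y l\<close>, where \<open>E\<close>
  grows only linearly in \<open>k\<close>. Since \<open>card L < card K\<close>, a large
  \<open>k\<close> forces a rational relation.\<close>

theorem ratgen_dependent: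
  fixes x :: "'k \<Rightarrow> real" and y :: "'l \<Rightarrow> real"
  assumes L: "finite L" and K: "finite K" and card: "card L < card K"
    and x: "\<And>k. k \<in> K \<Longrightarrow> x k \<in> ratgen (y ` L)"
  shows "\<not> alg_indep K x"
proof
  assume ind: "alg_indep K x"
  have "\<exists>D h. h \<in> monomial_span L y D \<and> h \<noteq> 0 \<and> (\<forall>k\<in>K. x k * h \<in> monomial_span L y D)"
    by (rule ratgen_common_denominator[OF L K x])
  then obtain D h where h: "h \<in> monomial_span L y D" "h \<noteq> 0" "\<And>k. k \<in> K \<Longrightarrow> x k * h \<in> monomial_span L y D"
    by auto
  define N where "N = card K"
  \<comment> \<open>Chosen so that the factor \<open>(N * D + 1) ^ card L\<close> of the upper bound
    is \<open>k\<close> itself and loses against one further factor \<open>k + 1\<close>.\<close>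
  define k where "k = (N * D + 1) ^ card L"
  define E where "E = N * (k * D)"
  \<comment> \<open>The factor \<open>h ^ (N * k)\<close> clears all denominators and is the same
    for every \<open>a\<close>, so a relation among the products is a relation among the
    monomials.\<close>
  have memb: "h ^ (N * k) * (\<Prod>i\<in>K. x i ^ a i) \<in> monomial_span L y E" if a: "a \<in> monexp K k" for a
  proof -
    have "h ^ (N * k) * (\<Prod>i\<in>K. x i ^ a i) = (\<Prod>i\<in>K. (x i * h) ^ a i * h ^ (k - a i))"
    proof -
      have "(\<Prod>i\<in>K. (x i * h) ^ a i * h ^ (k - a i)) = (\<Prod>i\<in>K. x i ^ a i * h ^ k)"
      proof (intro prod.cong refl)
        fix i assume "i \<in> K"
        then have "a i \<le> k" using a by (auto simp: PiE_iff)
        then have "h ^ a i * h ^ (k - a i) = h ^ k" by (simp add: power_add[symmetric])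
        then show "(x i * h) ^ a i * h ^ (k - a i) = x i ^ a i * h ^ k" by (simp add: power_mult_distrib mult.assoc)
      qed
      then show ?thesis using K by (simp add: prod.distrib N_def power_mult[symmetric] mult.commute)
    qed
    also have "\<dots> \<in> monomial_span L y (card K * (k * D))"
    proof (rule monomial_span_prod[OF L K])
      fix i assume i: "i \<in> K"
      then have "a i \<le> k" using a by (auto simp: PiE_iff)
      then have "a i * D + (k - a i) * D = k * D" by (simp add: add_mult_distrib[symmetric])
      then show "(x i * h) ^ a i * h ^ (k - a i) \<in> monomial_span L y (k * D)"
        using monomial_span_mult[OF L monomial_span_power[OF L h(3)[OF i]] monomial_span_power[OF L h(1)], of "a i" "k - a i"] by simp
    qed
    finally show ?thesis by (simp add: E_def N_def)
  qed
  have "\<forall>a\<in>monexp K k. \<exists>c. (\<forall>b. c b \<in> \<rat>) \<and>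
      h ^ (N * k) * (\<Prod>i\<in>K. x i ^ a i) = (\<Sum>b\<in>monexp L E. c b * (\<Prod>l\<in>L. y l ^ b l))"
    using memb unfolding monomial_span_def by (intro ballI) simp
  from bchoice[OF this] obtain C where C: "\<forall>a\<in>monexp K k. (\<forall>b. C a b \<in> \<rat>) \<and>
      h ^ (N * k) * (\<Prod>i\<in>K. x i ^ a i) = (\<Sum>b\<in>monexp L E. C a b * (\<Prod>l\<in>L. y l ^ b l))" by (elim exE)
  have "card (monexp L E) = (E + 1) ^ card L" using L by (simp add: card_PiE)
  also have "\<dots> \<le> ((N * D + 1) * (k + 1)) ^ card L"
    by (intro power_mono) (simp_all add: E_def algebra_simps)
  also have "\<dots> = k * (k + 1) ^ card L" by (simp only: power_mult_distrib k_def[symmetric])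
  also have "\<dots> < (k + 1) ^ Suc (card L)" by simp
  also have "\<dots> \<le> (k + 1) ^ card K" using card by (intro power_increasing) auto
  also have "\<dots> = card (monexp K k)" using K by (simp add: card_PiE)
  finally have "card (monexp L E) < card (monexp K k)" .
  then have "\<exists>c. (\<forall>a\<in>monexp K k. c a \<in> \<rat>) \<and> (\<exists>a\<in>monexp K k. c a \<noteq> 0) \<and>
     (\<forall>b\<in>monexp L E. (\<Sum>a\<in>monexp K k. C a b * c a) = 0)"
    using L K C by (intro homogeneous_system[OF real_subfield_Rats]) (auto intro: finite_PiE)
  then obtain c where c: "\<forall>a\<in>monexp K k. c a \<in> \<rat>" "\<exists>a\<in>monexp K k. c a \<noteq> 0"
     "\<forall>b\<in>monexp L E. (\<Sum>a\<in>monexp K k. C a b * c a) = 0" by (elim exE conjE)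
  have "h ^ (N * k) * (\<Sum>a\<in>monexp K k. c a * (\<Prod>i\<in>K. x i ^ a i))
      = (\<Sum>a\<in>monexp K k. c a * (h ^ (N * k) * (\<Prod>i\<in>K. x i ^ a i)))"
    by (simp add: sum_distrib_left algebra_simps)
  also have "\<dots> = (\<Sum>a\<in>monexp K k. \<Sum>b\<in>monexp L E. C a b * c a * (\<Prod>l\<in>L. y l ^ b l))"
    using C by (intro sum.cong refl) (simp add: sum_distrib_left algebra_simps)
  also have "\<dots> = (\<Sum>b\<in>monexp L E. (\<Sum>a\<in>monexp K k. C a b * c a) * (\<Prod>l\<in>L. y l ^ b l))"
    by (subst sum.swap) (simp add: sum_distrib_right)
  also have "\<dots> = 0" using c(3) by simp
  finally have zero: "(\<Sum>a\<in>monexp K k. c a * (\<Prod>i\<in>K. x i ^ a i)) = 0" using h(2) by simp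
  have pf: "(\<lambda>x. \<Sum>a\<in>monexp K k. c a * (\<Prod>i\<in>K. x i ^ a i)) \<in> polyfun \<rat> K"
    using c(1) by (intro polyfun_sum pf_mult polyfun_prod polyfun_power pf_const pf_var) auto
  then have "(\<Sum>a\<in>monexp K k. c a * (\<Prod>i\<in>K. z i ^ a i)) = 0" for z
    using bspec[OF ind[unfolded alg_indep_def] pf] zero by simp
  then have "c a = 0" if "a \<in> monexp K k" for a using monomials_independent[OF K _ that] by blast
  then show False using c(2) by blast
qed

text \<open>All parameters lie in a field generated by the \<open>card I - card A\<close> untouched
  ones and the \<open>card D\<close> values of \<open>w\<close>. Fewer than \<open>card I\<close>
  generators would contradict independence.\<close>

lemma transcendence_count:
  assumes I: "finite I" and p: "alg_indep I p" and D: "finite D"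
    and t: "inj_on t A" "t ` A \<subseteq> I"
    and gen: "\<And>j. j \<in> A \<Longrightarrow> p (t j) \<in> ratgen (p ` (I - t ` A) \<union> w ` D)"
  shows "card A \<le> card D"
proof (rule ccontr)
  assume "\<not> card A \<le> card D"
  define L where "L = (I - t ` A) <+> D"
  define y where "y = case_sum p w"
  have fin: "finite (t ` A)" using t(2) I by (rule finite_subset)
  have cA: "card (t ` A) = card A" using t(1) by (rule card_image)
  have yL: "y ` L = p ` (I - t ` A) \<union> w ` D" unfolding L_def y_def by (force simp: image_iff)
  have "card L = card I - card A + card D"
    using I D fin t(2) by (simp add: L_def card_Plus card_Diff_subset cA)
  moreover have "card A \<le> card I" using card_mono[OF I t(2)] cA by simp
  ultimately have "card L < card I" using \<open>\<not> card A \<le> card D\<close> by simp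
  moreover have "p i \<in> ratgen (y ` L)" if "i \<in> I" for i
  proof (cases "i \<in> t ` A")
    case True
    then show ?thesis using gen yL by auto
  next
    case False
    then show ?thesis using that yL by (intro ratgen_base) auto
  qed
  ultimately show False using ratgen_dependent[of L I p y] p I D by (auto simp: L_def)
qed

text \<open>Gaussian elimination read as a statement about fields: each of the independent forms,
  with known coefficients and known value, expresses one coordinate in \<open>Q\<close> through
  those outside \<open>Q\<close>.\<close>

lemma solve_linear_forms:
  assumes "finite K" "finite I" "indep_on I K a"
    and "\<And>k i. k \<in> K \<Longrightarrow> i \<in> I \<Longrightarrow> a k i \<in> ratgen F"
    and "\<And>k. k \<in> K \<Longrightarrow> (\<Sum>i\<in>I. a k i * v i) \<in> ratgen F"
  shows "\<exists>Q\<subseteq>I. card Q = card K \<and> (\<forall>i\<in>I. v i \<in> ratgen (F \<union> v ` (I - Q)))"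
  using assms
proof (induction K arbitrary: I a rule: finite_induct)
  case empty
  then show ?case by (intro exI[of _ "{}"]) (auto intro: ratgen_base)
next
  case (insert k K)
  have "\<exists>i0\<in>I. a k i0 \<noteq> 0"
  proof (rule ccontr)
    assume "\<not> ?thesis"
    then have 0: "a k i = 0" if "i \<in> I" for i using that by blast
    have "(if k = k then 1 else 0 :: real) = 0"
      by (rule indep_onD[OF insert.prems(2), of "\<lambda>j. if j = k then 1 else 0" k])
        (use insert.hyps 0 in \<open>auto intro!: sum.neutral\<close>)
    then show False by simp
  qed
  then obtain i0 where i0: "i0 \<in> I" "a k i0 \<noteq> 0" by blast
  define r where "r = (\<lambda>m. a m i0 / a k i0)"
  define a' where "a' = (\<lambda>m i. a m i - r m * a k i)"
  define J where "J = I - {i0}"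
  have finJ: "finite J" using insert.prems by (simp add: J_def)
  have a'0: "a' m i0 = 0" for m using i0 by (simp add: a'_def r_def)
  have sumI: "(\<Sum>i\<in>I. f i) = f i0 + (\<Sum>i\<in>J. f i)" for f :: "'b \<Rightarrow> real"
    unfolding J_def using insert.prems(1) i0 by (simp add: sum.remove)
  have rF: "r m \<in> ratgen F" if "m \<in> K" for m
    unfolding r_def using that i0 by (intro ratgen_field insert.prems) auto
  have indJ: "indep_on J K a'"
  proof (rule indep_onI)
    fix c m assume c: "\<And>i. i \<in> J \<Longrightarrow> (\<Sum>m\<in>K. c m * a' m i) = 0" and m: "m \<in> K"
    define d where "d = c(k := - (\<Sum>m\<in>K. c m * r m))"
    have dsum: "(\<Sum>m\<in>K. d m * a m i) = (\<Sum>m\<in>K. c m * a m i)" for i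
      using insert.hyps by (intro sum.cong) (auto simp: d_def)
    have "(\<Sum>m\<in>insert k K. d m * a m i) = (\<Sum>m\<in>K. c m * a' m i)" for i
      using insert.hyps
      by (simp add: dsum) (simp add: d_def a'_def algebra_simps sum_subtractf sum_distrib_left sum_distrib_right)
    moreover have "(\<Sum>m\<in>K. c m * a' m i) = 0" if "i \<in> I" for i
      using c that a'0 by (cases "i = i0") (auto simp: J_def)
    ultimately have "d m = 0" using indep_onD[OF insert.prems(2), of d m] m by simp
    then show "c m = 0" using m insert.hyps by (auto simp: d_def split: if_splits)
  qed
  have "\<exists>Q\<subseteq>J. card Q = card K \<and> (\<forall>i\<in>J. v i \<in> ratgen (F \<union> v ` (J - Q)))"
  proof (rule insert.IH[OF finJ indJ])
    fix m i assume "m \<in> K" "i \<in> J"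
    then show "a' m i \<in> ratgen F"
      unfolding a'_def by (intro ratgen_field rF insert.prems) (auto simp: J_def)
  next
    fix m assume m: "m \<in> K"
    have "(\<Sum>i\<in>J. a' m i * v i) = (\<Sum>i\<in>I. a' m i * v i)" unfolding sumI using a'0 by simp
    also have "\<dots> = (\<Sum>i\<in>I. a m i * v i) - r m * (\<Sum>i\<in>I. a k i * v i)"
      by (simp add: a'_def algebra_simps sum_subtractf sum_distrib_left)
    also have "\<dots> \<in> ratgen F" using m by (intro ratgen_field rF insert.prems) auto
    finally show "(\<Sum>i\<in>J. a' m i * v i) \<in> ratgen F" .
  qed
  then obtain Q where Q: "Q \<subseteq> J" "card Q = card K" "\<And>i. i \<in> J \<Longrightarrow> v i \<in> ratgen (F \<union> v ` (J - Q))" by blast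
  have eq: "I - insert i0 Q = J - Q" by (auto simp: J_def)
  have i0Q: "i0 \<notin> Q" "finite Q" using Q(1) finJ finite_subset by (auto simp: J_def)
  have up: "x \<in> ratgen (F \<union> v ` (J - Q))" if "x \<in> ratgen F" for x using that by (rule ratgen_mono[rotated]) auto
  have "v i0 = ((\<Sum>i\<in>I. a k i * v i) - (\<Sum>i\<in>J. a k i * v i)) / a k i0"
    unfolding sumI using i0 by simp
  also have "\<dots> \<in> ratgen (F \<union> v ` (J - Q))"
    by (intro ratgen_field ratgen_sum up insert.prems Q(3)) (use i0 in \<open>auto simp: J_def\<close>)
  finally have "v i0 \<in> ratgen (F \<union> v ` (J - Q))" .
  then have "v i \<in> ratgen (F \<union> v ` (I - insert i0 Q))" if "i \<in> I" for i
    using Q(3) that unfolding eq by (cases "i = i0") (auto simp: J_def)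
  moreover have "card (insert i0 Q) = card (insert k K)" using i0Q Q(2) insert.hyps by simp
  moreover have "insert i0 Q \<subseteq> I" using Q(1) i0 by (auto simp: J_def)
  ultimately show ?case by blast
qed

text \<open>The dichotomy between inactive and active columns. Eliminating the \<open>z s\<close>
  leaves equations in the \<open>x t\<close> alone. If all of them are trivial, the system is
  solvable for every \<open>x'\<close>; otherwise a nonzero coefficient allows some
  \<open>x t\<close> to be expressed by the rest.\<close>

lemma eliminate_auxiliary:
  assumes "finite S" "finite T"
    and "\<And>i t. i \<in> R \<Longrightarrow> t \<in> T \<Longrightarrow> b i t \<in> ratgen F" "\<And>i s. i \<in> R \<Longrightarrow> s \<in> S \<Longrightarrow> g i s \<in> ratgen F"
    and "\<And>i. i \<in> R \<Longrightarrow> (\<Sum>t\<in>T. b i t * x t) = (\<Sum>s\<in>S. g i s * z s)"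
  shows "(\<forall>x'. \<exists>z'. \<forall>i\<in>R. (\<Sum>t\<in>T. b i t * x' t) = (\<Sum>s\<in>S. g i s * z' s)) \<or>
         (\<exists>t\<in>T. x t \<in> ratgen (F \<union> x ` (T - {t})))"
  using assms(1,3-)
proof (induction S arbitrary: b g rule: finite_induct)
  case empty
  show ?case
  proof (cases "\<forall>i\<in>R. \<forall>t\<in>T. b i t = 0")
    case True
    then show ?thesis by simp
  next
    case False
    then obtain i t where it: "i \<in> R" "t \<in> T" "b i t \<noteq> 0" by blast
    have "b i t * x t + (\<Sum>s\<in>T-{t}. b i s * x s) = 0"
      using empty.prems(3)[OF it(1)] assms(2) it(2) by (simp add: sum.remove)
    then have "x t = - (\<Sum>s\<in>T-{t}. b i s * x s) / b i t" using it(3) by (simp add: field_simps)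
    also have "\<dots> \<in> ratgen (F \<union> x ` (T - {t}))"
    proof (intro ratgen_field ratgen_uminus ratgen_sum)
      have F: "b i s \<in> ratgen (F \<union> x ` (T - {t}))" if "s \<in> T" for s
        by (rule ratgen_mono[OF Un_upper1]) (rule empty.prems(1)[OF it(1) that])
      then show "b i t \<in> ratgen (F \<union> x ` (T - {t}))" "\<And>s. s \<in> T - {t} \<Longrightarrow> b i s \<in> ratgen (F \<union> x ` (T - {t}))"
        using it(2) by auto
    qed (auto intro: ratgen_base)
    finally show ?thesis using it(2) by blast
  qed
next
  case (insert s S)
  show ?case
  proof (cases "\<forall>i\<in>R. g i s = 0")
    case True
    then have eq: "(\<Sum>s\<in>insert s S. g i s * z' s) = (\<Sum>s\<in>S. g i s * z' s)" if "i \<in> R" for i z'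
      using insert.hyps that by simp
    have "(\<forall>x'. \<exists>z'. \<forall>i\<in>R. (\<Sum>t\<in>T. b i t * x' t) = (\<Sum>s\<in>S. g i s * z' s)) \<or>
         (\<exists>t\<in>T. x t \<in> ratgen (F \<union> x ` (T - {t})))"
      by (rule insert.IH) (use insert.prems eq in auto)
    then show ?thesis using eq by simp
  next
    case False
    then obtain i0 where i0: "i0 \<in> R" "g i0 s \<noteq> 0" by blast
    define r where "r = (\<lambda>i. g i s / g i0 s)"
    define b' where "b' = (\<lambda>i t. b i t - r i * b i0 t)"
    define g' where "g' = (\<lambda>i t. g i t - r i * g i0 t)"
    have rF: "r i \<in> ratgen F" if "i \<in> R" for i
      unfolding r_def using that i0 by (intro ratgen_field insert.prems) auto
    have b': "(\<Sum>t\<in>T. b' i t * x' t) = (\<Sum>t\<in>T. b i t * x' t) - r i * (\<Sum>t\<in>T. b i0 t * x' t)" for i x'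
      by (simp add: b'_def algebra_simps sum_subtractf sum_distrib_left)
    have g': "(\<Sum>t\<in>S. g' i t * z' t) = (\<Sum>t\<in>insert s S. g i t * z' t) - r i * (\<Sum>t\<in>insert s S. g i0 t * z' t)" for i z'
    proof -
      have "g i s = r i * g i0 s" using i0 by (simp add: r_def)
      then show ?thesis using insert.hyps by (simp add: g'_def algebra_simps sum_subtractf sum_distrib_left)
    qed
    have "(\<forall>x'. \<exists>z'. \<forall>i\<in>R. (\<Sum>t\<in>T. b' i t * x' t) = (\<Sum>s\<in>S. g' i s * z' s)) \<or>
         (\<exists>t\<in>T. x t \<in> ratgen (F \<union> x ` (T - {t})))"
    proof (rule insert.IH)
      fix i t assume "i \<in> R" "t \<in> T"
      then show "b' i t \<in> ratgen F" unfolding b'_def using i0 by (intro ratgen_field rF insert.prems)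
    next
      fix i t assume "i \<in> R" "t \<in> S"
      then show "g' i t \<in> ratgen F" unfolding g'_def using i0 by (intro ratgen_field rF insert.prems) auto
    next
      fix i assume i: "i \<in> R"
      then show "(\<Sum>t\<in>T. b' i t * x t) = (\<Sum>s\<in>S. g' i s * z s)"
        by (simp only: b' g' insert.prems(3)[OF i] insert.prems(3)[OF i0(1)])
    qed
    then show ?thesis
    proof
      assume L: "\<forall>x'. \<exists>z'. \<forall>i\<in>R. (\<Sum>t\<in>T. b' i t * x' t) = (\<Sum>s\<in>S. g' i s * z' s)"
      have "\<exists>z'. \<forall>i\<in>R. (\<Sum>t\<in>T. b i t * x' t) = (\<Sum>s\<in>insert s S. g i s * z' s)" for x'
      proof -
        obtain z' where z': "\<And>i. i \<in> R \<Longrightarrow> (\<Sum>t\<in>T. b' i t * x' t) = (\<Sum>s\<in>S. g' i s * z' s)" using L by meson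
        \<comment> \<open>Back substitution: the pivot equation at \<open>i0\<close> determines the
          eliminated unknown \<open>s\<close>.\<close>
        define q where "q = ((\<Sum>t\<in>T. b i0 t * x' t) - (\<Sum>t\<in>S. g i0 t * z' t)) / g i0 s"
        have S: "(\<Sum>t\<in>S. h t * (z'(s := q)) t) = (\<Sum>t\<in>S. h t * z' t)" for h
          using insert.hyps by (intro sum.cong) auto
        have e0: "(\<Sum>t\<in>insert s S. g i0 t * (z'(s := q)) t) = (\<Sum>t\<in>T. b i0 t * x' t)"
          using insert.hyps i0 S[of "g i0"] by (simp add: q_def)
        have "(\<Sum>t\<in>T. b i t * x' t) = (\<Sum>t\<in>insert s S. g i t * (z'(s := q)) t)" if "i \<in> R" for i
          using z'[OF that] g'[of i "z'(s := q)"] b'[of i x'] unfolding S e0 by simp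
        then show ?thesis by blast
      qed
      then show ?thesis by blast
    qed blast
  qed
qed

section \<open>Hall's marriage theorem\<close>

text \<open>Induction on the number of sets. If some proper nonempty subfamily attains equality in
  Hall's condition, it is matched separately from the rest; otherwise one representative can be
  chosen arbitrarily, since every smaller family has an element to spare.\<close>

theorem marriage:
  fixes S :: "'j \<Rightarrow> 'a set"
  assumes "finite G" "\<And>j. j \<in> G \<Longrightarrow> finite (S j)" "\<And>K. K \<subseteq> G \<Longrightarrow> card K \<le> card (\<Union> (S ` K))"
  shows "\<exists>f. inj_on f G \<and> (\<forall>j\<in>G. f j \<in> S j)"
  using assms
proof (induction "card G" arbitrary: G S rule: less_induct)
  case less
  note finG = less.prems(1) and finS = less.prems(2) and hall = less.prems(3)
  have finU: "finite (\<Union> (S ` K))" if "K \<subseteq> G" for K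
    using that finG finS by (auto intro: finite_subset)
  consider "G = {}" | K where "K \<subseteq> G" "K \<noteq> {}" "K \<noteq> G" "card (\<Union> (S ` K)) = card K"
    | "G \<noteq> {}" "\<And>K. K \<subseteq> G \<Longrightarrow> K \<noteq> {} \<Longrightarrow> K \<noteq> G \<Longrightarrow> card K < card (\<Union> (S ` K))"
    using hall by (metis le_neq_implies_less)
  then show ?case
  proof cases
    case 1
    then show ?thesis by simp
  next
    case 2
    have finK: "finite K" using 2(1) finG by (rule finite_subset)
    have "card K < card G" using 2 finG by (intro psubset_card_mono) auto
    then have "\<exists>f. inj_on f K \<and> (\<forall>j\<in>K. f j \<in> S j)"
      using finK finS hall 2(1) by (intro less.hyps) auto
    then obtain f where f: "inj_on f K" "\<And>j. j \<in> K \<Longrightarrow> f j \<in> S j" by blast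
    define U where "U = \<Union> (S ` K)"
    have finUK: "finite U" unfolding U_def by (rule finU[OF 2(1)])
    have "card (G - K) < card G" using 2 finG by (intro psubset_card_mono) auto
    moreover have "card M \<le> card (\<Union> ((\<lambda>j. S j - U) ` M))" if M: "M \<subseteq> G - K" for M
    proof -
      have finM: "finite M" using M finG finite_subset by blast
      have "card M + card K = card (M \<union> K)" using M finM finK by (subst card_Un_disjoint) auto
      also have "\<dots> \<le> card (\<Union> (S ` (M \<union> K)))" using M 2(1) by (intro hall) auto
      also have "\<Union> (S ` (M \<union> K)) = \<Union> ((\<lambda>j. S j - U) ` M) \<union> U" unfolding U_def by auto
      also have "card \<dots> \<le> card (\<Union> ((\<lambda>j. S j - U) ` M)) + card U" by (rule card_Un_le)
      finally show ?thesis using 2(4) U_def by simp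
    qed
    ultimately have "\<exists>g. inj_on g (G - K) \<and> (\<forall>j\<in>G-K. g j \<in> S j - U)"
      using finG finS by (intro less.hyps) auto
    then obtain g where g: "inj_on g (G - K)" "\<And>j. j \<in> G - K \<Longrightarrow> g j \<in> S j - U" by blast
    have "inj_on (\<lambda>j. if j \<in> K then f j else g j) G"
    proof (rule inj_onI)
      fix i j assume *: "i \<in> G" "j \<in> G" "(if i \<in> K then f i else g i) = (if j \<in> K then f j else g j)"
      have fU: "f j \<in> U" if "j \<in> K" for j using f(2)[OF that] that by (auto simp: U_def)
      have gU: "g j \<notin> U" if "j \<in> G" "j \<notin> K" for j using g(2) that by blast
      show "i = j"
      proof (cases "i \<in> K"; cases "j \<in> K")
        assume "i \<in> K" "j \<in> K"
        then show ?thesis using *(3) inj_onD[OF f(1), of i j] by simp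
      next
        assume "i \<notin> K" "j \<notin> K"
        then show ?thesis using * inj_onD[OF g(1), of i j] by simp
      next
        assume "i \<in> K" "j \<notin> K"
        then show ?thesis using *(3) fU[of i] gU[OF *(2)] by simp
      next
        assume "i \<notin> K" "j \<in> K"
        then show ?thesis using *(3) fU[of j] gU[OF *(1)] by simp
      qed
    qed
    then show ?thesis using f(2) g(2) by (intro exI[of _ "\<lambda>j. if j \<in> K then f j else g j"]) auto
  next
    case 3
    then obtain j where j: "j \<in> G" by blast
    have "S j \<noteq> {}" using hall[of "{j}"] j by auto
    then obtain x where x: "x \<in> S j" by blast
    have "card (G - {j}) < card G" using j finG by (intro psubset_card_mono) auto
    moreover have "card M \<le> card (\<Union> ((\<lambda>i. S i - {x}) ` M))" if M: "M \<subseteq> G - {j}" for M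
    proof (cases "M = {}")
      case False
      then have "card M < card (\<Union> (S ` M))" using M j by (intro 3(2)) auto
      moreover have "\<Union> ((\<lambda>i. S i - {x}) ` M) = \<Union> (S ` M) - {x}" by auto
      moreover have "card (\<Union> (S ` M)) - 1 \<le> card (\<Union> (S ` M) - {x})"
        by (metis card_Diff_singleton_if diff_le_self order_refl)
      ultimately show ?thesis by simp
    qed simp
    ultimately have "\<exists>g. inj_on g (G - {j}) \<and> (\<forall>i\<in>G-{j}. g i \<in> S i - {x})"
      using finG finS by (intro less.hyps) auto
    then obtain g where g: "inj_on g (G - {j})" "\<And>i. i \<in> G - {j} \<Longrightarrow> g i \<in> S i - {x}" by blast
    have "inj_on (g(j := x)) G"
    proof (rule inj_onI)
      fix a b assume "a \<in> G" "b \<in> G" "(g(j := x)) a = (g(j := x)) b"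
      then show "a = b" using g by (auto simp: inj_on_def split: if_splits)
    qed
    then show ?thesis using g(2) x by (intro exI[of _ "g(j := x)"]) auto
  qed
qed

section \<open>Random sampling patterns\<close>

text \<open>After deletion of any \<open>\<rho>\<close> rows the finite column set \<open>G\<close>
  still satisfies Hall's condition. The empty subfamily is exempt because it covers no rows.\<close>

definition hall_surplus :: "nat \<Rightarrow> (nat \<Rightarrow> nat set) \<Rightarrow> nat set \<Rightarrow> bool" where
  "hall_surplus \<rho> \<Omega> G \<longleftrightarrow> (\<forall>K\<subseteq>G. K \<noteq> {} \<longrightarrow> card K + \<rho> \<le> card (\<Union> (\<Omega> ` K)))"

text \<open>Both binomial coefficients are products over \<open>i < k\<close>, and factor by factor
  \<open>(s - i) / (n - i) \<le> s / n\<close>.\<close>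

lemma choose_ratio_le:
  assumes "s \<le> n"
  shows "real (s choose k) / real (n choose k) \<le> (real s / real n) ^ k"
proof (cases "k \<le> s")
  case False
  then show ?thesis by (simp add: binomial_eq_0)
next
  case True
  then have "real (s choose k) = (\<Prod>i<k. real (s - i) / real (k - i))"
    "real (n choose k) = (\<Prod>i<k. real (n - i) / real (k - i))"
    using assms binomial_altdef_of_nat[of k s, where 'a=real] binomial_altdef_of_nat[of k n, where 'a=real]
    by (simp_all add: atLeast0LessThan)
  then have "real (s choose k) / real (n choose k) = (\<Prod>i<k. (real (s - i) / real (k - i)) / (real (n - i) / real (k - i)))"
    by (simp only: prod_dividef)
  also have "\<dots> \<le> (\<Prod>i<k. real s / real n)"
  proof (intro prod_mono conjI)
    fix i assume i: "i \<in> {..<k}"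
    then have "i < s" "i < n" "i < k" using True assms by auto
    then have "real (s - i) * real n \<le> real s * real (n - i)" using assms
      by (simp add: of_nat_diff algebra_simps mult_left_mono)
    then have "real (s - i) / real (n - i) \<le> real s / real n" using \<open>i < n\<close> by (simp add: divide_simps)
    then show "real (s - i) / real (k - i) / (real (n - i) / real (k - i)) \<le> real s / real n"
      using \<open>i < k\<close> by simp
  qed simp
  finally show ?thesis by simp
qed

lemma prob_columns_within:
  assumes "finite K" "K \<subseteq> {..<m}" "Z \<subseteq> {..<n}" and k: "\<And>j. j < m \<Longrightarrow> k j \<le> n"
  shows "measure_pmf.prob (sampling n m k) {\<Omega>. \<forall>j\<in>K. \<Omega> j \<subseteq> Z}
     = (\<Prod>j\<in>K. real (card Z choose k j) / real (n choose k j))"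
proof -
  let ?B = "\<lambda>j. if j \<in> K then Pow Z else UNIV"
  let ?S = "\<lambda>j. {S. S \<subseteq> {..<n} \<and> card S = k j}"
  have "{\<Omega> :: nat \<Rightarrow> nat set. \<forall>j\<in>K. \<Omega> j \<subseteq> Z} = Pi {..<m} ?B"
  proof (rule Set.set_eqI, rule iffI)
    fix \<Omega> assume *: "\<Omega> \<in> Pi {..<m} ?B"
    have "\<Omega> j \<subseteq> Z" if "j \<in> K" for j
    proof -
      have "\<Omega> j \<in> ?B j" by (rule Pi_mem[OF *]) (use that assms(2) in auto)
      then show ?thesis using that by simp
    qed
    then show "\<Omega> \<in> {\<Omega>. \<forall>j\<in>K. \<Omega> j \<subseteq> Z}" by simp
  qed (auto simp: Pi_iff)
  then have "measure_pmf.prob (sampling n m k) {\<Omega>. \<forall>j\<in>K. \<Omega> j \<subseteq> Z}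
      = (\<Prod>j<m. measure_pmf.prob (pmf_of_set (?S j)) (?B j))"
    unfolding sampling_def by (simp add: measure_Pi_pmf_Pi)
  also have "\<dots> = (\<Prod>j\<in>K. measure_pmf.prob (pmf_of_set (?S j)) (Pow Z))"
    using assms(1,2) by (intro prod.mono_neutral_cong_right) auto
  also have "\<dots> = (\<Prod>j\<in>K. real (card Z choose k j) / real (n choose k j))"
  proof (intro prod.cong refl)
    fix j assume "j \<in> K"
    then have kn: "k j \<le> n" using k assms(2) by auto
    have card: "card (?S j) = n choose k j" using n_subsets[of "{..<n}" "k j"] by simp
    have fin: "finite (?S j)" by (rule finite_subset[of _ "Pow {..<n}"]) auto
    have "?S j \<noteq> {}" using card kn by (metis card.empty zero_less_binomial less_numeral_extra(3))
    moreover have "?S j \<inter> Pow Z = {S. S \<subseteq> Z \<and> card S = k j}" using assms(3) by auto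
    moreover have "finite Z" using assms(3) finite_subset by blast
    ultimately show "measure_pmf.prob (pmf_of_set (?S j)) (Pow Z) = real (card Z choose k j) / real (n choose k j)"
      using fin card n_subsets[of Z "k j"] by (simp add: measure_pmf_of_set)
  qed
  finally show ?thesis .
qed

text \<open>The share of one size \<open>c\<close> in the union bound: \<open>g choose c\<close>
  column sets, \<open>n choose s\<close> row sets of the largest violating size
  \<open>s = c + \<rho> - 1\<close>, and the probability that the columns fit into the rows. The
  number of row sets has to be compensated differently for few and for many rows.\<close>

lemma union_bound_term:
  fixes n c s l \<rho> :: nat and k :: "nat \<Rightarrow> nat" and q :: real
  assumes K: "finite K" "card K = c" "1 \<le> c" and kl: "\<And>j. j \<in> K \<Longrightarrow> l \<le> k j \<and> k j \<le> n"
    and s: "s + 1 = c + \<rho>" "s < n" and l: "\<rho> + 1 \<le> l" and \<rho>: "3 * \<rho> \<le> n"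
    and g: "c \<le> g" "g + \<rho> \<le> n"
    and q: "exp (- (real l / 3)) \<le> q" "real n ^ 2 * q \<le> 1"
  shows "real (g choose c) * (real (n choose s) * (\<Prod>j\<in>K. real (s choose k j) / real (n choose k j)))
     \<le> real n ^ 2 * q"
proof -
  define x where "x = real s / real n"
  have n: "0 < n" using s by simp
  have q0: "0 < q" using q(1) by (meson exp_gt_zero less_le_trans)
  have x: "0 \<le> x" "x \<le> 1" using s by (auto simp: x_def)
  have ratio: "real (s choose k j) / real (n choose k j) \<le> x ^ l" if "j \<in> K" for j
  proof -
    have "real (s choose k j) / real (n choose k j) \<le> x ^ k j"
      unfolding x_def using s by (intro choose_ratio_le) simp
    also have "\<dots> \<le> x ^ l" using x kl[OF that] by (intro power_decreasing) auto
    finally show ?thesis .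
  qed
  show ?thesis
  proof (cases "3 * s \<le> 2 * n")
    case True
    \<comment> \<open>Few rows: the column \<open>j0\<close> pays for the choice of the row set, and
      each of the other \<open>c - 1\<close> columns contributes a factor \<open>q\<close>.\<close>
    obtain j0 where j0: "j0 \<in> K" using K by fastforce
    have prod: "(\<Prod>j\<in>K. real (s choose k j) / real (n choose k j))
        = real (s choose k j0) / real (n choose k j0) * (\<Prod>j\<in>K-{j0}. real (s choose k j) / real (n choose k j))"
      using K(1) j0 by (rule prod.remove)
    show ?thesis
    proof (cases "k j0 \<le> s")
      case False
      then show ?thesis unfolding prod using q0 by (simp add: binomial_eq_0)
    next
      case ks: True
      have "l \<le> s" using ks kl[OF j0] by simp
      then have c2: "2 \<le> c" using s l by simp
      have "real (n choose s) * (real (s choose k j0) / real (n choose k j0)) = real (n - k j0 choose (s - k j0))"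
      proof -
        have "(n choose s) * (s choose k j0) = (n choose k j0) * (n - k j0 choose (s - k j0))"
          using ks s(2) by (intro choose_mult) auto
        then have "real (n choose s) * real (s choose k j0) = real (n choose k j0) * real (n - k j0 choose (s - k j0))"
          by (metis of_nat_mult)
        moreover have "real (n choose k j0) \<noteq> 0" using kl[OF j0] by simp
        ultimately show ?thesis by (simp add: field_simps)
      qed
      also have "\<dots> \<le> real n ^ (c - 2)"
      proof -
        have "n - k j0 choose (s - k j0) \<le> (n - k j0) ^ (s - k j0)" using s by (intro binomial_le_pow) simp
        also have "\<dots> \<le> n ^ (s - k j0)" by (rule power_mono) auto
        \<comment> \<open>As \<open>k j0 \<ge> \<rho> + 1\<close>, at most
          \<open>s - (\<rho> + 1) = c - 2\<close> rows remain to be chosen beyond those of column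
          \<open>j0\<close>.\<close>
        also have "\<dots> \<le> n ^ (c - 2)" using n s l kl[OF j0] by (intro power_increasing) auto
        finally show ?thesis by (metis of_nat_le_iff of_nat_power)
      qed
      finally have 1: "real (n choose s) * (real (s choose k j0) / real (n choose k j0)) \<le> real n ^ (c - 2)" .
      have "x \<le> 2 / 3" using True n by (simp add: x_def field_simps)
      \<comment> \<open>Equivalent to \<open>exp 1 \<le> 27 / 8\<close>, a consequence of
        \<open>exp 1 \<le> 3\<close>. It ties the threshold of two thirds of the rows to the
        exponent \<open>l / 3\<close>.\<close>
      also have "(2::real) / 3 \<le> exp (- (1/3))"
      proof -
        have "exp (1/3 :: real) ^ 3 = exp 1" by (simp add: exp_of_nat_mult[symmetric])
        also have "\<dots> \<le> (3/2) ^ 3" using exp_le by (simp add: power3_eq_cube)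
        finally have "exp (1/3 :: real) \<le> 3/2" by (rule power_le_imp_le_base[of _ 2, simplified]) (simp add: numeral_3_eq_3)
        then show ?thesis by (simp add: exp_minus field_simps)
      qed
      finally have "x ^ l \<le> exp (- (1/3)) ^ l" using x by (intro power_mono) auto
      also have "\<dots> = exp (- (real l / 3))" by (simp add: exp_of_nat_mult[symmetric])
      finally have xl: "x ^ l \<le> q" using q(1) by linarith
      have "(\<Prod>j\<in>K-{j0}. real (s choose k j) / real (n choose k j)) \<le> (\<Prod>j\<in>K-{j0}. q)"
        using ratio xl by (intro prod_mono) (auto intro: order_trans)
      also have "\<dots> = q ^ (c - 1)" using K j0 by simp
      finally have 2: "(\<Prod>j\<in>K-{j0}. real (s choose k j) / real (n choose k j)) \<le> q ^ (c - 1)" .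
      have 3: "real (g choose c) \<le> real n ^ c"
      proof -
        have "g choose c \<le> g ^ c" using g by (intro binomial_le_pow)
        also have "\<dots> \<le> n ^ c" using g by (intro power_mono) auto
        finally show ?thesis by (metis of_nat_le_iff of_nat_power)
      qed
      have "real (g choose c) * (real (n choose s) * (\<Prod>j\<in>K. real (s choose k j) / real (n choose k j)))
         = real (g choose c) * ((real (n choose s) * (real (s choose k j0) / real (n choose k j0))) * (\<Prod>j\<in>K-{j0}. real (s choose k j) / real (n choose k j)))"
        unfolding prod by (simp only: mult.assoc)
      also have "\<dots> \<le> real n ^ c * (real n ^ (c - 2) * q ^ (c - 1))"
        by (intro mult_mono 1 2 3 mult_nonneg_nonneg prod_nonneg) auto
      also have "\<dots> = (real n ^ 2 * q) ^ (c - 1)"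
      proof -
        have "c + (c - 2) = 2 * (c - 1)" using c2 by simp
        then have "real n ^ c * real n ^ (c - 2) = (real n ^ 2) ^ (c - 1)"
          by (simp only: power_add[symmetric] power_mult[symmetric])
        then show ?thesis by (simp add: power_mult_distrib mult.assoc[symmetric])
      qed
      also have "\<dots> \<le> (real n ^ 2 * q) ^ 1" using c2 q q0 n by (intro power_decreasing) auto
      finally show ?thesis by simp
    qed
  next
    case False
    \<comment> \<open>Many rows: both choices are counted through complements of size at most
      \<open>d\<close>. By \<open>3 * \<rho> \<le> n\<close> at least a third of \<open>n\<close>
      columns is involved, and together they contribute a factor \<open>q\<close> for each of the
      \<open>d\<close> missing rows.\<close>
    define d where "d = n - s"
    have d: "1 \<le> d" "s + d = n" using s by (auto simp: d_def)
    have c3: "n \<le> 3 * c" using False s \<rho> by simp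
    have 1: "real (g choose c) \<le> real n ^ (d - 1)"
    proof -
      have "g choose c \<le> (n - \<rho>) choose c" using g by (intro binomial_right_mono) simp
      also have "\<dots> = (n - \<rho>) choose (n - \<rho> - c)" using g by (intro binomial_symmetric) simp
      also have "\<dots> \<le> (n - \<rho>) ^ (n - \<rho> - c)" by (intro binomial_le_pow) simp
      also have "\<dots> \<le> n ^ (n - \<rho> - c)" by (intro power_mono) auto
      also have "n - \<rho> - c = d - 1" using s d by simp
      finally show ?thesis by (metis of_nat_le_iff of_nat_power)
    qed
    have 2: "real (n choose s) \<le> real n ^ d"
    proof -
      have "n choose s = n choose d" using s d by (metis binomial_symmetric d_def less_imp_le_nat)
      also have "\<dots> \<le> n ^ d" using d by (intro binomial_le_pow) simp
      finally show ?thesis by (metis of_nat_le_iff of_nat_power)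
    qed
    have "x = 1 - real d / real n" using d n by (simp add: x_def field_simps of_nat_add[symmetric])
    also have "\<dots> \<le> exp (- (real d / real n))" using exp_ge_add_one_self[of "- (real d / real n)"] by simp
    finally have "x ^ (l * c) \<le> exp (- (real d / real n)) ^ (l * c)" using x by (intro power_mono)
    also have "\<dots> = exp (- (real d * real l * (real c / real n)))"
      by (simp add: exp_of_nat_mult[symmetric] algebra_simps)
    also have "\<dots> \<le> exp (- (real d * real l * (1 / 3)))"
      using c3 n by (intro exp_le_cancel_iff[THEN iffD2] le_imp_neg_le mult_left_mono) (auto simp: field_simps)
    also have "\<dots> = exp (- (real l / 3)) ^ d" by (simp add: exp_of_nat_mult[symmetric] algebra_simps)
    also have "\<dots> \<le> q ^ d" using q(1) by (intro power_mono) auto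
    finally have xq: "x ^ (l * c) \<le> q ^ d" .
    have "(\<Prod>j\<in>K. real (s choose k j) / real (n choose k j)) \<le> (\<Prod>j\<in>K. x ^ l)"
      using ratio by (intro prod_mono) auto
    also have "\<dots> = x ^ (l * c)" using K by (simp add: power_mult)
    also note xq
    finally have 3: "(\<Prod>j\<in>K. real (s choose k j) / real (n choose k j)) \<le> q ^ d" .
    have "real (g choose c) * (real (n choose s) * (\<Prod>j\<in>K. real (s choose k j) / real (n choose k j)))
        \<le> real n ^ (d - 1) * (real n ^ d * q ^ d)"
      by (intro mult_mono 1 2 3 mult_nonneg_nonneg prod_nonneg) auto
    also have "\<dots> \<le> real n ^ d * (real n ^ d * q ^ d)"
      using n q0 by (intro mult_right_mono power_increasing) auto
    also have "\<dots> = (real n ^ 2 * q) ^ d" by (simp add: power_mult_distrib power2_eq_square)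
    also have "\<dots> \<le> (real n ^ 2 * q) ^ 1" using d q q0 n by (intro power_decreasing) auto
    finally show ?thesis by simp
  qed
qed

lemma set_pmf_sampling:
  assumes "\<Omega> \<in> set_pmf (sampling n m k)" "\<And>j. j < m \<Longrightarrow> k j \<le> n" "j < m"
  shows "\<Omega> j \<subseteq> {..<n}" "card (\<Omega> j) = k j"
proof -
  let ?S = "{S. S \<subseteq> {..<n} \<and> card S = k j}"
  have "card ?S = n choose k j" using n_subsets[of "{..<n}" "k j"] by simp
  then have "?S \<noteq> {}" using assms(2)[OF assms(3)] by (metis card.empty zero_less_binomial less_numeral_extra(3))
  moreover have "finite ?S" by (rule finite_subset[of _ "Pow {..<n}"]) auto
  moreover have "\<Omega> j \<in> set_pmf (pmf_of_set ?S)"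
    using assms(1,3) unfolding sampling_def by (auto simp: set_Pi_pmf PiE_dflt_def)
  ultimately show "\<Omega> j \<subseteq> {..<n}" "card (\<Omega> j) = k j" by auto
qed

text \<open>A violation is witnessed by \<open>c\<close> columns whose observed rows fit into a set
  of \<open>c + \<rho> - 1\<close> rows. Each of the at most \<open>n\<close> sizes \<open>c\<close>
  contributes at most \<open>n^2 * q\<close>, so a factor \<open>n^3\<close> must be absorbed; this
  accounts for the coefficient 9 in the bound on \<open>l\<close>.\<close>

theorem prob_hall_surplus_fails:
  fixes n m l \<rho> :: nat and k :: "nat \<Rightarrow> nat" and \<epsilon> \<mu> :: real
  assumes G: "G \<subseteq> {..<m}" "card G + \<rho> \<le> n" and k: "\<And>j. j < m \<Longrightarrow> l \<le> k j \<and> k j \<le> n"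
    and l: "\<rho> + 1 \<le> l" "real l > 9 * ln (real n / \<epsilon>) + 3 * ln (6 * \<mu> / \<epsilon>) + 6"
    and \<rho>: "3 * \<rho> \<le> n" and \<epsilon>: "0 < \<epsilon>" "\<epsilon> < 1" and \<mu>: "1 \<le> \<mu>"
  shows "measure_pmf.prob (sampling n m k) {\<Omega>. \<not> hall_surplus \<rho> \<Omega> G} \<le> \<epsilon> / (24 * \<mu>)"
proof (cases "n = 0")
  case True
  then have "G = {}" using G finite_subset[OF G(1)] by auto
  then show ?thesis using \<epsilon> \<mu> by (simp add: hall_surplus_def)
next
  case False
  then have n: "1 \<le> n" by simp
  \<comment> \<open>The exponential of minus one third of the threshold for \<open>l\<close>: its
    coefficients 9, 3 and 6 become the exponents 3, 1 and 2.\<close>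
  define q where "q = (\<epsilon> / n) ^ 3 * (\<epsilon> / (6 * \<mu>)) * exp (- 2)"
  have "exp (- (real l / 3)) \<le> exp (- (3 * ln (real n / \<epsilon>) + ln (6 * \<mu> / \<epsilon>) + 2))" using l(2) by simp
  also have "\<dots> = exp (ln (\<epsilon> / n)) ^ 3 * exp (ln (\<epsilon> / (6 * \<mu>))) * exp (- 2)"
    using n \<epsilon> \<mu> by (simp add: exp_of_nat_mult[symmetric] exp_add[symmetric] ln_div algebra_simps)
  also have "\<dots> = q" using n \<epsilon> \<mu> by (simp add: q_def)
  finally have q1: "exp (- (real l / 3)) \<le> q" .
  have n3q: "real n ^ 3 * q \<le> \<epsilon> / (24 * \<mu>)"
  proof -
    have "real n ^ 3 * q = \<epsilon> ^ 3 * (\<epsilon> / (6 * \<mu>)) * exp (- 2)" using n by (simp add: q_def field_simps)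
    \<comment> \<open>The summand 6 of the threshold yields \<open>exp (- 2) \<le> 1 / 4\<close>,
      and \<open>6 * 4 = 24\<close> is the constant in the claim.\<close>
    also have "\<dots> \<le> 1 * (\<epsilon> / (6 * \<mu>)) * (1 / 4)"
    proof (intro mult_mono)
      have "(2::real) ^ 2 \<le> exp 1 ^ 2" using exp_ge_add_one_self[of 1] by (intro power_mono) auto
      also have "exp (1::real) ^ 2 = exp 2" by (simp add: exp_of_nat_mult[symmetric])
      finally show "exp (- 2 :: real) \<le> 1 / 4" by (simp add: exp_minus field_simps)
    qed (use \<epsilon> \<mu> in \<open>auto intro: power_le_one\<close>)
    finally show ?thesis by simp
  qed
  have q0: "0 < q" using q1 by (meson exp_gt_zero less_le_trans)
  have n2q: "real n ^ 2 * q \<le> 1"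
  proof -
    have "real n ^ 2 * q \<le> real n ^ 3 * q" using n q0 by (intro mult_right_mono power_increasing) auto
    also have "\<dots> \<le> \<epsilon> / (24 * \<mu>)" by (rule n3q)
    also have "\<dots> \<le> 1" using \<epsilon> \<mu> by (simp add: divide_simps)
    finally show ?thesis .
  qed
  let ?P = "measure_pmf.prob (sampling n m k)"
  define g where "g = card G"
  have finG: "finite G" using G(1) finite_subset by blast
  define KK where "KK = (\<lambda>c. {K. K \<subseteq> G \<and> card K = c})"
  define ZZ where "ZZ = (\<lambda>c. {Z. Z \<subseteq> {..<n} \<and> card Z = c + \<rho> - 1})"
  define E where "E = (\<lambda>K Z. {\<Omega> :: nat \<Rightarrow> nat set. \<forall>j\<in>K. \<Omega> j \<subseteq> Z})"
  have finK: "finite (KK c)" for c unfolding KK_def by (rule finite_subset[of _ "Pow G"]) (use finG in auto)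
  have finZ: "finite (ZZ c)" for c unfolding ZZ_def by (rule finite_subset[of _ "Pow {..<n}"]) auto
  have "{\<Omega>. \<not> hall_surplus \<rho> \<Omega> G} \<inter> set_pmf (sampling n m k) \<subseteq> (\<Union>c\<in>{1..g}. \<Union>K\<in>KK c. \<Union>Z\<in>ZZ c. E K Z)"
  proof
    fix \<Omega> assume \<Omega>: "\<Omega> \<in> {\<Omega>. \<not> hall_surplus \<rho> \<Omega> G} \<inter> set_pmf (sampling n m k)"
    then obtain K where K: "K \<subseteq> G" "K \<noteq> {}" "card (\<Union> (\<Omega> ` K)) < card K + \<rho>"
      unfolding hall_surplus_def by (auto simp: not_le)
    have "finite K" using K(1) finG by (rule finite_subset)
    then have c: "1 \<le> card K" "card K \<le> g" using K finG by (auto simp: g_def card_mono Suc_le_eq card_gt_0_iff)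
    have U: "\<Union> (\<Omega> ` K) \<subseteq> {..<n}" using \<Omega> set_pmf_sampling(1)[of \<Omega> n m k] k K(1) G(1) by blast
    \<comment> \<open>Padding the covered rows to one fixed size leaves a single row-set size per
      \<open>c\<close>; \<open>card G + \<rho> \<le> n\<close> provides the room.\<close>
    have "\<exists>Z. \<Union> (\<Omega> ` K) \<subseteq> Z \<and> Z \<subseteq> {..<n} \<and> card Z = card K + \<rho> - 1"
      using K(3) c G(2) U by (intro exists_subset_between) (auto simp: g_def)
    then obtain Z where Z: "\<Union> (\<Omega> ` K) \<subseteq> Z" "Z \<subseteq> {..<n}" "card Z = card K + \<rho> - 1" by blast
    have "K \<in> KK (card K)" "Z \<in> ZZ (card K)" "\<Omega> \<in> E K Z" using K Z by (auto simp: KK_def ZZ_def E_def)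
    then show "\<Omega> \<in> (\<Union>c\<in>{1..g}. \<Union>K\<in>KK c. \<Union>Z\<in>ZZ c. E K Z)" using c by (intro UN_I[of "card K"] UN_I[of K] UN_I[of Z]) auto
  qed
  then have "?P {\<Omega>. \<not> hall_surplus \<rho> \<Omega> G} \<le> ?P (\<Union>c\<in>{1..g}. \<Union>K\<in>KK c. \<Union>Z\<in>ZZ c. E K Z)"
    by (subst measure_Int_set_pmf[symmetric]) (rule measure_pmf.finite_measure_mono, auto)
  also have "\<dots> \<le> (\<Sum>c\<in>{1..g}. \<Sum>K\<in>KK c. \<Sum>Z\<in>ZZ c. ?P (E K Z))"
    by (intro order_trans[OF measure_UNION_le] sum_mono order_refl) (auto simp: finK finZ)
  also have "\<dots> \<le> (\<Sum>c\<in>{1..g}. real n ^ 2 * q)"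
  proof (rule sum_mono)
    fix c assume c: "c \<in> {1..g}"
    define s where "s = c + \<rho> - 1"
    have s: "s + 1 = c + \<rho>" "s < n" using c G(2) by (auto simp: s_def g_def)
    have cardZ: "card (ZZ c) = n choose s" unfolding ZZ_def s_def using n_subsets[of "{..<n}"] by simp
    have cardK: "card (KK c) = g choose c" unfolding KK_def g_def using n_subsets[OF finG] by simp
    have bound: "real (g choose c) * (\<Sum>Z\<in>ZZ c. ?P (E K Z)) \<le> real n ^ 2 * q" if K: "K \<in> KK c" for K
    proof -
      have Kf: "finite K" "K \<subseteq> G" "card K = c" using K finG finite_subset by (auto simp: KK_def)
      have "(\<Sum>Z\<in>ZZ c. ?P (E K Z)) = (\<Sum>Z\<in>ZZ c. \<Prod>j\<in>K. real (s choose k j) / real (n choose k j))"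
        unfolding E_def
      proof (intro sum.cong refl)
        fix Z assume "Z \<in> ZZ c"
        then have "Z \<subseteq> {..<n}" "card Z = s" by (auto simp: ZZ_def s_def)
        then show "?P {\<Omega>. \<forall>j\<in>K. \<Omega> j \<subseteq> Z} = (\<Prod>j\<in>K. real (s choose k j) / real (n choose k j))"
          using prob_columns_within[OF Kf(1), of m Z n k] Kf(2) G(1) k by auto
      qed
      then show ?thesis
        using union_bound_term[OF Kf(1,3) _ _ s l(1) \<rho> _ _ q1 n2q, of k g] c k Kf(2) G
        by (auto simp: cardZ g_def subset_iff)
    qed
    have "0 < g choose c" using c by simp
    then have "(\<Sum>K\<in>KK c. \<Sum>Z\<in>ZZ c. ?P (E K Z)) \<le> (\<Sum>K\<in>KK c. real n ^ 2 * q / real (g choose c))"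
      using bound by (intro sum_mono) (simp add: field_simps)
    also have "\<dots> = real n ^ 2 * q" using c by (simp add: cardK)
    finally show "(\<Sum>K\<in>KK c. \<Sum>Z\<in>ZZ c. ?P (E K Z)) \<le> real n ^ 2 * q" .
  qed
  also have "\<dots> = real g * (real n ^ 2 * q)" by simp
  also have "\<dots> \<le> real n * (real n ^ 2 * q)" using G(2) q0 by (intro mult_right_mono) (auto simp: g_def)
  also have "\<dots> = real n ^ 3 * q" by (simp add: power3_eq_cube power2_eq_square)
  also have "\<dots> \<le> \<epsilon> / (24 * \<mu>)" by (rule n3q)
  finally show ?thesis .
qed

section \<open>Active columns\<close>

text \<open>Group \<open>q\<close> has as many columns as \<open>v q\<close> has non-pivot entries.
  Its inactive columns give independent equations and remove one entry each, so as many entries stay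
  free as the group has active columns. Every active column, wherever it lies, makes one coefficient
  parameter redundant; hence there are no more active columns than free entries, and the groups
  already contain that many.\<close>

lemma no_extra_active:
  fixes a :: "'q \<Rightarrow> nat \<Rightarrow> nat \<Rightarrow> real" and v :: "'q \<Rightarrow> nat \<Rightarrow> real" and T :: "nat \<Rightarrow> 'i set"
  assumes I: "finite I" "alg_indep I p" "Ib \<subseteq> I"
    and cols: "finite Cols" "\<And>j. j \<in> Cols \<Longrightarrow> T j \<subseteq> I - Ib" "disjoint_family_on T Cols"
    and Qs: "finite Qs" "disjoint_family_on Gr Qs" "\<And>q. q \<in> Qs \<Longrightarrow> Gr q \<subseteq> Cols"
    and Piv: "\<And>q. q \<in> Qs \<Longrightarrow> Piv q \<subseteq> {..<n}" "\<And>q. q \<in> Qs \<Longrightarrow> card (Gr q) + card (Piv q) = n"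
      "\<And>q i. q \<in> Qs \<Longrightarrow> i \<in> Piv q \<Longrightarrow> v q i \<in> ratgen (p ` Ib)"
    and a: "\<And>q j i. q \<in> Qs \<Longrightarrow> j \<in> Gr q \<Longrightarrow> i < n \<Longrightarrow> a q j i \<in> ratgen (p ` Ib)"
      "\<And>q j. q \<in> Qs \<Longrightarrow> j \<in> Gr q \<Longrightarrow> \<not> act j \<Longrightarrow> (\<Sum>i<n. a q j i * v q i) = 0"
      "\<And>q. q \<in> Qs \<Longrightarrow> indep_on ({..<n} - Piv q) {j \<in> Gr q. \<not> act j} (a q)"
    and act: "\<And>j. j \<in> Cols \<Longrightarrow> act j \<Longrightarrow>
      \<exists>t\<in>T j. p t \<in> ratgen (p ` Ib \<union> {v q i | q i. q \<in> Qs \<and> i < n} \<union> p ` (T j - {t}))"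
    and j: "j \<in> Cols" "act j"
  shows "j \<in> (\<Union>q\<in>Qs. Gr q)"
proof -
  have finGr: "finite (Gr q)" if "q \<in> Qs" for q using Qs(3)[OF that] cols(1) by (rule finite_subset)
  have "\<exists>Q. Q \<subseteq> {..<n} - Piv q \<and> card Q = card {j \<in> Gr q. \<not> act j} \<and>
      (\<forall>i\<in>{..<n} - Piv q. v q i \<in> ratgen (p ` Ib \<union> v q ` ({..<n} - Piv q - Q)))" if q: "q \<in> Qs" for q
  proof -
    have "(\<Sum>i\<in>{..<n} - Piv q. a q j i * v q i) \<in> ratgen (p ` Ib)" if j: "j \<in> {j \<in> Gr q. \<not> act j}" for j
    proof -
      have "(\<Sum>i\<in>{..<n} - Piv q. a q j i * v q i) = 0 - (\<Sum>i\<in>Piv q. a q j i * v q i)"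
        using a(2)[OF q] j Piv(1)[OF q] by (subst sum_diff) auto
      also have "\<dots> \<in> ratgen (p ` Ib)"
        using q j Piv(1)[OF q] by (intro ratgen_field ratgen_sum a Piv) auto
      finally show ?thesis .
    qed
    then have "\<exists>Q\<subseteq>{..<n} - Piv q. card Q = card {j \<in> Gr q. \<not> act j} \<and>
      (\<forall>i\<in>{..<n} - Piv q. v q i \<in> ratgen (p ` Ib \<union> v q ` ({..<n} - Piv q - Q)))"
      using finGr[OF q] a(1)[OF q] a(3)[OF q] by (intro solve_linear_forms[where a = "a q"]) auto
    then show ?thesis by blast
  qed
  then have "\<forall>q\<in>Qs. \<exists>Q. Q \<subseteq> {..<n} - Piv q \<and> card Q = card {j \<in> Gr q. \<not> act j} \<and>
      (\<forall>i\<in>{..<n} - Piv q. v q i \<in> ratgen (p ` Ib \<union> v q ` ({..<n} - Piv q - Q)))" by (rule ballI)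
  from bchoice[OF this] obtain Q where Q0: "\<forall>q\<in>Qs. Q q \<subseteq> {..<n} - Piv q \<and> card (Q q) = card {j \<in> Gr q. \<not> act j} \<and>
      (\<forall>i\<in>{..<n} - Piv q. v q i \<in> ratgen (p ` Ib \<union> v q ` ({..<n} - Piv q - Q q)))" by (elim exE)
  have Q: "\<And>q. q \<in> Qs \<Longrightarrow> Q q \<subseteq> {..<n} - Piv q"
      "\<And>q. q \<in> Qs \<Longrightarrow> card (Q q) = card {j \<in> Gr q. \<not> act j}"
      "\<And>q i. q \<in> Qs \<Longrightarrow> i \<in> {..<n} - Piv q \<Longrightarrow> v q i \<in> ratgen (p ` Ib \<union> v q ` ({..<n} - Piv q - Q q))"
    using Q0 by blast+
  \<comment> \<open>The entries still free after the equations of the inactive columns have been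
    solved for the entries in \<open>Q q\<close>.\<close>
  define D where "D = Sigma Qs (\<lambda>q. {..<n} - Piv q - Q q)"
  define w where "w = (\<lambda>(q, i). v q i)"
  have cardD: "card ({..<n} - Piv q - Q q) = card {j \<in> Gr q. act j}" if q: "q \<in> Qs" for q
  proof -
    have "finite (Piv q)" "finite (Q q)" using Piv(1)[OF q] Q(1)[OF q] by (auto intro: finite_subset)
    then have "card ({..<n} - Piv q - Q q) = n - card (Piv q) - card {j \<in> Gr q. \<not> act j}"
      using Piv(1)[OF q] Q(1,2)[OF q] by (simp add: card_Diff_subset)
    moreover have "card (Gr q) = card ({j \<in> Gr q. act j} \<union> {j \<in> Gr q. \<not> act j})"
      by (rule arg_cong[where f = card]) auto
    then have "card (Gr q) = card {j \<in> Gr q. act j} + card {j \<in> Gr q. \<not> act j}"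
      using finGr[OF q] by (subst (asm) card_Un_disjoint) auto
    ultimately show ?thesis using Piv(2)[OF q] by simp
  qed
  have vD: "v q i \<in> ratgen (p ` Ib \<union> w ` D)" if q: "q \<in> Qs" and i: "i < n" for q i
  proof (cases "i \<in> Piv q")
    case True
    show ?thesis by (rule ratgen_mono[OF _ Piv(3)[OF q True]]) auto
  next
    case False
    have "p ` Ib \<union> v q ` ({..<n} - Piv q - Q q) \<subseteq> p ` Ib \<union> w ` D"
      using q by (force simp: D_def w_def)
    then show ?thesis using Q(3)[OF q, of i] i False by (intro ratgen_mono[of _ "p ` Ib \<union> w ` D"]) auto
  qed
  define A where "A = {j \<in> Cols. act j}"
  have finA: "finite A" using cols(1) by (simp add: A_def)
  have "\<forall>j\<in>A. \<exists>t. t \<in> T j \<and> p t \<in> ratgen (p ` Ib \<union> {v q i | q i. q \<in> Qs \<and> i < n} \<union> p ` (T j - {t}))"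
    using act unfolding A_def by blast
  from bchoice[OF this] obtain t where t: "\<And>j. j \<in> A \<Longrightarrow> t j \<in> T j"
     "\<And>j. j \<in> A \<Longrightarrow> p (t j) \<in> ratgen (p ` Ib \<union> {v q i | q i. q \<in> Qs \<and> i < n} \<union> p ` (T j - {t j}))"
    by auto
  have disj: "j = j'" if "j \<in> A" "j' \<in> A" "x \<in> T j" "x \<in> T j'" for j j' x
    using cols(3) that unfolding disjoint_family_on_def A_def by blast
  have injt: "inj_on t A" using t(1) disj by (intro inj_onI) metis
  have tI: "t ` A \<subseteq> I - Ib" using t(1) cols(2) by (force simp: A_def)
  have "card A \<le> card D"
  proof (rule transcendence_count[OF I(1,2) _ injt])
    show "finite D" unfolding D_def using Qs(1) by auto
    show "t ` A \<subseteq> I" using tI by blast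
    fix j assume j: "j \<in> A"
    let ?Y = "p ` (I - t ` A) \<union> w ` D"
    have Ib: "p ` Ib \<subseteq> ?Y" using I(3) tI by blast
    have "T j - {t j} \<subseteq> I - t ` A"
    proof
      fix x assume x: "x \<in> T j - {t j}"
      then have "x \<notin> t ` A" using disj[OF j, of _ x] t(1) by auto
      then show "x \<in> I - t ` A" using x cols(2) j by (auto simp: A_def)
    qed
    moreover have "{v q i | q i. q \<in> Qs \<and> i < n} \<subseteq> ratgen ?Y"
      using ratgen_mono[of "p ` Ib \<union> w ` D" ?Y] vD Ib by blast
    ultimately have "p ` Ib \<union> {v q i | q i. q \<in> Qs \<and> i < n} \<union> p ` (T j - {t j}) \<subseteq> ratgen ?Y"
      using Ib by (intro Un_least) (auto intro!: ratgen_base)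
    then show "p (t j) \<in> ratgen ?Y" using t(2)[OF j] by (rule ratgen_least)
  qed
  also have "card D = (\<Sum>q\<in>Qs. card {j \<in> Gr q. act j})"
    unfolding D_def using Qs(1) cardD by (subst card_SigmaI) auto
  also have "\<dots> = card (\<Union>q\<in>Qs. {j \<in> Gr q. act j})"
    using Qs finGr by (subst card_UN_disjoint) (auto simp: disjoint_family_on_def)
  finally have "card A \<le> card (\<Union>q\<in>Qs. {j \<in> Gr q. act j})" .
  moreover have "(\<Union>q\<in>Qs. {j \<in> Gr q. act j}) \<subseteq> A" using Qs(3) unfolding A_def by blast
  ultimately have "(\<Union>q\<in>Qs. {j \<in> Gr q. act j}) = A" using finA by (intro card_seteq)
  then show ?thesis using j unfolding A_def by blast
qed

lemma in_span_orthogonal: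
  assumes "in_span R L V u" "\<And>l. l \<in> L \<Longrightarrow> (\<Sum>i\<in>R. a i * V l i) = 0"
  shows "(\<Sum>i\<in>R. a i * u i) = (0::real)"
proof -
  obtain c where c: "\<And>i. i \<in> R \<Longrightarrow> u i = (\<Sum>l\<in>L. c l * V l i)" using assms(1) unfolding in_span_def by blast
  have "(\<Sum>i\<in>R. a i * u i) = (\<Sum>i\<in>R. \<Sum>l\<in>L. c l * (a i * V l i))"
    by (intro sum.cong refl) (simp add: c sum_distrib_left algebra_simps)
  also have "\<dots> = (\<Sum>l\<in>L. c l * (\<Sum>i\<in>R. a i * V l i))" by (subst sum.swap) (simp add: sum_distrib_left)
  finally show ?thesis using assms(2) by simp
qed

lemma in_span_mono: "in_span R L V u \<Longrightarrow> R' \<subseteq> R \<Longrightarrow> in_span R' L V u"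
  unfolding in_span_def by blast

lemma in_span_trans:
  assumes "in_span R L V u" "\<And>l. l \<in> L \<Longrightarrow> in_span R K W (V l)"
  shows "in_span R K W u"
proof -
  obtain c where c: "\<And>i. i \<in> R \<Longrightarrow> u i = (\<Sum>l\<in>L. c l * V l i)" using assms(1) unfolding in_span_def by blast
  obtain d where d: "\<And>l i. l \<in> L \<Longrightarrow> i \<in> R \<Longrightarrow> V l i = (\<Sum>k\<in>K. d l k * W k i)"
    using assms(2) unfolding in_span_def by metis
  show ?thesis
  proof (rule in_span_byI[where c = "\<lambda>k. \<Sum>l\<in>L. c l * d l k"])
    fix i assume i: "i \<in> R"
    have "u i = (\<Sum>l\<in>L. \<Sum>k\<in>K. c l * d l k * W k i)"
      using i by (simp add: c d sum_distrib_left mult.assoc)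
    also have "\<dots> = (\<Sum>k\<in>K. (\<Sum>l\<in>L. c l * d l k) * W k i)"
      by (subst sum.swap) (simp add: sum_distrib_right)
    finally show "u i = (\<Sum>k\<in>K. (\<Sum>l\<in>L. c l * d l k) * W k i)" .
  qed
qed

text \<open>\<open>a j\<close> is a linear relation among the observed rows of the matrix whose
  columns are the \<open>C j k\<close>, with coefficients in the field generated by
  \<open>F\<close>. The name comes from the matroid of rows, although the support may exceed a
  minimal one.\<close>

definition circuits :: "nat \<Rightarrow> real set \<Rightarrow> (nat \<Rightarrow> nat set) \<Rightarrow> nat set \<Rightarrow> (nat \<Rightarrow> 'k set) \<Rightarrow> (nat \<Rightarrow> 'k \<Rightarrow> nat \<Rightarrow> real) \<Rightarrow> (nat \<Rightarrow> nat \<Rightarrow> real) \<Rightarrow> bool" where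
  "circuits n F \<Omega> G K C a \<longleftrightarrow>
     (\<forall>j\<in>G. (\<forall>i. a j i \<in> ratgen F) \<and> (\<forall>i. i \<notin> \<Omega> j \<longrightarrow> a j i = 0) \<and> (\<forall>k\<in>K j. (\<Sum>i<n. a j i * C j k i) = 0))
     \<and> indep_on {..<n} G a"

text \<open>The view of a column selects its true basis B (with coefficients p (\<tau> j t)), the candidate basis V, and
  the family C to which the circuits are orthogonal. The vectors v q are the unknowns, Gr q their column
  groups and Piv q the rows in which they are known; E is the spare group.\<close>

theorem candidate_in_span:
  fixes n :: nat and \<tau> :: "nat \<Rightarrow> nat \<Rightarrow> 'i" and view :: "nat \<Rightarrow> 'v" and V :: "'v \<Rightarrow> 'l \<Rightarrow> nat \<Rightarrow> real"
    and a :: "'q \<Rightarrow> nat \<Rightarrow> nat \<Rightarrow> real" and C :: "'v \<Rightarrow> 'k \<Rightarrow> nat \<Rightarrow> real"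
  assumes I: "finite I" "alg_indep I p" "Ib \<subseteq> I"
    and cols: "finite Cols" "\<And>j t. j \<in> Cols \<Longrightarrow> t < \<kappa> (view j) \<Longrightarrow> \<tau> j t \<in> I - Ib"
      "\<And>j t j' t'. j \<in> Cols \<Longrightarrow> j' \<in> Cols \<Longrightarrow> t < \<kappa> (view j) \<Longrightarrow> t' < \<kappa> (view j') \<Longrightarrow> \<tau> j t = \<tau> j' t' \<Longrightarrow> j = j' \<and> t = t'"
    and B: "\<And>j t i. j \<in> Cols \<Longrightarrow> t < \<kappa> (view j) \<Longrightarrow> i < n \<Longrightarrow> B (view j) t i \<in> ratgen (p ` Ib)"
    and V: "\<And>j l i. j \<in> Cols \<Longrightarrow> l \<in> L (view j) \<Longrightarrow> i < n \<Longrightarrow>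
        V (view j) l i \<in> ratgen (p ` Ib \<union> {v q i | q i. q \<in> Qs \<and> i < n})"
    and LK: "\<And>j. j \<in> Cols \<Longrightarrow> finite (L (view j))" "\<And>j. j \<in> Cols \<Longrightarrow> finite (K (view j))"
      "\<And>j. j \<in> Cols \<Longrightarrow> card (L (view j)) \<le> card (K (view j))"
    and \<Omega>: "\<And>j. j \<in> Cols \<Longrightarrow> \<Omega> j \<subseteq> {..<n}" "\<And>j. j \<in> Cols \<Longrightarrow> indep_on (\<Omega> j) (K (view j)) (C (view j))"
    and gen: "\<And>j. j \<in> Cols \<Longrightarrow> (\<And>t. t < \<kappa> (view j) \<Longrightarrow> in_span (\<Omega> j) (L (view j)) (V (view j)) (B (view j) t))
        \<Longrightarrow> (\<And>k. k \<in> K (view j) \<Longrightarrow> in_span (\<Omega> j) (L (view j)) (V (view j)) (C (view j) k))"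
    and cons: "\<And>j. j \<in> Cols \<Longrightarrow> in_span (\<Omega> j) (L (view j)) (V (view j)) (\<lambda>i. \<Sum>t<\<kappa> (view j). B (view j) t i * p (\<tau> j t))"
    and Qs: "finite Qs" "disjoint_family_on Gr Qs" "\<And>q. q \<in> Qs \<Longrightarrow> Gr q \<subseteq> Cols"
    and Piv: "\<And>q. q \<in> Qs \<Longrightarrow> Piv q \<subseteq> {..<n}" "\<And>q. q \<in> Qs \<Longrightarrow> card (Gr q) + card (Piv q) = n"
      "\<And>q i. q \<in> Qs \<Longrightarrow> i \<in> Piv q \<Longrightarrow> v q i \<in> ratgen (p ` Ib)"
    and a: "\<And>q. q \<in> Qs \<Longrightarrow> circuits n (p ` Ib) \<Omega> (Gr q) (\<lambda>j. K (view j)) (\<lambda>j. C (view j)) (a q)"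
    and vspan: "\<And>q j. q \<in> Qs \<Longrightarrow> j \<in> Gr q \<Longrightarrow> in_span {..<n} (L (view j)) (V (view j)) (v q)"
    and unit: "\<And>q i. q \<in> Qs \<Longrightarrow> i \<in> Piv q \<Longrightarrow> \<exists>u. (\<forall>j\<in>Gr q. in_span {..<n} (L (view j)) (V (view j)) u) \<and>
        (\<forall>i'\<in>Piv q. u i' = (if i' = i then 1 else 0))"
    and E: "E \<subseteq> Cols" "\<And>q. q \<in> Qs \<Longrightarrow> E \<inter> Gr q = {}" "\<And>j. j \<in> E \<Longrightarrow> view j = \<nu>" "card E + card (K \<nu>) = n"
      "circuits n (p ` Ib) \<Omega> E (\<lambda>j. K (view j)) (\<lambda>j. C (view j)) e" "indep_on {..<n} (K \<nu>) (C \<nu>)" "finite (K \<nu>)"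
    and l: "l \<in> L \<nu>"
  shows "in_span {..<n} (K \<nu>) (C \<nu>) (V \<nu> l)"
proof -
  define act where "act = (\<lambda>j. \<not> (\<forall>t<\<kappa> (view j). in_span (\<Omega> j) (L (view j)) (V (view j)) (B (view j) t)))"
  \<comment> \<open>On the observed rows of an inactive column the independent family
    \<open>C\<close> lies in the candidate span, which has no larger dimension. By exchange both
    spans agree there, so a relation valid for \<open>C\<close> annihilates the candidate as
    well.\<close>
  have perp: "(\<Sum>i<n. b i * V (view j) l i) = 0"
    if j: "j \<in> Cols" "\<not> act j" and b: "\<And>i. i \<notin> \<Omega> j \<Longrightarrow> b i = 0" "\<And>k. k \<in> K (view j) \<Longrightarrow> (\<Sum>i<n. b i * C (view j) k i) = 0"
      and l: "l \<in> L (view j)" for j b l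
  proof -
    have sub: "(\<Sum>i<n. b i * f i) = (\<Sum>i\<in>\<Omega> j. b i * f i)" for f
      using \<Omega>(1)[OF j(1)] b(1) by (intro sum.mono_neutral_right) auto
    have "in_span (\<Omega> j) (K (view j)) (C (view j)) (V (view j) l)"
    proof (rule in_span_exchange[OF \<Omega>(2)[OF j(1)] LK(2)[OF j(1)] LK(1)[OF j(1)] LK(3)[OF j(1)]])
      show "\<And>k. k \<in> K (view j) \<Longrightarrow> in_span (\<Omega> j) (L (view j)) (V (view j)) (C (view j) k)"
        using gen[OF j(1)] j(2) unfolding act_def by blast
      show "in_span (\<Omega> j) (L (view j)) (V (view j)) (V (view j) l)" using LK(1)[OF j(1)] l by (rule in_span_base)
    qed
    then show ?thesis unfolding sub by (rule in_span_orthogonal) (use b(2) sub in simp)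
  qed
  have circ: "(\<Sum>i<n. b j i * u i) = 0"
    if "circuits n (p ` Ib) \<Omega> G (\<lambda>j. K (view j)) (\<lambda>j. C (view j)) b" "j \<in> G" "G \<subseteq> Cols" "\<not> act j"
      "in_span {..<n} (L (view j)) (V (view j)) u" for G b j u
  proof (rule in_span_orthogonal[OF that(5)])
    fix l assume l: "l \<in> L (view j)"
    show "(\<Sum>i<n. b j i * V (view j) l i) = 0"
      by (rule perp[OF subsetD[OF that(3,2)] that(4) _ _ l]) (use that(1,2) in \<open>simp_all add: circuits_def\<close>)
  qed
  have inactive: "\<not> act j" if j: "j \<in> E" for j
  proof
    assume actj: "act j"
    have "j \<in> (\<Union>q\<in>Qs. Gr q)"
    proof (rule no_extra_active[OF I cols(1) _ _ Qs Piv, where T = "\<lambda>j. \<tau> j ` {..<\<kappa> (view j)}" and a = a and act = act])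
      show "disjoint_family_on (\<lambda>j. \<tau> j ` {..<\<kappa> (view j)}) Cols"
        unfolding disjoint_family_on_def using cols(3) by (auto simp: set_eq_iff)
      fix q assume q: "q \<in> Qs"
      have finGr: "finite (Gr q)" using Qs(3)[OF q] cols(1) by (rule finite_subset)
      \<comment> \<open>A combination that vanishes off the pivot rows vanishes on them too: pairing
        it with a candidate vector that is a unit vector on \<open>Piv q\<close> returns the entry
        at that pivot, and the pairing is zero because the columns involved are inactive.\<close>
      show "indep_on ({..<n} - Piv q) {j \<in> Gr q. \<not> act j} (a q)"
      proof (rule indep_onI)
        fix c k assume c: "\<And>i. i \<in> {..<n} - Piv q \<Longrightarrow> (\<Sum>k | k \<in> Gr q \<and> \<not> act k. c k * a q k i) = 0"
          and k: "k \<in> {j \<in> Gr q. \<not> act j}"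
        have "(\<Sum>k | k \<in> Gr q \<and> \<not> act k. c k * a q k i) = 0" if i: "i \<in> Piv q" for i
        proof -
          obtain u where u: "\<And>j. j \<in> Gr q \<Longrightarrow> in_span {..<n} (L (view j)) (V (view j)) u"
            "\<And>i'. i' \<in> Piv q \<Longrightarrow> u i' = (if i' = i then 1 else 0)" using unit[OF q i] by blast
          define s where "s = (\<lambda>i. \<Sum>k | k \<in> Gr q \<and> \<not> act k. c k * a q k i)"
          have "(\<Sum>i<n. s i * u i) = (\<Sum>k | k \<in> Gr q \<and> \<not> act k. c k * (\<Sum>i<n. a q k i * u i))"
            unfolding s_def sum_distrib_right sum_distrib_left by (subst sum.swap) (simp add: mult.assoc)
          also have "\<dots> = 0"
            using circ[OF a[OF q] _ Qs(3)[OF q]] u(1) by (intro sum.neutral) auto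
          finally have "(\<Sum>i<n. s i * u i) = 0" .
          moreover have "(\<Sum>i'<n. s i' * u i') = (\<Sum>i'<n. if i' = i then s i else 0)"
          proof (intro sum.cong refl)
            fix i' assume i': "i' \<in> {..<n}"
            show "s i' * u i' = (if i' = i then s i else 0)"
            proof (cases "i' \<in> Piv q")
              case True
              then show ?thesis using u(2) by simp
            next
              case False
              then have "s i' = 0" using c i' unfolding s_def by blast
              then show ?thesis using False i by auto
            qed
          qed
          ultimately show ?thesis using i Piv(1)[OF q] by (auto simp: s_def split: if_splits)
        qed
        then have z: "(\<Sum>k | k \<in> Gr q \<and> \<not> act k. c k * a q k i) = 0" if "i \<in> {..<n}" for i
          using c[of i] that by (cases "i \<in> Piv q") simp_all
        have "indep_on {..<n} {j \<in> Gr q. \<not> act j} (a q)"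
          by (rule indep_on_subset[OF a[OF q, unfolded circuits_def, THEN conjunct2] _ finGr]) simp
        then show "c k = 0" by (rule indep_onD[OF _ z k])
      qed
    next
      fix j assume j: "j \<in> Cols" "act j"
      let ?F = "p ` Ib \<union> {v q i | q i. q \<in> Qs \<and> i < n}"
      let ?\<nu> = "view j"
      obtain z where z: "\<And>i. i \<in> \<Omega> j \<Longrightarrow> (\<Sum>t<\<kappa> ?\<nu>. B ?\<nu> t i * p (\<tau> j t)) = (\<Sum>l\<in>L ?\<nu>. z l * V ?\<nu> l i)"
        using cons[OF j(1)] unfolding in_span_def by blast
      \<comment> \<open>The true coefficients play the role of \<open>x\<close>; the candidate's
        coefficients are the auxiliary unknowns to be eliminated.\<close>
      have "(\<forall>x'. \<exists>z'. \<forall>i\<in>\<Omega> j. (\<Sum>t\<in>{..<\<kappa> ?\<nu>}. B ?\<nu> t i * x' t) = (\<Sum>s\<in>L ?\<nu>. V ?\<nu> s i * z' s)) \<or>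
         (\<exists>t\<in>{..<\<kappa> ?\<nu>}. p (\<tau> j t) \<in> ratgen (?F \<union> (\<lambda>t. p (\<tau> j t)) ` ({..<\<kappa> ?\<nu>} - {t})))"
      proof (rule eliminate_auxiliary)
        fix i t assume "i \<in> \<Omega> j" "t \<in> {..<\<kappa> ?\<nu>}"
        then show "B ?\<nu> t i \<in> ratgen ?F"
          using B[OF j(1)] \<Omega>(1)[OF j(1)] by (intro ratgen_mono[OF Un_upper1]) auto
      next
        fix i l assume "i \<in> \<Omega> j" "l \<in> L ?\<nu>"
        then show "V ?\<nu> l i \<in> ratgen ?F" using V[OF j(1)] \<Omega>(1)[OF j(1)] by auto
      next
        fix i assume "i \<in> \<Omega> j"
        then show "(\<Sum>t\<in>{..<\<kappa> ?\<nu>}. B ?\<nu> t i * p (\<tau> j t)) = (\<Sum>s\<in>L ?\<nu>. V ?\<nu> s i * z s)"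
          using z by (simp add: mult.commute)
      qed (use LK(1)[OF j(1)] in auto)
      moreover have "\<not> (\<forall>x'. \<exists>z'. \<forall>i\<in>\<Omega> j. (\<Sum>t\<in>{..<\<kappa> ?\<nu>}. B ?\<nu> t i * x' t) = (\<Sum>s\<in>L ?\<nu>. V ?\<nu> s i * z' s))"
      proof
        assume H: "\<forall>x'. \<exists>z'. \<forall>i\<in>\<Omega> j. (\<Sum>t\<in>{..<\<kappa> ?\<nu>}. B ?\<nu> t i * x' t) = (\<Sum>s\<in>L ?\<nu>. V ?\<nu> s i * z' s)"
        \<comment> \<open>Solvability for every right-hand side, applied to the coefficient vector
          with a single 1, yields each true basis vector.\<close>
        have "in_span (\<Omega> j) (L ?\<nu>) (V ?\<nu>) (B ?\<nu> t)" if t: "t < \<kappa> ?\<nu>" for t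
        proof -
          obtain z' where z': "\<forall>i\<in>\<Omega> j. (\<Sum>s\<in>{..<\<kappa> ?\<nu>}. B ?\<nu> s i * (if s = t then 1 else 0)) = (\<Sum>s\<in>L ?\<nu>. V ?\<nu> s i * z' s)"
            using spec[OF H, of "\<lambda>s. if s = t then 1 else 0"] by (elim exE)
          show ?thesis
          proof (rule in_span_byI[where c = z'])
            fix i assume "i \<in> \<Omega> j"
            then show "B ?\<nu> t i = (\<Sum>k\<in>L ?\<nu>. z' k * V ?\<nu> k i)"
              using bspec[OF z', of i] t by (simp add: mult.commute if_distrib cong: if_cong)
          qed
        qed
        then show False using j(2) unfolding act_def by blast
      qed
      ultimately obtain t where t: "t < \<kappa> ?\<nu>" "p (\<tau> j t) \<in> ratgen (?F \<union> (\<lambda>t. p (\<tau> j t)) ` ({..<\<kappa> ?\<nu>} - {t}))"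
        by blast
      have "(\<lambda>t. p (\<tau> j t)) ` ({..<\<kappa> ?\<nu>} - {t}) \<subseteq> p ` (\<tau> j ` {..<\<kappa> ?\<nu>} - {\<tau> j t})"
        using cols(3)[OF j(1) j(1)] t(1) by fastforce
      then have "?F \<union> (\<lambda>t. p (\<tau> j t)) ` ({..<\<kappa> ?\<nu>} - {t}) \<subseteq> ?F \<union> p ` (\<tau> j ` {..<\<kappa> ?\<nu>} - {\<tau> j t})"
        by blast
      from ratgen_mono[OF this t(2)] show "\<exists>t\<in>\<tau> j ` {..<\<kappa> ?\<nu>}. p t \<in> ratgen (?F \<union> p ` (\<tau> j ` {..<\<kappa> ?\<nu>} - {t}))"
        using t(1) by (intro bexI[of _ "\<tau> j t"]) auto
    next
      fix q j assume q: "q \<in> Qs" and j: "j \<in> Gr q" and "\<not> act j"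
      then show "(\<Sum>i<n. a q j i * v q i) = 0" by (intro circ[OF a[OF q] j Qs(3)[OF q]] vspan)
    qed (use a cols(2) E(1) j actj in \<open>auto simp: circuits_def\<close>)
    then show False using E(2) j by blast
  qed
  have "finite E" using E(1) cols(1) by (rule finite_subset)
  show ?thesis
  proof (rule orthogonal_union_spans[where K = E and a = e])
    show "indep_on {..<n} E e" using E(5) by (simp add: circuits_def)
    show "(\<Sum>i<n. e k i * C \<nu> l i) = 0" if "k \<in> E" "l \<in> K \<nu>" for k l
      using E(5) E(3)[OF that(1)] that by (auto simp: circuits_def)
    show "(\<Sum>i<n. e k i * V \<nu> l i) = 0" if k: "k \<in> E" for k
      by (rule circ[OF E(5) k E(1) inactive[OF k]])
        (use E(3)[OF k] l LK(1)[of k] E(1) k in \<open>auto intro: in_span_base\<close>)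
  qed (use E(4,6,7) \<open>finite E\<close> in auto)
qed

section \<open>Generic circuits\<close>

text \<open>Independence of \<open>A\<close> off \<open>R\<close> means that the entries outside
  \<open>R\<close> suffice to satisfy all orthogonality conditions, so the entries on
  \<open>R\<close> can be prescribed.\<close>

lemma indep_on_delta:
  assumes "indep_on (N - R) K A" "R \<subseteq> N" "finite N" "finite K"
  shows "\<exists>x. \<forall>r\<in>R. (\<forall>i\<in>R. x r i = (if i = r then 1 else 0)) \<and> (\<forall>k\<in>K. (\<Sum>i\<in>N. A k i * x r i) = (0::real))"
proof -
  have "\<exists>x. (\<forall>i\<in>R. x i = (if i = r then 1 else 0)) \<and> (\<forall>k\<in>K. (\<Sum>i\<in>N. A k i * x i) = 0)" if r: "r \<in> R" for r
  proof -
    have "\<exists>y. \<forall>k\<in>K. (\<Sum>i\<in>N - R. A k i * y i) = - A k r"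
      by (rule indep_on_solve) (use assms in auto)
    then obtain y where y: "\<And>k. k \<in> K \<Longrightarrow> (\<Sum>i\<in>N - R. A k i * y i) = - A k r" by blast
    define x where "x = (\<lambda>i. if i \<in> R then if i = r then 1 else 0 else y i)"
    have "(\<Sum>i\<in>N. A k i * x i) = 0" if k: "k \<in> K" for k
    proof -
      have "(\<Sum>i\<in>N. A k i * x i) = (\<Sum>i\<in>R. A k i * x i) + (\<Sum>i\<in>N - R. A k i * x i)"
        using assms(2,3) by (subst sum.subset_diff[of R]) (auto simp: add.commute)
      moreover have "(\<Sum>i\<in>R. A k i * x i) = (\<Sum>i\<in>R. if i = r then A k r else 0)"
        by (intro sum.cong) (auto simp: x_def)
      moreover have "(\<Sum>i\<in>N - R. A k i * x i) = (\<Sum>i\<in>N - R. A k i * y i)"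
        by (intro sum.cong) (auto simp: x_def)
      moreover have "finite R" using assms(2,3) by (rule finite_subset)
      ultimately show ?thesis using y[OF k] r by simp
    qed
    then show ?thesis by (intro exI[of _ x]) (simp add: x_def)
  qed
  then have "\<forall>r\<in>R. \<exists>x. (\<forall>i\<in>R. x i = (if i = r then 1 else 0)) \<and> (\<forall>k\<in>K. (\<Sum>i\<in>N. A k i * x i) = 0)"
    by (rule ballI)
  from bchoice[OF this] show ?thesis .
qed

text \<open>Deleting \<open>R\<close> costs at most \<open>\<rho>\<close> rows, so the columns can
  be matched into the remaining ones. The 0-1 specialisation given by the matching is independent,
  and the Gram determinant transfers this to generic entries.\<close>

lemma generic_columns_indep:
  fixes \<Omega> :: "nat \<Rightarrow> nat set"
  assumes \<alpha>: "alg_indep ({..<n} \<times> G) \<alpha>" and G: "finite G" "K \<subseteq> G" and R: "R \<subseteq> {..<n}" "card R \<le> \<rho>"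
    and \<Omega>: "\<And>j. j \<in> G \<Longrightarrow> \<Omega> j \<subseteq> {..<n}" and hall: "hall_surplus \<rho> \<Omega> K"
  shows "indep_on ({..<n} - R) K (\<lambda>j i. if i \<in> \<Omega> j then \<alpha> (i, j) else 0)"
proof -
  have finR: "finite R" using R(1) finite_subset by blast
  have finK: "finite K" using G(2,1) by (rule finite_subset)
  have "\<exists>f. inj_on f K \<and> (\<forall>j\<in>K. f j \<in> \<Omega> j - R)"
  proof (rule marriage[OF finK])
    fix j assume "j \<in> K"
    then have "\<Omega> j \<subseteq> {..<n}" using \<Omega> G(2) by blast
    then show "finite (\<Omega> j - R)" by (meson finite_Diff finite_lessThan finite_subset)
  next
    fix M assume M: "M \<subseteq> K"
    show "card M \<le> card (\<Union> ((\<lambda>j. \<Omega> j - R) ` M))"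
    proof (cases "M = {}")
      case False
      then have "card M + \<rho> \<le> card (\<Union> (\<Omega> ` M))" using hall M unfolding hall_surplus_def by blast
      moreover have "\<Union> ((\<lambda>j. \<Omega> j - R) ` M) = \<Union> (\<Omega> ` M) - R" by auto
      moreover have "card (\<Union> (\<Omega> ` M)) - card R \<le> card (\<Union> (\<Omega> ` M) - R)" by (rule diff_card_le_card_Diff[OF finR])
      ultimately show ?thesis using R(2) by simp
    qed simp
  qed
  then obtain f where f: "inj_on f K" "\<And>j. j \<in> K \<Longrightarrow> f j \<in> \<Omega> j" "\<And>j. j \<in> K \<Longrightarrow> f j \<notin> R" by blast
  define A where "A = (\<lambda>\<alpha> j i. if i \<in> \<Omega> j then \<alpha> (i, j) else (0::real))"
  obtain h where h: "bij_betw h {..<card K} K" using ex_bij_betw_nat_finite[OF finK] by (auto simp: atLeast0LessThan)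
  have hK: "h s \<in> K" if "s < card K" for s using h that by (auto simp: bij_betw_def)
  define g where "g = (\<lambda>\<alpha>. gram ({..<n} - R) (card K) (\<lambda>s. A \<alpha> (h s)))"
  have "g \<in> polyfun \<rat> ({..<n} \<times> G)"
    unfolding g_def
  proof (rule polyfun_gram)
    fix s i assume "s < card K" "i \<in> {..<n} - R"
    then show "(\<lambda>x. A x (h s) i) \<in> polyfun \<rat> ({..<n} \<times> G)"
      using hK G(2) by (cases "i \<in> \<Omega> (h s)") (auto simp: A_def intro: pf_var pf_const)
  qed auto
  moreover define \<alpha>0 where "\<alpha>0 = (\<lambda>(i, j). if i = f j then 1 else (0::real))"
  have "indep_on ({..<n} - R) K (A \<alpha>0)"
  proof (rule indep_onI)
    fix c k assume c: "\<And>i. i \<in> {..<n} - R \<Longrightarrow> (\<Sum>k\<in>K. c k * A \<alpha>0 k i) = 0" and k: "k \<in> K"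
    have "f k \<in> {..<n} - R" using f k \<Omega> G(2) by blast
    then have "0 = (\<Sum>j\<in>K. c j * A \<alpha>0 j (f k))" using c by simp
    also have "\<dots> = (\<Sum>j\<in>K. if j = k then c k else 0)"
      using f k by (intro sum.cong) (auto simp: A_def \<alpha>0_def inj_on_def)
    also have "\<dots> = c k" using finK k by simp
    finally show "c k = 0" by simp
  qed
  then have "g \<alpha>0 \<noteq> 0" unfolding g_def by (subst gram_nonzero_iff) (simp_all add: indep_on_reindex[OF h])
  ultimately have "g \<alpha> \<noteq> 0" using alg_indepD[OF \<alpha>] by blast
  then have "indep_on ({..<n} - R) K (A \<alpha>)"
    unfolding g_def by (subst (asm) gram_nonzero_iff) (simp_all add: indep_on_reindex[OF h])
  then show ?thesis by (simp add: A_def)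
qed

text \<open>Extends a basis of the orthogonal complement of all columns to a space orthogonal only to the
  columns of one view, in such a way that no dimension is lost on any of the observed row sets.\<close>
lemma extend_injective:
  fixes A :: "nat \<Rightarrow> nat \<Rightarrow> real" and x :: "nat \<Rightarrow> nat \<Rightarrow> real"
  assumes fin: "finite H" and k: "k0 \<le> \<kappa>"
    and \<Omega>: "\<And>j. j \<in> H \<Longrightarrow> \<Omega> j \<subseteq> {..<n}" "\<And>j. j \<in> H \<Longrightarrow> \<kappa> \<le> card (\<Omega> j)"
    and A: "\<And>R. R \<subseteq> {..<n} \<Longrightarrow> card R \<le> \<kappa> \<Longrightarrow> indep_on ({..<n} - R) H A"
    and x: "\<And>R. R \<subseteq> {..<n} \<Longrightarrow> card R = k0 \<Longrightarrow> indep_on R {..<k0} x"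
      "\<And>s j. s < k0 \<Longrightarrow> j \<in> H \<Longrightarrow> (\<Sum>i<n. A j i * x s i) = 0"
  shows "\<exists>b. (\<forall>s<k0. b s = x s) \<and> (\<forall>j\<in>H. \<forall>s<\<kappa>. (\<Sum>i<n. A j i * b s i) = 0) \<and> (\<forall>j\<in>H. indep_on (\<Omega> j) {..<\<kappa>} b)"
proof -
  define b where "b = (\<lambda>y s i. if s < k0 then x s i else y (s, i))"
  \<comment> \<open>The conditions on the free vectors \<open>y\<close> are affine, so
    \<open>V\<close> is closed under lines and it suffices to find a good \<open>y\<close> for each
    column separately.\<close>
  define V where "V = {y. \<forall>s<\<kappa>. \<forall>j\<in>H. (\<Sum>i<n. A j i * b y s i) = 0}"
  define f where "f = (\<lambda>j y. gram (\<Omega> j) \<kappa> (b y))"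
  have VI: "y \<in> V" if "\<And>s j. k0 \<le> s \<Longrightarrow> s < \<kappa> \<Longrightarrow> j \<in> H \<Longrightarrow> (\<Sum>i<n. A j i * y (s, i)) = 0" for y
  proof -
    have "(\<Sum>i<n. A j i * b y s i) = 0" if "s < \<kappa>" "j \<in> H" for s j
      using that x(2) \<open>\<And>s j. k0 \<le> s \<Longrightarrow> s < \<kappa> \<Longrightarrow> j \<in> H \<Longrightarrow> (\<Sum>i<n. A j i * y (s, i)) = 0\<close>
      by (cases "s < k0") (simp_all add: b_def)
    then show ?thesis by (simp add: V_def)
  qed
  have finO: "finite (\<Omega> j)" if "j \<in> H" for j using \<Omega>(1)[OF that] finite_subset by blast
  have "\<exists>y\<in>V. f j y \<noteq> 0" if j: "j \<in> H" for j
  proof -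
    \<comment> \<open>For a single column take \<open>\<kappa>\<close> of its rows and reserve
      \<open>k0\<close> of them for the given vectors. The new vectors are unit vectors on
      \<open>R\<close> vanishing on the reserved rows, so the whole family is block triangular on
      \<open>R\<close>.\<close>
    obtain R where R: "R \<subseteq> \<Omega> j" "card R = \<kappa>" using obtain_subset_with_card_n[OF \<Omega>(2)[OF j]] by metis
    obtain R0 where R0: "R0 \<subseteq> R" "card R0 = k0" using obtain_subset_with_card_n[of k0 R] R(2) k by metis
    have finR: "finite R" using R(1) finO[OF j] by (rule finite_subset)
    have Rn: "R \<subseteq> {..<n}" using R(1) \<Omega>(1)[OF j] by blast
    obtain d where d: "\<And>r i. r \<in> R \<Longrightarrow> i \<in> R \<Longrightarrow> d r i = (if i = r then 1 else 0)"
      "\<And>r l. r \<in> R \<Longrightarrow> l \<in> H \<Longrightarrow> (\<Sum>i<n. A l i * d r i) = 0"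
      using indep_on_delta[OF A[OF Rn] Rn _ fin] R(2) by auto
    have "card {k0..<\<kappa>} = card (R - R0)" using R R0 finR by (simp add: card_Diff_subset finite_subset)
    then obtain e where e: "bij_betw e {k0..<\<kappa>} (R - R0)"
      using finite_same_card_bij[of "{k0..<\<kappa>}" "R - R0"] finR by auto
    have eR: "e s \<in> R - R0" if "k0 \<le> s" "s < \<kappa>" for s using e that by (auto simp: bij_betw_def)
    define y where "y = (\<lambda>(s, i). d (e s) i)"
    have "y \<in> V" using eR d(2) by (intro VI) (simp add: y_def)
    moreover have "indep_on R {..<\<kappa>} (b y)"
    proof (rule indep_onI)
      fix c s assume c: "\<And>i. i \<in> R \<Longrightarrow> (\<Sum>s<\<kappa>. c s * b y s i) = 0" and s: "s \<in> {..<\<kappa>}"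
      have split: "(\<Sum>s<\<kappa>. c s * b y s i) = (\<Sum>s<k0. c s * x s i) + (\<Sum>s\<in>{k0..<\<kappa>}. c s * d (e s) i)" for i
      proof -
        have "(\<Sum>s<\<kappa>. c s * b y s i) = (\<Sum>s<k0. c s * b y s i) + (\<Sum>s\<in>{k0..<\<kappa>}. c s * b y s i)"
          using sum.atLeastLessThan_concat[of 0 k0 \<kappa> "\<lambda>s. c s * b y s i"] k by (simp add: atLeast0LessThan)
        then show ?thesis by (simp add: b_def y_def)
      qed
      have "(\<Sum>s<k0. c s * x s i) = 0" if i: "i \<in> R0" for i
      proof -
        have "(\<Sum>s\<in>{k0..<\<kappa>}. c s * d (e s) i) = 0"
        proof (intro sum.neutral ballI)
          fix s assume "s \<in> {k0..<\<kappa>}"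
          then have "e s \<in> R" "e s \<notin> R0" using eR by auto
          then have "d (e s) i = 0" using d(1)[of "e s" i] i R0(1) by auto
          then show "c s * d (e s) i = 0" by simp
        qed
        then show ?thesis using c[of i] split[of i] i R0(1) by auto
      qed
      moreover have "indep_on R0 {..<k0} x" using R0 Rn by (intro x(1)) auto
      ultimately have c0: "c s = 0" if "s < k0" for s using that indep_onD[of R0 "{..<k0}" x c s] by auto
      show "c s = 0"
      proof (cases "s < k0")
        case False
        then have s': "k0 \<le> s" "s < \<kappa>" using s by auto
        have "0 = (\<Sum>t\<in>{k0..<\<kappa>}. c t * d (e t) (e s))" using c[of "e s"] split[of "e s"] c0 eR[OF s'] by simp
        also have "\<dots> = (\<Sum>t\<in>{k0..<\<kappa>}. if t = s then c s else 0)"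
        proof (intro sum.cong refl)
          fix t assume t: "t \<in> {k0..<\<kappa>}"
          have "e s = e t \<longleftrightarrow> s = t" using e t s' by (auto simp: bij_betw_def inj_on_def)
          then show "c t * d (e t) (e s) = (if t = s then c s else 0)" using d(1)[of "e t" "e s"] eR[of t] eR[OF s'] t by auto
        qed
        also have "\<dots> = c s" using s' by simp
        finally show ?thesis by simp
      qed (rule c0)
    qed
    then have "f j y \<noteq> 0"
      unfolding f_def using gram_nonzero_iff[OF finO[OF j]] indep_on_mono[OF _ R(1)] by blast
    ultimately show ?thesis by blast
  qed
  moreover have "(\<lambda>_. 0) \<in> V" by (rule VI) simp
  then have "V \<noteq> {}" by (metis empty_iff)
  moreover have "(\<lambda>i. y i + t * (z i - y i)) \<in> V" if "y \<in> V" "z \<in> V" for y z t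
  proof -
    have "(\<Sum>i<n. A j i * b (\<lambda>i. y i + t * (z i - y i)) s i)
        = (\<Sum>i<n. A j i * b y s i) + t * ((\<Sum>i<n. A j i * b z s i) - (\<Sum>i<n. A j i * b y s i))" for s j
      by (cases "s < k0") (simp_all add: b_def sum_distrib_left sum_subtractf[symmetric] sum.distrib[symmetric] algebra_simps)
    then show ?thesis using that by (simp add: V_def)
  qed
  moreover have "f j \<in> polyfun UNIV UNIV" for j
    unfolding f_def
  proof (rule polyfun_gram)
    fix s i
    show "(\<lambda>y. b y s i) \<in> polyfun UNIV UNIV"
      by (cases "s < k0") (simp_all add: b_def pf_const pf_var)
  qed auto
  ultimately have "\<exists>y\<in>V. \<forall>g\<in>f ` H. g y \<noteq> 0"
    using fin by (intro common_nonroot[where I = UNIV]) (simp_all, blast+)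
  then obtain y where y: "y \<in> V" "\<And>j. j \<in> H \<Longrightarrow> f j y \<noteq> 0" by auto
  have "indep_on (\<Omega> j) {..<\<kappa>} (b y)" if "j \<in> H" for j
    using y(2)[OF that] gram_nonzero_iff[OF finO[OF that]] by (simp add: f_def)
  then show ?thesis using y(1) by (intro exI[of _ "b y"]) (auto simp: V_def b_def fun_eq_iff)
qed

text \<open>Circuits with generic entries on the pattern are chosen before the bases. The orthogonal
  complement of all of them has dimension \<open>k0\<close> and supplies the common vectors; each
  view then extends these within the complement of its own circuits.\<close>

lemma special_position:
  fixes \<Omega> :: "nat \<Rightarrow> nat set"
  assumes G: "finite G1" "finite G2" "G1 \<inter> G2 = {}" "card G1 + card G2 + k0 = n"
    and k: "k0 \<le> \<kappa>1" "k0 \<le> \<kappa>2"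
    and \<Omega>: "\<forall>j\<in>G1 \<union> G2. \<Omega> j \<subseteq> {..<n}"
    and hall: "hall_surplus k0 \<Omega> (G1 \<union> G2)" "hall_surplus \<kappa>1 \<Omega> G1" "hall_surplus \<kappa>2 \<Omega> G2"
  shows "\<exists>A b1 b2. (\<forall>s<k0. b1 s = b2 s) \<and> (\<forall>j i. i \<notin> \<Omega> j \<longrightarrow> A j i = 0) \<and> indep_on {..<n} (G1 \<union> G2) A \<and>
    (\<forall>j\<in>G1. \<forall>s<\<kappa>1. (\<Sum>i<n. A j i * b1 s i) = 0) \<and> (\<forall>j\<in>G1. indep_on (\<Omega> j) {..<\<kappa>1} b1) \<and>
    (\<forall>j\<in>G2. \<forall>s<\<kappa>2. (\<Sum>i<n. A j i * b2 s i) = 0) \<and> (\<forall>j\<in>G2. indep_on (\<Omega> j) {..<\<kappa>2} (b2 :: nat \<Rightarrow> nat \<Rightarrow> real))"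
proof -
  define G where "G = G1 \<union> G2"
  have finG: "finite G" and cardG: "card G + k0 = n" using G by (auto simp: G_def card_Un_disjoint)
  obtain \<alpha> where \<alpha>: "alg_indep ({..<n} \<times> G) \<alpha>" using alg_indep_exists[of "{..<n} \<times> G"] finG by auto
  define A where "A = (\<lambda>j i. if i \<in> \<Omega> j then \<alpha> (i, j) else (0::real))"
  have ind: "indep_on ({..<n} - R) K A" if "K \<subseteq> G" "R \<subseteq> {..<n}" "card R \<le> \<rho>" "hall_surplus \<rho> \<Omega> K" for R K \<rho>
    unfolding A_def by (rule generic_columns_indep[OF \<alpha> finG that(1-3) _ that(4)]) (use \<Omega> in \<open>auto simp: G_def\<close>)
  have indG: "indep_on ({..<n} - R) G A" if "R \<subseteq> {..<n}" "card R \<le> k0" for R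
    using that hall(1) by (intro ind[of G R k0]) (auto simp: G_def)
  have k0n: "{..<k0} \<subseteq> {..<n}" using cardG by auto
  obtain x where x: "\<And>r i. r < k0 \<Longrightarrow> i < k0 \<Longrightarrow> x r i = (if i = r then 1 else 0)"
      "\<And>r j. r < k0 \<Longrightarrow> j \<in> G \<Longrightarrow> (\<Sum>i<n. A j i * x r i) = 0"
    using indep_on_delta[OF indG[OF k0n] k0n _ finG] by auto
  \<comment> \<open>A combination vanishing on \<open>k0\<close> rows is orthogonal, on the other
    \<open>n - k0\<close> rows, to \<open>n - k0\<close> independent vectors, hence zero. So the
    common vectors are independent on any \<open>k0\<close> rows.\<close>
  have xind: "indep_on R {..<k0} x" if R: "R \<subseteq> {..<n}" "card R = k0" for R
  proof (rule indep_onI)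
    fix c s assume c: "\<And>i. i \<in> R \<Longrightarrow> (\<Sum>k<k0. c k * x k i) = 0" and s: "s \<in> {..<k0}"
    define u where "u = (\<lambda>i. \<Sum>k<k0. c k * x k i)"
    have finR: "finite R" using R(1) finite_subset by blast
    have "in_span ({..<n} - R) ({} :: nat set) (\<lambda>_ _. 0) u"
    proof (rule orthogonal_union_spans[where K = G and a = A])
      show "indep_on ({..<n} - R) G A" using R by (intro indG) auto
      show "card ({..<n} - R) \<le> card G + card ({} :: nat set)" using R finR cardG by (simp add: card_Diff_subset)
      fix j assume j: "j \<in> G"
      have "(\<Sum>i\<in>{..<n} - R. A j i * u i) = (\<Sum>i<n. A j i * u i)"
        using c by (intro sum.mono_neutral_left) (auto simp: u_def)
      also have "\<dots> = (\<Sum>k<k0. c k * (\<Sum>i<n. A j i * x k i))"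
        unfolding u_def sum_distrib_left by (subst sum.swap) (simp add: algebra_simps)
      also have "\<dots> = 0" using x(2) j by simp
      finally show "(\<Sum>i\<in>{..<n} - R. A j i * u i) = 0" .
    qed (use finG in \<open>auto simp: indep_on_def\<close>)
    then have "u i = 0" if "i < n" for i
      using c[of i] that unfolding in_span_def by (cases "i \<in> R") (auto simp: u_def)
    moreover have "u s = c s"
    proof -
      have "u s = (\<Sum>k<k0. if k = s then c s else 0)"
        unfolding u_def using s x(1) by (intro sum.cong) auto
      then show ?thesis using s by simp
    qed
    ultimately show "c s = 0" using s k0n by auto
  qed
  have fin12: "finite G1" "finite G2" using G by auto
  have cO: "\<kappa>1 \<le> card (\<Omega> j)" if "j \<in> G1" for j
    using hall(2) that unfolding hall_surplus_def by (auto dest!: spec[of _ "{j}"])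
  have cO2: "\<kappa>2 \<le> card (\<Omega> j)" if "j \<in> G2" for j
    using hall(3) that unfolding hall_surplus_def by (auto dest!: spec[of _ "{j}"])
  have "\<exists>b. (\<forall>s<k0. b s = x s) \<and> (\<forall>j\<in>G1. \<forall>s<\<kappa>1. (\<Sum>i<n. A j i * b s i) = 0) \<and> (\<forall>j\<in>G1. indep_on (\<Omega> j) {..<\<kappa>1} b)"
    by (rule extend_injective[OF fin12(1) k(1)])
      (use \<Omega> cO xind x(2) ind[of G1 _ \<kappa>1] hall(2) in \<open>auto simp: G_def\<close>)
  moreover have "\<exists>b. (\<forall>s<k0. b s = x s) \<and> (\<forall>j\<in>G2. \<forall>s<\<kappa>2. (\<Sum>i<n. A j i * b s i) = 0) \<and> (\<forall>j\<in>G2. indep_on (\<Omega> j) {..<\<kappa>2} b)"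
    by (rule extend_injective[OF fin12(2) k(2)])
      (use \<Omega> cO2 xind x(2) ind[of G2 _ \<kappa>2] hall(3) in \<open>auto simp: G_def\<close>)
  ultimately obtain b1 b2 where b: "\<forall>s<k0. b1 s = x s" "\<forall>j\<in>G1. \<forall>s<\<kappa>1. (\<Sum>i<n. A j i * b1 s i) = 0"
      "\<forall>j\<in>G1. indep_on (\<Omega> j) {..<\<kappa>1} b1"
      "\<forall>s<k0. b2 s = x s" "\<forall>j\<in>G2. \<forall>s<\<kappa>2. (\<Sum>i<n. A j i * b2 s i) = 0"
      "\<forall>j\<in>G2. indep_on (\<Omega> j) {..<\<kappa>2} b2" by (elim exE conjE)
  have "indep_on {..<n} (G1 \<union> G2) A" using indG[of "{}"] by (simp add: G_def)
  then show ?thesis using b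
    by (intro exI[of _ A] exI[of _ b1] exI[of _ b2]) (simp add: A_def)
qed

section \<open>Orthogonal projection by polynomials\<close>

lemma polyfun_adj_mat:
  assumes C: "0 \<in> C" "1 \<in> C" "-1 \<in> C" and "\<And>s t. s < k \<Longrightarrow> t < k \<Longrightarrow> f s t \<in> polyfun C I" and st: "s < k" "t < k"
  shows "(\<lambda>x. adj_mat (mat k k (\<lambda>(s,t). f s t x)) $$ (s, t)) \<in> polyfun C I"
proof -
  define h where "h = (\<lambda>i j. f (if i < t then i else Suc i) (if j < s then j else Suc j))"
  have "(\<lambda>x. (-1) ^ (t + s) * det (mat (k - 1) (k - 1) (\<lambda>(i,j). h i j x))) \<in> polyfun C I"
  proof (intro pf_mult polyfun_det polyfun_power pf_const C)
    fix i j assume "i < k - 1" "j < k - 1"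
    then show "h i j \<in> polyfun C I" unfolding h_def by (intro assms(4)) auto
  qed
  moreover have "adj_mat (mat k k (\<lambda>(s,t). f s t x)) $$ (s, t)
      = (-1) ^ (t + s) * det (mat (k - 1) (k - 1) (\<lambda>(i,j). h i j x))" for x
  proof -
    have "mat_delete (mat k k (\<lambda>(s,t). f s t x)) t s = mat (k - 1) (k - 1) (\<lambda>(i,j). h i j x)"
      unfolding mat_delete_def h_def by (intro eq_matI) auto
    then show ?thesis using st by (simp add: adj_mat_def cofactor_def)
  qed
  ultimately show ?thesis by simp
qed

text \<open>An entry of the adjugate of the Gram matrix, used in place of the inverse so that no
  division occurs.\<close>

definition gram_adj :: "'a set \<Rightarrow> nat \<Rightarrow> (nat \<Rightarrow> 'a \<Rightarrow> real) \<Rightarrow> nat \<Rightarrow> nat \<Rightarrow> real" where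
  "gram_adj R k v s t = adj_mat (mat k k (\<lambda>(s,t). \<Sum>i\<in>R. v s i * v t i)) $$ (s, t)"

lemma gram_adj:
  assumes "s < k" "t < k"
  shows "(\<Sum>u<k. (\<Sum>i\<in>R. v s i * v u i) * gram_adj R k v u t) = (if s = t then gram R k v else 0)"
proof -
  let ?M = "mat k k (\<lambda>(s,t). \<Sum>i\<in>R. v s i * v t i)"
  have M: "?M \<in> carrier_mat k k" by simp
  have "(?M * adj_mat ?M) $$ (s, t) = (det ?M \<cdot>\<^sub>m 1\<^sub>m k) $$ (s, t)" by (simp only: adj_mat(2)[OF M])
  moreover have "(?M * adj_mat ?M) $$ (s, t) = (\<Sum>u<k. (\<Sum>i\<in>R. v s i * v u i) * adj_mat ?M $$ (u, t))"
    using assms adj_mat(1)[OF M] by (simp add: scalar_prod_def atLeast0LessThan)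
  ultimately show ?thesis using assms by (simp add: gram_def gram_adj_def)
qed

text \<open>The orthogonal projection of w to the complement of the v's, scaled by the Gram determinant so that
  it becomes polynomial in all entries.\<close>
definition project_off :: "'a set \<Rightarrow> nat \<Rightarrow> (nat \<Rightarrow> 'a \<Rightarrow> real) \<Rightarrow> ('a \<Rightarrow> real) \<Rightarrow> 'a \<Rightarrow> real" where
  "project_off R k v w i = gram R k v * w i - (\<Sum>s<k. \<Sum>t<k. v s i * gram_adj R k v s t * (\<Sum>i'\<in>R. v t i' * w i'))"

lemma project_off_orthogonal:
  assumes u: "u < k"
  shows "(\<Sum>i\<in>R. v u i * project_off R k v w i) = 0"
proof -
  define \<beta> where "\<beta> = (\<lambda>t. \<Sum>i\<in>R. v t i * w i)"
  have "(\<Sum>i\<in>R. v u i * (\<Sum>s<k. \<Sum>t<k. v s i * gram_adj R k v s t * \<beta> t))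
      = (\<Sum>i\<in>R. \<Sum>t<k. \<Sum>s<k. v u i * v s i * gram_adj R k v s t * \<beta> t)"
    unfolding sum_distrib_left by (rule sum.cong[OF refl], subst sum.swap) (simp add: mult.assoc)
  also have "\<dots> = (\<Sum>t<k. \<Sum>s<k. \<Sum>i\<in>R. v u i * v s i * gram_adj R k v s t * \<beta> t)"
    by (subst sum.swap, rule sum.cong[OF refl], rule sum.swap)
  also have "\<dots> = (\<Sum>t<k. (\<Sum>s<k. (\<Sum>i\<in>R. v u i * v s i) * gram_adj R k v s t) * \<beta> t)"
    by (simp add: sum_distrib_right)
  also have "\<dots> = (\<Sum>t<k. if t = u then gram R k v * \<beta> u else 0)"
    using gram_adj[OF u, where R = R and v = v] by (intro sum.cong refl) auto
  also have "\<dots> = gram R k v * \<beta> u" using u by simp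
  finally have "(\<Sum>i\<in>R. v u i * (\<Sum>s<k. \<Sum>t<k. v s i * gram_adj R k v s t * \<beta> t)) = gram R k v * \<beta> u" .
  moreover have "(\<Sum>i\<in>R. v u i * (gram R k v * w i)) = gram R k v * \<beta> u"
    unfolding \<beta>_def sum_distrib_left by (simp add: algebra_simps)
  moreover have "project_off R k v w i = gram R k v * w i - (\<Sum>s<k. \<Sum>t<k. v s i * gram_adj R k v s t * \<beta> t)" for i
    unfolding project_off_def \<beta>_def ..
  ultimately show ?thesis by (simp add: right_diff_distrib sum_subtractf)
qed

text \<open>A vector that is already orthogonal is merely scaled. At the special position the
  projected weights therefore reproduce the prescribed circuits.\<close>

lemma project_off_fixed:
  assumes "\<And>t. t < k \<Longrightarrow> (\<Sum>i\<in>R. v t i * w i) = 0"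
  shows "project_off R k v w i = gram R k v * w i"
  unfolding project_off_def using assms by simp

lemma polyfun_project_off:
  assumes C: "0 \<in> C" "1 \<in> C" "-1 \<in> C"
    and v: "\<And>s i. s < k \<Longrightarrow> i \<in> R \<Longrightarrow> (\<lambda>x. v x s i) \<in> polyfun C I" and w: "\<And>i. i \<in> R \<Longrightarrow> (\<lambda>x. w x i) \<in> polyfun C I"
    and i: "i \<in> R"
  shows "(\<lambda>x. project_off R k (v x) (w x) i) \<in> polyfun C I"
  unfolding project_off_def gram_adj_def
  by (intro polyfun_diff pf_mult polyfun_gram polyfun_sum polyfun_adj_mat[where f = "\<lambda>s t x. \<Sum>i\<in>R. v x s i * v x t i"] C v w i)
    auto

text \<open>Circuits arise by projecting weight vectors on the observed rows off the bases. Their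
  independence is the nonvanishing of a polynomial \<open>\<Phi>\<close> in basis entries and
  weights, which is nonzero at the special position. Suitable rational weights keep it nonzero, and
  algebraic independence carries it to the true basis.\<close>

theorem generic_circuits:
  fixes \<Omega> :: "nat \<Rightarrow> nat set" and c1 c2 :: "nat \<Rightarrow> nat \<Rightarrow> 'i"
  assumes p: "alg_indep I p"
    and c: "\<And>s i. s < \<kappa>1 \<Longrightarrow> i < n \<Longrightarrow> c1 s i \<in> I" "\<And>s i. s < \<kappa>2 \<Longrightarrow> i < n \<Longrightarrow> c2 s i \<in> I"
      "\<And>s i. s < k0 \<Longrightarrow> c1 s i = c2 s i"
      "\<And>s i s' i'. s < \<kappa>1 \<Longrightarrow> s' < \<kappa>1 \<Longrightarrow> c1 s i = c1 s' i' \<Longrightarrow> s = s' \<and> i = i'"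
      "\<And>s i s' i'. s < \<kappa>2 \<Longrightarrow> s' < \<kappa>2 \<Longrightarrow> c2 s i = c2 s' i' \<Longrightarrow> s = s' \<and> i = i'"
      "\<And>s i s' i'. s < \<kappa>1 \<Longrightarrow> s' < \<kappa>2 \<Longrightarrow> c1 s i = c2 s' i' \<Longrightarrow> s = s' \<and> i = i' \<and> s < k0"
    and G: "finite G1" "finite G2" "G1 \<inter> G2 = {}" "card G1 + card G2 + k0 = n"
    and k: "k0 \<le> \<kappa>1" "k0 \<le> \<kappa>2"
    and \<Omega>: "\<forall>j\<in>G1 \<union> G2. \<Omega> j \<subseteq> {..<n}"
    and hall: "hall_surplus k0 \<Omega> (G1 \<union> G2)" "hall_surplus \<kappa>1 \<Omega> G1" "hall_surplus \<kappa>2 \<Omega> G2"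
  shows "\<exists>a. circuits n (p ` I) \<Omega> (G1 \<union> G2) (\<lambda>j. if j \<in> G1 then {..<\<kappa>1} else {..<\<kappa>2})
      (\<lambda>j s i. p (if j \<in> G1 then c1 s i else c2 s i)) a"
proof -
  define \<kappa> where "\<kappa> = (\<lambda>j. if j \<in> G1 then \<kappa>1 else \<kappa>2)"
  define cc where "cc = (\<lambda>j s i. if j \<in> G1 then c1 s i else c2 s i)"
  define G where "G = G1 \<union> G2"
  have finG: "finite G" using G by (simp add: G_def)
  have finO: "finite (\<Omega> j)" if "j \<in> G" for j using \<Omega> that finite_subset[of "\<Omega> j" "{..<n}"] by (auto simp: G_def)
  \<comment> \<open>\<open>Inl\<close> variables are basis entries, \<open>Inr\<close> variables are
    weights.\<close>
  define Bf where "Bf = (\<lambda>x :: 'i + nat \<times> nat \<Rightarrow> real. \<lambda>j s i. x (Inl (cc j s i)))"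
  define w where "w = (\<lambda>x :: 'i + nat \<times> nat \<Rightarrow> real. \<lambda>j i. x (Inr (i, j)))"
  define af where "af = (\<lambda>x j i. if i \<in> \<Omega> j then project_off (\<Omega> j) (\<kappa> j) (Bf x j) (w x j) i else 0)"
  define J where "J = Inl ` I \<union> Inr ` ({..<n} \<times> G)"
  have ccI: "cc j s i \<in> I" if "s < \<kappa> j" "i < n" for j s i
    using c(1,2) that by (auto simp: cc_def \<kappa>_def split: if_splits)
  have af_poly: "(\<lambda>x. af x j i) \<in> polyfun \<rat> J" if j: "j \<in> G" for j i
  proof (cases "i \<in> \<Omega> j")
    case True
    have On: "i' < n" if "i' \<in> \<Omega> j" for i' using \<Omega> j that by (auto simp: G_def)
    have "(\<lambda>x. project_off (\<Omega> j) (\<kappa> j) (Bf x j) (w x j) i) \<in> polyfun \<rat> J"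
    proof (rule polyfun_project_off[OF _ _ _ _ _ True])
      fix s i' assume "s < \<kappa> j" "i' \<in> \<Omega> j"
      then show "(\<lambda>x. Bf x j s i') \<in> polyfun \<rat> J" unfolding Bf_def using ccI On by (intro pf_var) (auto simp: J_def)
    next
      fix i' assume "i' \<in> \<Omega> j"
      then show "(\<lambda>x. w x j i') \<in> polyfun \<rat> J" unfolding w_def using On j by (intro pf_var) (auto simp: J_def)
    qed auto
    then show ?thesis using True by (simp add: af_def)
  next
    case False
    then show ?thesis by (simp add: af_def pf_const)
  qed
  have orth: "(\<Sum>i<n. af x j i * Bf x j s i) = 0" if j: "j \<in> G" and s: "s < \<kappa> j" for x j s
  proof -
    have "(\<Sum>i<n. af x j i * Bf x j s i) = (\<Sum>i\<in>\<Omega> j. Bf x j s i * project_off (\<Omega> j) (\<kappa> j) (Bf x j) (w x j) i)"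
      using \<Omega> j by (intro sum.mono_neutral_cong_right) (auto simp: af_def G_def)
    then show ?thesis using project_off_orthogonal[OF s] by simp
  qed
  obtain h where h: "bij_betw h {..<card G} G" using ex_bij_betw_nat_finite[OF finG] by (auto simp: atLeast0LessThan)
  have hG: "h s \<in> G" if "s < card G" for s using h that by (auto simp: bij_betw_def)
  define \<Phi> where "\<Phi> = (\<lambda>x. gram {..<n} (card G) (\<lambda>s. af x (h s)))"
  have \<Phi>_poly: "\<Phi> \<in> polyfun \<rat> J" unfolding \<Phi>_def by (rule polyfun_gram) (auto intro: af_poly hG)
  have \<Phi>_iff: "\<Phi> x \<noteq> 0 \<longleftrightarrow> indep_on {..<n} G (af x)" for x
    unfolding \<Phi>_def by (subst gram_nonzero_iff) (simp_all add: indep_on_reindex[OF h])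
  obtain A b1 b2 where sp: "\<forall>s<k0. b1 s = b2 s" "\<forall>j i. i \<notin> \<Omega> j \<longrightarrow> A j i = 0" "indep_on {..<n} (G1 \<union> G2) A"
    "\<forall>j\<in>G1. \<forall>s<\<kappa>1. (\<Sum>i<n. A j i * b1 s i) = 0" "\<forall>j\<in>G1. indep_on (\<Omega> j) {..<\<kappa>1} b1"
    "\<forall>j\<in>G2. \<forall>s<\<kappa>2. (\<Sum>i<n. A j i * b2 s i) = 0" "\<forall>j\<in>G2. indep_on (\<Omega> j) {..<\<kappa>2} (b2 :: nat \<Rightarrow> nat \<Rightarrow> real)"
    using special_position[OF G k \<Omega> hall] by (elim exE conjE)
  define bb where "bb = (\<lambda>j. if j \<in> G1 then b1 else b2)"
  have "\<exists>y. \<forall>j\<in>{True, False}. \<forall>s<(if j then \<kappa>1 else \<kappa>2). \<forall>i. y ((if j then c1 else c2) s i) = (if j then b1 else b2) s i"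
  proof -
    \<comment> \<open>The special bases are read back through the variable maps \<open>c1\<close>
      and \<open>c2\<close>. Variables are shared only by the first \<open>k0\<close> vectors, where
      \<open>b1\<close> and \<open>b2\<close> agree, so the assignment is consistent.\<close>
    define y where "y = (\<lambda>q. if \<exists>s<\<kappa>1. \<exists>i. q = c1 s i then (THE r. \<exists>s<\<kappa>1. \<exists>i. q = c1 s i \<and> r = b1 s i)
       else (THE r. \<exists>s<\<kappa>2. \<exists>i. q = c2 s i \<and> r = b2 s i))"
    have y1: "y (c1 s i) = b1 s i" if "s < \<kappa>1" for s i
    proof -
      have "(THE r. \<exists>s'<\<kappa>1. \<exists>i'. c1 s i = c1 s' i' \<and> r = b1 s' i') = b1 s i"
        using that c(4) by (intro the_equality) blast+
      then show ?thesis using that unfolding y_def by auto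
    qed
    have y2: "y (c2 s i) = b2 s i" if s: "s < \<kappa>2" for s i
    proof (cases "s < k0")
      case True
      then show ?thesis using y1[of s i] c(3)[OF True, of i] sp(1) k(1) by simp
    next
      case False
      then have "\<not> (\<exists>s'<\<kappa>1. \<exists>i'. c2 s i = c1 s' i')" using c(6)[OF _ s] by metis
      moreover have "(THE r. \<exists>s'<\<kappa>2. \<exists>i'. c2 s i = c2 s' i' \<and> r = b2 s' i') = b2 s i"
        using s c(5) by (intro the_equality) blast+
      ultimately show ?thesis unfolding y_def by auto
    qed
    show ?thesis using y1 y2 by (intro exI[of _ y]) simp
  qed
  then obtain y where "\<forall>j\<in>{True, False}. \<forall>s<(if j then \<kappa>1 else \<kappa>2). \<forall>i. y ((if j then c1 else c2) s i) = (if j then b1 else b2) s i"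
    by (elim exE)
  then have y: "\<And>s i. s < \<kappa>1 \<Longrightarrow> y (c1 s i) = b1 s i" "\<And>s i. s < \<kappa>2 \<Longrightarrow> y (c2 s i) = b2 s i" by auto
  define x0 where "x0 = case_sum y (\<lambda>(i, j). A j i)"
  have Bf0: "Bf x0 j s i = bb j s i" if "s < \<kappa> j" for j s i
    using that y by (simp add: Bf_def x0_def cc_def bb_def \<kappa>_def split: if_splits)
  have "af x0 j i = gram (\<Omega> j) (\<kappa> j) (Bf x0 j) * A j i" if j: "j \<in> G" for j i
  proof (cases "i \<in> \<Omega> j")
    case True
    have "(\<Sum>i\<in>\<Omega> j. Bf x0 j t i * A j i) = 0" if t: "t < \<kappa> j" for t
    proof -
      have "(\<Sum>i\<in>\<Omega> j. Bf x0 j t i * A j i) = (\<Sum>i<n. A j i * bb j t i)"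
        using \<Omega> j sp(2) Bf0[OF t] by (intro sum.mono_neutral_cong_left) (auto simp: G_def)
      also have "\<dots> = 0" using sp(4,6) j t by (auto simp: bb_def G_def \<kappa>_def split: if_splits)
      finally show ?thesis .
    qed
    moreover have "w x0 j = A j" by (simp add: w_def x0_def fun_eq_iff)
    ultimately show ?thesis using True by (simp add: af_def project_off_fixed)
  next
    case False
    then show ?thesis using sp(2) by (simp add: af_def)
  qed
  moreover have g0: "gram (\<Omega> j) (\<kappa> j) (Bf x0 j) \<noteq> 0" if j: "j \<in> G" for j
  proof -
    have "indep_on (\<Omega> j) {..<\<kappa> j} (bb j)"
      using sp(5,7) j by (auto simp: bb_def G_def \<kappa>_def)
    then have "indep_on (\<Omega> j) {..<\<kappa> j} (Bf x0 j)" by (subst indep_on_cong[where w = "bb j"]) (simp_all add: Bf0)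
    then show ?thesis using gram_nonzero_iff[OF finO[OF j]] by blast
  qed
  ultimately have "indep_on {..<n} G (af x0)"
  proof -
    assume eq: "\<And>j i. j \<in> G \<Longrightarrow> af x0 j i = gram (\<Omega> j) (\<kappa> j) (Bf x0 j) * A j i"
    show ?thesis
    proof (rule indep_onI)
      fix c k assume c: "\<And>i. i \<in> {..<n} \<Longrightarrow> (\<Sum>k\<in>G. c k * af x0 k i) = 0" and k: "k \<in> G"
      have "c k * gram (\<Omega> k) (\<kappa> k) (Bf x0 k) = 0"
      proof (rule indep_onD[OF sp(3), of "\<lambda>k. c k * gram (\<Omega> k) (\<kappa> k) (Bf x0 k)"])
        fix i assume "i \<in> {..<n}"
        from c[OF this] show "(\<Sum>k\<in>G1 \<union> G2. c k * gram (\<Omega> k) (\<kappa> k) (Bf x0 k) * A k i) = 0"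
          using eq by (simp add: G_def mult.assoc)
      qed (use k in \<open>simp add: G_def\<close>)
      then show "c k = 0" using g0[OF k] by simp
    qed
  qed
  then have "\<Phi> x0 \<noteq> 0" by (simp add: \<Phi>_iff)
  moreover have "\<Phi> \<in> polyfun UNIV J" by (rule polyfun_mono[OF \<Phi>_poly]) auto
  \<comment> \<open>Rational weights leave the field generated by the basis parameters unchanged,
    which is where the circuits have to live.\<close>
  ultimately obtain x1 where x1: "\<And>i. i \<in> Inr ` ({..<n} \<times> G) \<Longrightarrow> x1 i \<in> \<rat>" "\<Phi> x1 \<noteq> 0"
    using rational_nonroot[of "Inr ` ({..<n} \<times> G)" \<Phi> J x0] finG by auto
  define ext where "ext = (\<lambda>(q :: 'i \<Rightarrow> real) i. case i of Inl k \<Rightarrow> q k | Inr m \<Rightarrow> x1 (Inr m))"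
  have ext_poly: "(\<lambda>q. f (ext q)) \<in> polyfun \<rat> I" if "f \<in> polyfun \<rat> J" for f
  proof (rule polyfun_subst[OF that])
    fix i assume "i \<in> J"
    then show "(\<lambda>q. ext q i) \<in> polyfun \<rat> I"
      using x1(1) by (cases i) (auto simp: ext_def J_def intro: pf_var pf_const)
  qed
  have "\<Phi> (ext (\<lambda>k. x1 (Inl k))) \<noteq> 0"
  proof -
    have "ext (\<lambda>k. x1 (Inl k)) = x1" by (auto simp: ext_def fun_eq_iff split: sum.split)
    then show ?thesis using x1 by simp
  qed
  then have "\<Phi> (ext p) \<noteq> 0" using alg_indepD[OF p ext_poly[OF \<Phi>_poly]] by blast
  then have "indep_on {..<n} G (af (ext p))" by (simp add: \<Phi>_iff)
  moreover have "af (ext p) j i \<in> ratgen (p ` I)" if "j \<in> G" for j i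
    by (rule polyfun_in_ratgen[OF ext_poly[OF af_poly[OF that]]]) (auto intro: ratgen_base)
  moreover have supp: "af (ext p) j i = 0" if "i \<notin> \<Omega> j" for j i using that by (simp add: af_def)
  moreover have "Bf (ext p) j s i = p (cc j s i)" for j s i by (simp add: Bf_def ext_def)
  then have "(\<Sum>i<n. af (ext p) j i * p (if j \<in> G1 then c1 s i else c2 s i)) = 0"
    if "j \<in> G" "s \<in> (if j \<in> G1 then {..<\<kappa>1} else {..<\<kappa>2})" for j s
    using orth[of j s "ext p"] that by (simp add: cc_def \<kappa>_def split: if_splits)
  ultimately have "circuits n (p ` I) \<Omega> (G1 \<union> G2) (\<lambda>j. if j \<in> G1 then {..<\<kappa>1} else {..<\<kappa>2})
      (\<lambda>j s i. p (if j \<in> G1 then c1 s i else c2 s i)) (af (ext p))"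
    unfolding circuits_def G_def[symmetric] by (intro conjI ballI allI impI)
  then show ?thesis by (intro exI[of _ "af (ext p)"])
qed

text \<open>An injection of the basis indices into \<open>R\<close> gives a 0-1 specialisation
  containing an identity block; it is well defined because distinct entries are distinct
  variables.\<close>

lemma generic_rows_indep:
  fixes c :: "nat \<Rightarrow> nat \<Rightarrow> 'i" and R :: "nat set"
  assumes p: "alg_indep I p" and R: "R \<subseteq> {..<n}" "\<kappa> \<le> card R"
    and c: "\<And>s i. s < \<kappa> \<Longrightarrow> i < n \<Longrightarrow> c s i \<in> I"
      "\<And>s i s' i'. s < \<kappa> \<Longrightarrow> s' < \<kappa> \<Longrightarrow> c s i = c s' i' \<Longrightarrow> s = s' \<and> i = i'"
  shows "indep_on R {..<\<kappa>} (\<lambda>s i. p (c s i))"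
proof -
  have finR: "finite R" by (rule finite_subset[OF R(1) finite_lessThan])
  have "\<exists>f. f ` {..<\<kappa>} \<subseteq> R \<and> inj_on f {..<\<kappa>}"
    by (rule card_le_inj) (use finR R(2) in simp_all)
  then obtain f where f: "f ` {..<\<kappa>} \<subseteq> R" "inj_on f {..<\<kappa>}" by (elim exE conjE)
  define g where "g = (\<lambda>p. gram R \<kappa> (\<lambda>s i. p (c s i)))"
  have "g \<in> polyfun \<rat> I" unfolding g_def
    by (rule polyfun_gram) (use c(1) R(1) in \<open>auto intro!: pf_var\<close>)
  moreover define p0 where "p0 = (\<lambda>q. if \<exists>s<\<kappa>. q = c s (f s) then 1 else (0::real))"
  have p0: "p0 (c s i) = (if i = f s then 1 else 0)" if "s < \<kappa>" for s i
  proof -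
    have "(\<exists>s'<\<kappa>. c s i = c s' (f s')) \<longleftrightarrow> i = f s" using c(2)[OF that] that by blast
    then show ?thesis by (simp add: p0_def)
  qed
  have "indep_on R {..<\<kappa>} (\<lambda>s i. p0 (c s i))"
  proof (rule indep_onI)
    fix d k assume d: "\<And>i. i \<in> R \<Longrightarrow> (\<Sum>s<\<kappa>. d s * p0 (c s i)) = 0" and k: "k \<in> {..<\<kappa>}"
    have "0 = (\<Sum>s<\<kappa>. d s * p0 (c s (f k)))" using d[of "f k"] f k by auto
    also have "\<dots> = (\<Sum>s<\<kappa>. if s = k then d k else 0)"
      using f(2) k by (intro sum.cong refl) (auto simp: p0 inj_on_def)
    finally show "d k = 0" using k by simp
  qed
  then have "g p0 \<noteq> 0" unfolding g_def by (simp add: gram_nonzero_iff[OF finR])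
  ultimately have "g p \<noteq> 0" using alg_indepD[OF p] by blast
  then show ?thesis unfolding g_def by (simp add: gram_nonzero_iff[OF finR])
qed

section \<open>Column spaces\<close>

text \<open>Entries beyond the last row are 0, so vectors that agree on all rows are equal as
  functions. The intersection of two column spaces relies on this.\<close>

definition colspace :: "real mat \<Rightarrow> (nat \<Rightarrow> real) set" where
  "colspace A = range (\<lambda>c i. if i < dim_row A then \<Sum>j<dim_col A. c j * A $$ (i, j) else 0)"

lemma colspace_outside: "u \<in> colspace A \<Longrightarrow> dim_row A \<le> i \<Longrightarrow> u i = 0"
  by (auto simp: colspace_def)

lemma lin_subspace_colspace: "lin_subspace (colspace A)"
  unfolding lin_subspace_def
proof (intro conjI ballI allI)
  fix u w c assume "u \<in> colspace A" "w \<in> colspace A"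
  then obtain a b where "u = (\<lambda>i. if i < dim_row A then \<Sum>j<dim_col A. a j * A $$ (i, j) else 0)"
    "w = (\<lambda>i. if i < dim_row A then \<Sum>j<dim_col A. b j * A $$ (i, j) else 0)"
    unfolding colspace_def by (elim rangeE)
  then have "(\<lambda>i. u i + c * w i) = (\<lambda>i. if i < dim_row A then \<Sum>j<dim_col A. (a j + c * b j) * A $$ (i, j) else 0)"
    by (simp add: fun_eq_iff distrib_right sum.distrib sum_distrib_left mult.assoc)
  then show "(\<lambda>i. u i + c * w i) \<in> colspace A" unfolding colspace_def by (intro range_eqI)
next
  have "(\<lambda>_. 0) = (\<lambda>i. if i < dim_row A then \<Sum>j<dim_col A. 0 * A $$ (i, j) else 0)" by (simp add: fun_eq_iff)
  then show "(\<lambda>_. 0) \<in> colspace A" unfolding colspace_def by (rule range_eqI[where x = "\<lambda>_. 0"])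
qed

lemma column_in_colspace:
  assumes "j < dim_col A"
  shows "(\<lambda>i. if i < dim_row A then A $$ (i, j) else 0) \<in> colspace A"
proof -
  have "(\<lambda>i. if i < dim_row A then A $$ (i, j) else 0)
      = (\<lambda>i. if i < dim_row A then \<Sum>j'<dim_col A. (if j' = j then 1 else 0) * A $$ (i, j') else 0)"
    using assms by (simp add: fun_eq_iff if_distrib if_distribR cong: if_cong)
  then show ?thesis unfolding colspace_def by (rule range_eqI[where x = "\<lambda>j'. if j' = j then 1 else 0"])
qed

lemma delta_basis_in_span: "delta_basis N V P v \<Longrightarrow> u \<in> V \<Longrightarrow> in_span N P v u"
  unfolding delta_basis_def by (intro in_span_byI[where c = u]) simp

lemma delta_basis_finite: "delta_basis N V P v \<Longrightarrow> finite N \<Longrightarrow> finite P"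
  unfolding delta_basis_def by (elim conjE) (rule finite_subset)

lemma delta_basis_indep: "delta_basis N V P v \<Longrightarrow> finite N \<Longrightarrow> indep_on N P v"
  using delta_basis_finite[of N V P v] by (intro delta_on_indep) (simp_all add: delta_basis_def)

lemma in_span_if_dependent:
  assumes S: "indep_on R S v" "finite S" and c: "\<not> indep_on R (insert c S) v"
  shows "in_span R S v (v c)"
proof (cases "c \<in> S")
  case True
  then show ?thesis using S by (intro in_span_base)
next
  case False
  from c obtain d k where d: "\<And>i. i \<in> R \<Longrightarrow> (\<Sum>k\<in>insert c S. d k * v k i) = 0" "k \<in> insert c S" "d k \<noteq> 0"
    unfolding indep_on_def by blast
  have rel: "d c * v c i + (\<Sum>k\<in>S. d k * v k i) = 0" if "i \<in> R" for i using d(1)[OF that] S(2) False by simp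
  have "d c \<noteq> 0"
  proof
    assume z: "d c = 0"
    have "d k = 0" if "k \<in> S" for k
      by (rule indep_onD[OF S(1) _ that]) (use rel z in simp)
    then show False using d(2,3) z by auto
  qed
  then have "v c i = (\<Sum>k\<in>S. (- d k / d c) * v k i)" if "i \<in> R" for i
    using rel[OF that] by (simp add: sum_negf sum_divide_distrib[symmetric] field_simps)
  then show ?thesis by (rule in_span_byI)
qed

lemma lin_indpt_iff_indep_on:
  fixes T :: "real vec set"
  assumes "finite T" "T \<subseteq> carrier_vec n"
  shows "\<not> LinearCombinations.module.lin_dep class_ring (module_vec TYPE(real) n) T \<longleftrightarrow> indep_on {..<n} T (\<lambda>u i. u $ i)"
proof -
  interpret vec_space "TYPE(real)" n .
  have lc: "lincomb a T = 0\<^sub>v n \<longleftrightarrow> (\<forall>i\<in>{..<n}. (\<Sum>u\<in>T. a u * u $ i) = 0)" for a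
  proof -
    have "lincomb a T \<in> carrier_vec n" using assms by (simp add: lincomb_closed)
    then have "lincomb a T = 0\<^sub>v n \<longleftrightarrow> (\<forall>i<n. lincomb a T $ i = 0)"
      by (auto intro!: eq_vecI)
    then show ?thesis using lincomb_index[OF _ assms(2)] by auto
  qed
  show ?thesis
  proof
    assume ni: "\<not> lin_dep T"
    show "indep_on {..<n} T (\<lambda>u i. u $ i)"
    proof (rule indep_onI)
      fix c k assume "\<And>i. i \<in> {..<n} \<Longrightarrow> (\<Sum>k\<in>T. c k * k $ i) = 0" "k \<in> T"
      then have "lincomb c T = 0\<^sub>v n" using lc by blast
      then have "c \<in> T \<rightarrow> {\<zero>\<^bsub>class_ring\<^esub>}" using not_lindepD[OF ni assms(1) subset_refl] by (auto simp: class_ring_simps)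
      then show "c k = 0" using \<open>k \<in> T\<close> by (auto simp: class_ring_simps)
    qed
  next
    assume ind: "indep_on {..<n} T (\<lambda>u i. u $ i)"
    show "\<not> lin_dep T"
    proof (rule finite_lin_indpt2[OF assms(1)], goal_cases)
      case 1
      then show ?case using assms by simp
    next
      case (2 a)
      then have "lincomb a T = 0\<^sub>v n" by (simp add: module_vec_simps)
      then show ?case using lc ind by (auto simp: class_ring_simps indep_on_def)
    qed
  qed
qed

text \<open>A maximal independent set of columns and a pivot basis lie in each other's span, so the
  bound on independent families applies in both directions. This translates the rank conditions into
  numbers of pivots.\<close>

theorem mrank_eq_card_delta_basis:
  assumes A: "A \<in> carrier_mat n m" and P: "delta_basis {..<n} (colspace A) P v"
  shows "mrank A = card P"
proof -
  interpret vec_space "TYPE(real)" n .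
  define Q where "Q = (\<lambda>T. T \<subseteq> set (cols A) \<and> lin_indpt T)"
  have colsA: "set (cols A) \<subseteq> carrier_vec n" using cols_dim A by blast
  have "lin_indpt {}" by (subst lin_indpt_iff_indep_on) (auto simp: indep_on_def)
  then have "\<exists>S. finite S \<and> maximal S Q \<and> {} \<subseteq> S"
    by (intro maximal_exists_superset[of "set (cols A)"]) (auto simp: Q_def)
  then obtain S where S: "finite S" "maximal S Q" by blast
  have "mrank A = rank A" using A by (simp add: mrank_def)
  also have "\<dots> = card S" using rank_card_indpt[OF A] S(2) by (simp add: Q_def)
  finally have rank: "mrank A = card S" .
  let ?v = "\<lambda>u i. (u :: real vec) $ i"
  have QS: "S \<subseteq> set (cols A)" "lin_indpt S" using S(2) by (auto simp: maximal_def Q_def)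
  have indS: "indep_on {..<n} S ?v" using lin_indpt_iff_indep_on[OF S(1)] QS colsA by blast
  have finP: "finite P" using delta_basis_finite[OF P] by simp
  have col: "in_span {..<n} S ?v (?v u)" if u: "u \<in> set (cols A)" for u
  proof (cases "u \<in> S")
    case False
    have "\<not> indep_on {..<n} (insert u S) ?v"
    proof
      assume "indep_on {..<n} (insert u S) ?v"
      then have "Q (insert u S)"
        unfolding Q_def using lin_indpt_iff_indep_on[of "insert u S" n] S(1) QS(1) u colsA by auto
      then show False using S(2) False unfolding maximal_def by blast
    qed
    then show ?thesis using in_span_if_dependent[OF indS S(1)] by blast
  qed (use S in \<open>auto intro: in_span_base\<close>)
  have dim: "dim_row A = n" "dim_col A = m" using A by auto
  have "card P \<le> card S"
  proof (rule indep_card_le[OF delta_basis_indep[OF P] finP S(1)])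
    fix q assume "q \<in> P"
    then have "v q \<in> colspace A" using P by (simp add: delta_basis_def)
    then obtain c where c: "v q = (\<lambda>i. if i < n then \<Sum>j<m. c j * A $$ (i, j) else 0)" unfolding colspace_def dim by (elim rangeE)
    have "in_span {..<n} {..<m} (\<lambda>j i. A $$ (i, j)) (v q)" by (rule in_span_byI[where c = c]) (simp add: c)
    then show "in_span {..<n} S ?v (v q)"
    proof -
      assume sp: "in_span {..<n} {..<m} (\<lambda>j i. A $$ (i, j)) (v q)"
      have colj: "in_span {..<n} S ?v (\<lambda>i. A $$ (i, j))" if j: "j < m" for j
      proof -
        have "col A j \<in> set (cols A)" using j dim by (simp add: cols_def)
        from col[OF this] show ?thesis unfolding in_span_def using j dim by auto
      qed
      obtain d where d: "\<And>i. i \<in> {..<n} \<Longrightarrow> v q i = (\<Sum>j<m. d j * A $$ (i, j))" using sp unfolding in_span_def by blast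
      have "\<forall>j\<in>{..<m}. \<exists>e. \<forall>i\<in>{..<n}. A $$ (i, j) = (\<Sum>k\<in>S. e k * k $ i)"
        using colj unfolding in_span_def by blast
      from bchoice[OF this] obtain e where e: "\<And>j i. j < m \<Longrightarrow> i < n \<Longrightarrow> A $$ (i, j) = (\<Sum>k\<in>S. e j k * k $ i)" by auto
      show ?thesis
      proof (rule in_span_byI[where c = "\<lambda>k. \<Sum>j<m. d j * e j k"])
        fix i assume i: "i \<in> {..<n}"
        have "v q i = (\<Sum>j<m. \<Sum>k\<in>S. d j * e j k * k $ i)"
          using d[OF i] e i by (simp add: sum_distrib_left mult.assoc)
        then show "v q i = (\<Sum>k\<in>S. (\<Sum>j<m. d j * e j k) * k $ i)" by (subst (asm) sum.swap) (simp add: sum_distrib_right)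
      qed
    qed
  qed simp
  moreover have "card S \<le> card P"
  proof (rule indep_card_le[OF indS S(1) finP])
    fix u assume "u \<in> S"
    then obtain j where j: "j < m" "u = col A j" using QS(1) dim by (auto simp: cols_def)
    have "in_span {..<n} P v (\<lambda>i. if i < dim_row A then A $$ (i, j) else 0)"
      by (rule delta_basis_in_span[OF P column_in_colspace]) (use j dim in simp)
    then show "in_span {..<n} P v (?v u)" unfolding in_span_def using j dim by auto
  qed
  ultimately show ?thesis using rank by simp
qed

section \<open>Candidates for two views\<close>

text \<open>Subtracting the \<open>x\<close>-part of \<open>u\<close> leaves a vector that vanishes
  on \<open>P0\<close>, so only pivots outside \<open>P0\<close> occur in its expansion. The
  prescribed vectors \<open>x\<close> may thus replace the members of \<open>v\<close> at these
  pivots.\<close>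

lemma delta_basis_split:
  assumes V: "lin_subspace V" and P: "delta_basis N V P v" and N: "finite N"
    and P0: "P0 \<subseteq> P" "\<And>q. q \<in> P0 \<Longrightarrow> x q \<in> V" "delta_on P0 x" and u: "u \<in> V"
  shows "in_span N (P0 <+> (P - P0)) (case_sum x v) u"
proof -
  have finP: "finite P" using delta_basis_finite[OF P N] .
  have finP0: "finite P0" using P0(1) finP by (rule finite_subset)
  define w where "w = (\<lambda>i. u i + (-1) * (\<Sum>q\<in>P0. u q * x q i))"
  have "w \<in> V" unfolding w_def by (intro lin_subspaceD(2)[OF V u] lin_subspace_sum[OF V finP0] P0(2))
  then have w: "w i = (\<Sum>q\<in>P. w q * v q i)" if "i \<in> N" for i using P that by (simp add: delta_basis_def)
  have w0: "w q = 0" if "q \<in> P0" for q using delta_on_combination[OF P0(3) finP0 that, of u] by (simp add: w_def)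
  show ?thesis
  proof (rule in_span_byI[where c = "case_sum u w"])
    fix i assume i: "i \<in> N"
    have "(\<Sum>q\<in>P. w q * v q i) = (\<Sum>q\<in>P - P0. w q * v q i)"
      using finP P0(1) w0 by (intro sum.mono_neutral_right) auto
    then have "u i = (\<Sum>q\<in>P0. u q * x q i) + (\<Sum>q\<in>P - P0. w q * v q i)" using w[OF i] by (simp add: w_def)
    then show "u i = (\<Sum>k\<in>P0 <+> (P - P0). case_sum u w k * case_sum x v k i)"
      using finP finP0 by (simp add: sum.Plus)
  qed
qed

lemma circuits_cong:
  assumes "\<And>j. j \<in> G \<Longrightarrow> K j = K' j \<and> C j = C' j"
  shows "circuits n F \<Omega> G K C a \<longleftrightarrow> circuits n F \<Omega> G K' C' a"
  using assms unfolding circuits_def by simp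

lemma disjoint_family_reindex:
  "disjoint_family_on g J \<Longrightarrow> inj_on e P \<Longrightarrow> e ` P \<subseteq> J \<Longrightarrow> disjoint_family_on (\<lambda>q. g (e q)) P"
  unfolding disjoint_family_on_def inj_on_def by blast

text \<open>Column j of the candidate is X j; V1, V2 and W are the column spaces of its two views and of the whole
  matrix. The true bases have entries p (c1 s i) and p (c2 s i), the first k0 vectors being common.\<close>

locale two_view_candidate =
  fixes n k0 r1 r2 :: nat and I Ib :: "'i set" and p :: "'i \<Rightarrow> real" and c1 c2 \<tau> :: "nat \<Rightarrow> nat \<Rightarrow> 'i"
    and Cols1 Cols2 :: "nat set" and \<Omega> :: "nat \<Rightarrow> nat set" and X :: "nat \<Rightarrow> nat \<Rightarrow> real"
    and V1 V2 W :: "(nat \<Rightarrow> real) set"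
  assumes I: "finite I" "alg_indep I p" "Ib \<subseteq> I"
    and dims: "k0 \<le> r1" "k0 \<le> r2" "r1 + r2 - k0 \<le> n"
    and c: "\<And>s i. s < r1 \<Longrightarrow> i < n \<Longrightarrow> c1 s i \<in> Ib" "\<And>s i. s < r2 \<Longrightarrow> i < n \<Longrightarrow> c2 s i \<in> Ib"
      "\<And>s i. s < k0 \<Longrightarrow> c1 s i = c2 s i"
      "\<And>s i s' i'. s < r1 \<Longrightarrow> s' < r1 \<Longrightarrow> c1 s i = c1 s' i' \<Longrightarrow> s = s' \<and> i = i'"
      "\<And>s i s' i'. s < r2 \<Longrightarrow> s' < r2 \<Longrightarrow> c2 s i = c2 s' i' \<Longrightarrow> s = s' \<and> i = i'"
      "\<And>s i s' i'. s < r1 \<Longrightarrow> s' < r2 \<Longrightarrow> c1 s i = c2 s' i' \<Longrightarrow> s = s' \<and> i = i' \<and> s < k0"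
    and cols: "finite Cols1" "finite Cols2" "Cols1 \<inter> Cols2 = {}"
    and \<tau>: "\<And>j t. j \<in> Cols1 \<Longrightarrow> t < r1 \<Longrightarrow> \<tau> j t \<in> I - Ib" "\<And>j t. j \<in> Cols2 \<Longrightarrow> t < r2 \<Longrightarrow> \<tau> j t \<in> I - Ib"
      "\<And>j t j' t'. j \<in> Cols1 \<union> Cols2 \<Longrightarrow> j' \<in> Cols1 \<union> Cols2 \<Longrightarrow> \<tau> j t = \<tau> j' t' \<Longrightarrow> j = j' \<and> t = t'"
    and \<Omega>: "\<And>j. j \<in> Cols1 \<union> Cols2 \<Longrightarrow> \<Omega> j \<subseteq> {..<n}" "\<And>j. j \<in> Cols1 \<union> Cols2 \<Longrightarrow> r1 + r2 - k0 \<le> card (\<Omega> j)"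
    and V: "lin_subspace V1" "lin_subspace V2" "lin_subspace W" "V1 \<subseteq> W" "V2 \<subseteq> W"
      "\<And>u i. u \<in> W \<Longrightarrow> n \<le> i \<Longrightarrow> u i = 0"
      "\<And>u. u \<in> W \<Longrightarrow> \<exists>u1\<in>V1. \<exists>u2\<in>V2. \<forall>i<n. u i = u1 i + u2 i"
    and rank: "\<And>P v. delta_basis {..<n} V1 P v \<Longrightarrow> card P = r1" "\<And>P v. delta_basis {..<n} V2 P v \<Longrightarrow> card P = r2"
      "\<And>P v. delta_basis {..<n} W P v \<Longrightarrow> card P = r1 + r2 - k0"
    and X: "\<And>j. j \<in> Cols1 \<Longrightarrow> X j \<in> V1" "\<And>j. j \<in> Cols2 \<Longrightarrow> X j \<in> V2"
    and agree: "\<And>j i. j \<in> Cols1 \<Longrightarrow> i \<in> \<Omega> j \<Longrightarrow> X j i = (\<Sum>t<r1. p (c1 t i) * p (\<tau> j t))"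
      "\<And>j i. j \<in> Cols2 \<Longrightarrow> i \<in> \<Omega> j \<Longrightarrow> X j i = (\<Sum>t<r2. p (c2 t i) * p (\<tau> j t))"
begin

text \<open>With the views exchanged, the case of a wide first view is inherited from that of a wide
  second view.\<close>

lemma swap: "two_view_candidate n k0 r2 r1 I Ib p c2 c1 \<tau> Cols2 Cols1 \<Omega> X V2 V1 W"
proof (rule two_view_candidate.intro)
  show "r2 + r1 - k0 \<le> n" using dims(3) by (simp only: add.commute)
  show "\<exists>u1\<in>V2. \<exists>u2\<in>V1. \<forall>i<n. u i = u1 i + u2 i" if u: "u \<in> W" for u
  proof -
    obtain u1 u2 where "u1 \<in> V1" "u2 \<in> V2" "\<forall>i<n. u i = u1 i + u2 i" using V(7)[OF u] by (elim bexE)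
    then show ?thesis by (intro bexI[of _ u2] bexI[of _ u1]) (simp_all add: add.commute)
  qed
  show "s = s' \<and> i = i' \<and> s < k0" if "s < r2" "s' < r1" "c2 s i = c1 s' i'" for s s' i i'
    using c(6)[OF that(2,1), of i' i] that(3) by simp
  show "c2 s i = c1 s i" if "s < k0" for s i using c(3)[OF that] by simp
  show "Cols2 \<inter> Cols1 = {}" using cols(3) by (simp only: Int_commute)
  show "j = j' \<and> t = t'" if "j \<in> Cols2 \<union> Cols1" "j' \<in> Cols2 \<union> Cols1" "\<tau> j t = \<tau> j' t'" for j j' t t'
    using \<tau>(3) that by (simp only: Un_commute)
  show "\<Omega> j \<subseteq> {..<n}" "r2 + r1 - k0 \<le> card (\<Omega> j)" if "j \<in> Cols2 \<union> Cols1" for j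
    using \<Omega>[of j] that by (simp_all only: Un_commute add.commute)
  show "card P = r2 + r1 - k0" if "delta_basis {..<n} W P v" for P v
    using rank(3)[OF that] by (simp only: add.commute)
qed (fact I dims c cols \<tau> V rank X agree)+

abbreviation (input) "r \<equiv> r1 + r2 - k0"

text \<open>Numbers a basis of the sum of the two true spaces: all vectors of the first view, then
  those of the second from index \<open>k0\<close> on, so that common vectors occur once.\<close>

definition "cT s i = (if s < r1 then c1 s i else c2 (s - r1 + k0) i)"

abbreviation (input) "b1 \<equiv> \<lambda>s i. p (c1 s i)"
abbreviation (input) "b2 \<equiv> \<lambda>s i. p (c2 s i)"
abbreviation (input) "bT \<equiv> \<lambda>s i. p (cT s i)"

lemma cT: "s < r \<Longrightarrow> i < n \<Longrightarrow> cT s i \<in> Ib"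
    "s < r \<Longrightarrow> s' < r \<Longrightarrow> cT s i = cT s' i' \<Longrightarrow> s = s' \<and> i = i'"
proof -
  show "s < r \<Longrightarrow> i < n \<Longrightarrow> cT s i \<in> Ib" using c(1,2) dims by (auto simp: cT_def)
  show "s = s' \<and> i = i'" if "s < r" "s' < r" "cT s i = cT s' i'"
  proof (cases "s < r1"; cases "s' < r1")
    assume "s < r1" "s' < r1"
    then show ?thesis using c(4) that(3) by (simp add: cT_def)
  next
    assume a: "s < r1" "\<not> s' < r1"
    then have "c1 s i = c2 (s' - r1 + k0) i'" "s' - r1 + k0 < r2" using that dims by (auto simp: cT_def)
    then show ?thesis using c(6)[OF a(1)] by fastforce
  next
    assume a: "\<not> s < r1" "s' < r1"
    then have "c1 s' i' = c2 (s - r1 + k0) i" "s - r1 + k0 < r2" using that dims by (auto simp: cT_def)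
    then show ?thesis using c(6)[OF a(2)] by fastforce
  next
    assume a: "\<not> s < r1" "\<not> s' < r1"
    then have "c2 (s - r1 + k0) i = c2 (s' - r1 + k0) i'" "s - r1 + k0 < r2" "s' - r1 + k0 < r2"
      using that dims by (auto simp: cT_def)
    then have "s - r1 + k0 = s' - r1 + k0 \<and> i = i'" using c(5) by blast
    then show ?thesis using a by arith
  qed
qed

lemma Ib_indep: "alg_indep Ib p"
  using I(2,3) by (rule alg_indep_mono)

lemma rows_indep:
  assumes "R \<subseteq> {..<n}"
  shows "r1 \<le> card R \<Longrightarrow> indep_on R {..<r1} b1" "r2 \<le> card R \<Longrightarrow> indep_on R {..<r2} b2"
    "r \<le> card R \<Longrightarrow> indep_on R {..<r} bT"
proof -
  show "r1 \<le> card R \<Longrightarrow> indep_on R {..<r1} b1"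
    by (rule generic_rows_indep[OF Ib_indep assms]) (use c(1,4) in auto)
  show "r2 \<le> card R \<Longrightarrow> indep_on R {..<r2} b2"
    by (rule generic_rows_indep[OF Ib_indep assms]) (use c(2,5) in auto)
  show "r \<le> card R \<Longrightarrow> indep_on R {..<r} bT"
    by (rule generic_rows_indep[OF Ib_indep assms]) (use cT in auto)
qed

lemma observed_indep:
  assumes "j \<in> Cols1 \<union> Cols2"
  shows "indep_on (\<Omega> j) {..<r1} b1" "indep_on (\<Omega> j) {..<r2} b2" "indep_on (\<Omega> j) {..<r} bT"
  using rows_indep[OF \<Omega>(1)[OF assms]] \<Omega>(2)[OF assms] dims by auto

lemma b1_in_bT: "s < r1 \<Longrightarrow> in_span R {..<r} bT (b1 s)"
  using in_span_base[of "{..<r}" s R bT] dims by (simp add: cT_def)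

lemma b2_in_bT:
  assumes "s < r2"
  shows "in_span R {..<r} bT (b2 s)"
proof (cases "s < k0")
  case True
  then show ?thesis using b1_in_bT[of s R] c(3)[OF True] dims by simp
next
  case False
  then obtain d where "s = k0 + d" by (metis le_Suc_ex not_less)
  then have "cT (s - k0 + r1) = c2 s" by (simp add: cT_def fun_eq_iff add.commute)
  moreover have "in_span R {..<r} bT (bT (s - k0 + r1))"
    by (rule in_span_base) (use assms False dims in auto)
  ultimately show ?thesis by simp
qed

text \<open>The true and the candidate column both lie in the span of \<open>bT\<close> and agree on
  the observed rows. Since \<open>bT\<close> is independent there, their coefficients coincide. It
  remains to bring the candidate into this span.\<close>

lemma candidate_unique:
  assumes j: "j \<in> Cols1 \<union> Cols2" and sp: "in_span {..<n} {..<r} bT (X j)" and i: "i < n"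
  shows "X j i = (if j \<in> Cols1 then \<Sum>t<r1. p (c1 t i) * p (\<tau> j t) else \<Sum>t<r2. p (c2 t i) * p (\<tau> j t))"
proof -
  define U where "U = (\<lambda>i. if j \<in> Cols1 then \<Sum>t<r1. p (c1 t i) * p (\<tau> j t) else \<Sum>t<r2. p (c2 t i) * p (\<tau> j t))"
  have "in_span {..<n} {..<r} bT U"
  proof (cases "j \<in> Cols1")
    case True
    have "in_span {..<n} {..<r1} b1 U" using True by (intro in_span_byI[where c = "\<lambda>t. p (\<tau> j t)"]) (simp add: U_def mult.commute)
    then show ?thesis by (rule in_span_trans) (simp add: b1_in_bT)
  next
    case False
    have "in_span {..<n} {..<r2} b2 U" using False by (intro in_span_byI[where c = "\<lambda>t. p (\<tau> j t)"]) (simp add: U_def mult.commute)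
    then show ?thesis by (rule in_span_trans) (simp add: b2_in_bT)
  qed
  then obtain d where d: "\<And>i. i < n \<Longrightarrow> U i = (\<Sum>s<r. d s * bT s i)" unfolding in_span_def by auto
  obtain e where e: "\<And>i. i < n \<Longrightarrow> X j i = (\<Sum>s<r. e s * bT s i)" using sp unfolding in_span_def by auto
  have "d s - e s = 0" if "s < r" for s
  proof (rule indep_onD[OF observed_indep(3)[OF j]])
    fix i assume i: "i \<in> \<Omega> j"
    then have "i < n" using \<Omega>(1)[OF j] by auto
    moreover have "U i = X j i" using agree i j cols(3) by (auto simp: U_def)
    ultimately show "(\<Sum>s<r. (d s - e s) * bT s i) = 0" using d e by (simp add: left_diff_distrib sum_subtractf)
  qed (use that in simp)
  then have "(\<Sum>s<r. d s * bT s i) = (\<Sum>s<r. e s * bT s i)" by (intro sum.cong) auto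
  then have "U i = X j i" using d[OF i] e[OF i] by simp
  then show ?thesis by (simp add: U_def)
qed

text \<open>The case of \<open>generic_circuits\<close> with an empty second group and all vectors
  common.\<close>

lemma single_circuits:
  assumes c: "\<And>s i. s < \<kappa> \<Longrightarrow> i < n \<Longrightarrow> cc s i \<in> Ib"
      "\<And>s i s' i'. s < \<kappa> \<Longrightarrow> s' < \<kappa> \<Longrightarrow> cc s i = cc s' i' \<Longrightarrow> s = s' \<and> i = i'"
    and G: "finite G" "card G + \<kappa> = n" "G \<subseteq> Cols1 \<union> Cols2" "hall_surplus \<kappa> \<Omega> G"
  shows "\<exists>a. circuits n (p ` Ib) \<Omega> G (\<lambda>_. {..<\<kappa>}) (\<lambda>_ s i. p (cc s i)) a"
proof -
  have "\<exists>a. circuits n (p ` Ib) \<Omega> (G \<union> {}) (\<lambda>j. if j \<in> G then {..<\<kappa>} else {..<\<kappa>})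
      (\<lambda>j s i. p (if j \<in> G then cc s i else cc s i)) a"
  proof (rule generic_circuits[OF Ib_indep, where ?k0.0 = \<kappa>])
    show "\<forall>j\<in>G \<union> {}. \<Omega> j \<subseteq> {..<n}" using G(3) \<Omega>(1) by blast
    show "hall_surplus \<kappa> \<Omega> {}" by (simp add: hall_surplus_def)
    show "s = s' \<and> i = i' \<and> s < \<kappa>" if "s < \<kappa>" "s' < \<kappa>" "cc s i = cc s' i'" for s s' i i'
      using c(2)[OF that] that(1) by simp
    show "s = s' \<and> i = i'" if "s < \<kappa>" "s' < \<kappa>" "cc s i = cc s' i'" for s s' i i' using c(2)[OF that] .
    show "s = s' \<and> i = i'" if "s < \<kappa>" "s' < \<kappa>" "cc s i = cc s' i'" for s s' i i' using c(2)[OF that] .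
  qed (use c(1) G in simp_all)
  then show ?thesis by simp
qed

text \<open>Each of the \<open>r2\<close> pivot vectors of \<open>V2\<close> has a group of its own
  and the group with index \<open>r2\<close> is spare, hence \<open>r2 + 1\<close> groups of
  \<open>n - r2\<close> columns.\<close>

lemma view2_determined:
  fixes g :: "nat \<Rightarrow> nat set"
  assumes P2: "delta_basis {..<n} V2 P2 v2"
    and g: "\<And>q. q \<le> r2 \<Longrightarrow> g q \<subseteq> Cols2" "disjoint_family_on g {..r2}" "\<And>q. q \<le> r2 \<Longrightarrow> card (g q) + r2 = n"
      "\<And>q. q \<le> r2 \<Longrightarrow> hall_surplus r2 \<Omega> (g q)"
    and q: "q \<in> P2"
  shows "in_span {..<n} {..<r2} b2 (v2 q)"
proof -
  have fin: "finite P2" "card P2 = r2" using delta_basis_finite[OF P2] rank(2)[OF P2] by auto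
  have P2': "P2 \<subseteq> {..<n}" "delta_on P2 v2" using P2 by (auto simp: delta_basis_def)
  obtain e where e: "bij_betw e P2 {..<r2}" using ex_bij_betw_finite_nat[OF fin(1)] fin(2) by (auto simp: atLeast0LessThan)
  have eq: "e q < r2" if "q \<in> P2" for q using e that by (auto simp: bij_betw_def)
  have fing: "finite (g q)" if "q \<le> r2" for q using g(1)[OF that] cols(2) by (rule finite_subset)
  have "\<exists>a. circuits n (p ` Ib) \<Omega> (g q) (\<lambda>_. {..<r2}) (\<lambda>_. b2) a" if "q \<le> r2" for q
    using g(1,3,4)[OF that] fing[OF that] c(2,5) by (intro single_circuits) auto
  then have "\<forall>q\<in>{..r2}. \<exists>a. circuits n (p ` Ib) \<Omega> (g q) (\<lambda>_. {..<r2}) (\<lambda>_. b2) a" by simp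
  from bchoice[OF this] obtain a where a: "\<And>q. q \<le> r2 \<Longrightarrow> circuits n (p ` Ib) \<Omega> (g q) (\<lambda>_. {..<r2}) (\<lambda>_. b2) (a q)" by auto
  show ?thesis
  proof (rule candidate_in_span[OF I, where Cols = Cols2 and \<tau> = \<tau> and view = "\<lambda>_. ()" and \<kappa> = "\<lambda>_. r2"
        and B = "\<lambda>_. b2" and L = "\<lambda>_. P2" and V = "\<lambda>_. v2" and Qs = P2 and v = v2 and K = "\<lambda>_. {..<r2}" and C = "\<lambda>_. b2"
        and \<Omega> = \<Omega> and Gr = "\<lambda>q. g (e q)" and Piv = "\<lambda>_. P2" and a = "\<lambda>q. a (e q)" and E = "g r2" and e = "a r2" and \<nu> = "()"])
    show "in_span (\<Omega> j) P2 v2 (\<lambda>i. \<Sum>t<r2. p (c2 t i) * p (\<tau> j t))" if j: "j \<in> Cols2" for j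
    proof -
      have "in_span (\<Omega> j) P2 v2 (X j)"
        by (rule in_span_mono[OF delta_basis_in_span[OF P2 X(2)[OF j]] \<Omega>(1)[OF UnI2[OF j]]])
      then show ?thesis using agree(2)[OF j] unfolding in_span_def by auto
    qed
    show "disjoint_family_on (\<lambda>q. g (e q)) P2"
      using e by (intro disjoint_family_reindex[OF g(2)]) (auto simp: bij_betw_def)
    show "g (e q) \<subseteq> Cols2" if "q \<in> P2" for q using g(1)[of "e q"] eq[OF that] by simp
    show "card (g (e q)) + card P2 = n" if "q \<in> P2" for q using g(3)[of "e q"] eq[OF that] fin(2) by simp
    show "card P2 \<le> card {..<r2}" using fin(2) by simp
    show "card (g r2) + card {..<r2} = n" using g(3)[of r2] by simp
    show "g r2 \<subseteq> Cols2" using g(1)[of r2] by simp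
    show "circuits n (p ` Ib) \<Omega> (g r2) (\<lambda>_. {..<r2}) (\<lambda>_. b2) (a r2)" using a[of r2] by simp
    show "g r2 \<inter> g (e q) = {}" if "q \<in> P2" for q
      using eq[OF that] by (intro disjoint_family_onD[OF g(2)]) auto
    show "\<exists>u. (\<forall>j\<in>g (e q). in_span {..<n} P2 v2 u) \<and> (\<forall>i'\<in>P2. u i' = (if i' = i then 1 else 0))"
      if "q \<in> P2" "i \<in> P2" for q i
      using P2'(2) that fin by (intro exI[of _ "v2 i"]) (auto simp: delta_on_def intro: in_span_base)
    show "v2 q i \<in> ratgen (p ` Ib)" if "q \<in> P2" "i \<in> P2" for q i
      using P2'(2) that by (auto simp: delta_on_def intro: ratgen_field[where Y = "p ` Ib"])
    show "v2 l i \<in> ratgen (p ` Ib \<union> {v2 q i |q i. q \<in> P2 \<and> i < n})" if "l \<in> P2" "i < n" for l i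
      using that by (intro ratgen_base) auto
    show "circuits n (p ` Ib) \<Omega> (g (e q)) (\<lambda>_. {..<r2}) (\<lambda>_. b2) (a (e q))" if "q \<in> P2" for q
      using a eq[OF that] by simp
    show "in_span {..<n} P2 v2 (v2 q)" if "q \<in> P2" for q using fin(1) that by (rule in_span_base)
    show "indep_on {..<n} {..<r2} b2" using dims by (intro rows_indep) auto
    show "\<tau> j t \<in> I - Ib" if "j \<in> Cols2" "t < r2" for j t using \<tau>(2) that .
    show "j = j' \<and> t = t'" if "j \<in> Cols2" "j' \<in> Cols2" "\<tau> j t = \<tau> j' t'" for j j' t t'
      using \<tau>(3) that by blast
    show "indep_on (\<Omega> j) {..<r2} b2" if "j \<in> Cols2" for j using observed_indep(2) that by blast
  qed (use fin(1) P2'(1) cols c(2) \<Omega>(1) q in \<open>auto intro: ratgen_base\<close>)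
qed


lemma delta_in_ratgen: "delta_on P w \<Longrightarrow> q \<in> P \<Longrightarrow> i \<in> P \<Longrightarrow> w q i \<in> ratgen Y"
  by (auto simp: delta_on_def ratgen_field)

text \<open>The second view has columns to spare. Once V2 is known, only r1 - k0 vectors are missing in W, which
  the columns of the first view determine.\<close>

theorem determined_sequentially:
  fixes g g1 :: "nat \<Rightarrow> nat set"
  assumes g: "\<And>q. q \<le> r2 \<Longrightarrow> g q \<subseteq> Cols2" "disjoint_family_on g {..r2}" "\<And>q. q \<le> r2 \<Longrightarrow> card (g q) + r2 = n"
      "\<And>q. q \<le> r2 \<Longrightarrow> hall_surplus r2 \<Omega> (g q)"
    and g1: "\<And>q. q \<le> r1 - k0 \<Longrightarrow> g1 q \<subseteq> Cols1" "disjoint_family_on g1 {..r1 - k0}" "\<And>q. q \<le> r1 - k0 \<Longrightarrow> card (g1 q) + r = n"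
      "\<And>q. q \<le> r1 - k0 \<Longrightarrow> hall_surplus r \<Omega> (g1 q)"
    and j: "j \<in> Cols1 \<union> Cols2"
  shows "in_span {..<n} {..<r} bT (X j)"
proof -
  obtain P2 v2 where P2: "delta_basis {..<n} V2 P2 v2" using delta_basis_exists[OF finite_lessThan[of n] V(2)] by (elim exE)
  have v2V: "v2 q \<in> V2" if "q \<in> P2" for q using P2 that by (simp add: delta_basis_def)
  have v2W: "v2 q \<in> W" if "q \<in> P2" for q using v2V[OF that] V(5) by blast
  have d2: "P2 \<subseteq> {..<n}" "delta_on P2 v2" using P2 by (simp_all add: delta_basis_def)
  have fin2: "finite P2" "card P2 = r2" using delta_basis_finite[OF P2] rank(2)[OF P2] by simp_all
  have v2: "in_span {..<n} {..<r2} b2 (v2 q)" if "q \<in> P2" for q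
    by (rule view2_determined[OF P2 g that])
  \<comment> \<open>Keeping the pivots of \<open>V2\<close> makes \<open>P - P2\<close> index
    precisely the directions of \<open>W\<close> that are still unknown.\<close>
  have "\<exists>P v. P2 \<subseteq> P \<and> delta_basis {..<n} W P v"
    by (rule delta_basis_extend[OF finite_lessThan V(3) d2(1) _ d2(2)]) (rule v2W)
  then obtain P vT where PP: "P2 \<subseteq> P" "delta_basis {..<n} W P vT" by (elim exE conjE)
  have P: "P \<subseteq> {..<n}" "delta_on P vT" "finite P" "card P = r"
    using PP delta_basis_finite[OF PP(2)] rank(3)[OF PP(2)] by (simp_all add: delta_basis_def)
  have vTW: "vT q \<in> W" if "q \<in> P" for q using PP that by (simp add: delta_basis_def)
  define Qs where "Qs = P - P2"
  \<comment> \<open>The spanning family for \<open>W\<close> consists of the true basis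
    \<open>b2\<close>, which may replace the pivot basis of \<open>V2\<close> now, and the unknown
    vectors at the \<open>r1 - k0\<close> new pivots.\<close>
  define L where "L = {..<r2} <+> Qs"
  define VT where "VT = case_sum b2 vT"
  have Qs: "finite Qs" "card Qs = r1 - k0" using P fin2 PP(1) dims by (auto simp: Qs_def card_Diff_subset)
  have Wspan: "in_span {..<n} L VT u" if u: "u \<in> W" for u
  proof -
    have "in_span {..<n} (P2 <+> Qs) (case_sum v2 vT) u"
      unfolding Qs_def by (rule delta_basis_split[OF V(3) PP(2) finite_lessThan PP(1) v2W d2(2) u])
    then show ?thesis
    proof (rule in_span_trans)
      fix l assume l: "l \<in> P2 <+> Qs"
      show "in_span {..<n} L VT (case_sum v2 vT l)"
      proof (cases l)
        case (Inl q)
        then have "in_span {..<n} {..<r2} b2 (v2 q)" using v2 l by auto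
        then have "in_span {..<n} L VT (v2 q)"
        proof (rule in_span_trans)
          fix s assume "s \<in> {..<r2}"
          then show "in_span {..<n} L VT (b2 s)"
            using in_span_base[of L "Inl s" "{..<n}" VT] Qs InlI[of s "{..<r2}" Qs] by (simp add: L_def VT_def)
        qed
        then show ?thesis using Inl by simp
      next
        case (Inr q)
        then show ?thesis using in_span_base[of L "Inr q" "{..<n}" VT] Qs l by (auto simp: L_def VT_def)
      qed
    qed
  qed
  obtain e where e: "bij_betw e Qs {..<r1 - k0}" using ex_bij_betw_finite_nat[OF Qs(1)] Qs(2) by (auto simp: atLeast0LessThan)
  have eq: "e q < r1 - k0" if "q \<in> Qs" for q using e that by (auto simp: bij_betw_def)
  have fing: "finite (g1 q)" if "q \<le> r1 - k0" for q using g1(1)[OF that] cols(1) by (rule finite_subset)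
  have "\<exists>a. circuits n (p ` Ib) \<Omega> (g1 q) (\<lambda>_. {..<r}) (\<lambda>_. bT) a" if "q \<le> r1 - k0" for q
    using g1(1,3,4)[OF that] fing[OF that] cT by (intro single_circuits) auto
  then have "\<forall>q\<in>{..r1 - k0}. \<exists>a. circuits n (p ` Ib) \<Omega> (g1 q) (\<lambda>_. {..<r}) (\<lambda>_. bT) a" by simp
  from bchoice[OF this] obtain a where a: "\<And>q. q \<le> r1 - k0 \<Longrightarrow> circuits n (p ` Ib) \<Omega> (g1 q) (\<lambda>_. {..<r}) (\<lambda>_. bT) (a q)" by auto
  have VTr: "VT l i \<in> ratgen (p ` Ib \<union> {vT q i |q i. q \<in> Qs \<and> i < n})" if l: "l \<in> L" and i: "i < n" for l i
    using l i c(2) by (auto simp: L_def VT_def intro!: ratgen_base)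
  have key: "in_span {..<n} {..<r} bT (VT l)" if l: "l \<in> L" for l
  proof (rule candidate_in_span[OF I, where Cols = Cols1 and \<tau> = \<tau> and view = "\<lambda>_. ()" and \<kappa> = "\<lambda>_. r1"
        and B = "\<lambda>_. b1" and L = "\<lambda>_. L" and V = "\<lambda>_. VT" and Qs = Qs and v = vT and K = "\<lambda>_. {..<r}" and C = "\<lambda>_. bT"
        and \<Omega> = \<Omega> and Gr = "\<lambda>q. g1 (e q)" and Piv = "\<lambda>_. P" and a = "\<lambda>q. a (e q)" and E = "g1 (r1 - k0)"
        and e = "a (r1 - k0)" and \<nu> = "()"])
    show "in_span (\<Omega> j) L VT (\<lambda>i. \<Sum>t<r1. p (c1 t i) * p (\<tau> j t))" if j: "j \<in> Cols1" for j
    proof -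
      have "X j \<in> W" using X(1)[OF j] V(4) by blast
      then have "in_span (\<Omega> j) L VT (X j)"
        by (rule in_span_mono[OF Wspan \<Omega>(1)[OF UnI1[OF j]]])
      then show ?thesis using agree(1)[OF j] unfolding in_span_def by auto
    qed
    \<comment> \<open>A column of the first view involves only \<open>b1\<close>, but its circuit is
      orthogonal to all of \<open>bT\<close>; the other members of \<open>bT\<close> are among the
      known vectors \<open>b2\<close>.\<close>
    show "in_span (\<Omega> j) L VT (bT k)"
      if j: "j \<in> Cols1" and b: "\<And>t. t < r1 \<Longrightarrow> in_span (\<Omega> j) L VT (b1 t)" and k: "k \<in> {..<r}" for j k
    proof (cases "k < r1")
      case True
      then show ?thesis using b by (simp add: cT_def)
    next
      case False
      then have "bT k = VT (Inl (k - r1 + k0))" by (simp add: cT_def VT_def)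
      moreover have "Inl (k - r1 + k0) \<in> L" using False k dims by (auto simp: L_def)
      ultimately show ?thesis using in_span_base[of L] Qs(1) by (simp add: L_def)
    qed
    show "disjoint_family_on (\<lambda>q. g1 (e q)) Qs"
      using e by (intro disjoint_family_reindex[OF g1(2)]) (auto simp: bij_betw_def)
    show "g1 (r1 - k0) \<inter> g1 (e q) = {}" if "q \<in> Qs" for q
      using eq[OF that] by (intro disjoint_family_onD[OF g1(2)]) auto
    show "\<exists>u. (\<forall>j\<in>g1 (e q). in_span {..<n} L VT u) \<and> (\<forall>i'\<in>P. u i' = (if i' = i then 1 else 0))"
      if "q \<in> Qs" "i \<in> P" for q i
      using P(2) that Wspan[OF vTW[OF that(2)]] by (intro exI[of _ "vT i"]) (auto simp: delta_on_def)
    show "vT q i \<in> ratgen (p ` Ib)" if "q \<in> Qs" "i \<in> P" for q i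
      using that by (intro delta_in_ratgen[OF P(2)]) (auto simp: Qs_def)
    show "circuits n (p ` Ib) \<Omega> (g1 (e q)) (\<lambda>_. {..<r}) (\<lambda>_. bT) (a (e q))" if "q \<in> Qs" for q
      using a eq[OF that] by simp
    show "in_span {..<n} L VT (vT q)" if "q \<in> Qs" for q using that by (intro Wspan vTW) (simp add: Qs_def)
    show "indep_on {..<n} {..<r} bT" using dims by (intro rows_indep) auto
    show "\<tau> j t \<in> I - Ib" if "j \<in> Cols1" "t < r1" for j t using \<tau>(1) that .
    show "j = j' \<and> t = t'" if "j \<in> Cols1" "j' \<in> Cols1" "\<tau> j t = \<tau> j' t'" for j j' t t'
      using \<tau>(3) that by blast
    show "indep_on (\<Omega> j) {..<r} bT" if "j \<in> Cols1" for j using observed_indep(3) that by blast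
    show "g1 (e q) \<subseteq> Cols1" if "q \<in> Qs" for q using g1(1)[of "e q"] eq[OF that] by simp
    show "card (g1 (e q)) + card P = n" if "q \<in> Qs" for q using g1(3)[of "e q"] eq[OF that] P(4) by simp
    show "card L \<le> card {..<r}" using Qs dims by (simp add: L_def card_Plus)
    show "card (g1 (r1 - k0)) + card {..<r} = n" using g1(3)[of "r1 - k0"] by simp
    show "g1 (r1 - k0) \<subseteq> Cols1" using g1(1)[of "r1 - k0"] by simp
    show "circuits n (p ` Ib) \<Omega> (g1 (r1 - k0)) (\<lambda>_. {..<r}) (\<lambda>_. bT) (a (r1 - k0))" using a[of "r1 - k0"] by simp
    show "finite L" using Qs by (simp add: L_def)
  qed (use Qs(1) P(1) cols c(1) \<Omega>(1) l VTr in \<open>auto intro: ratgen_base\<close>)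
  have "X j \<in> W" using j X V(4,5) by blast
  then show ?thesis by (rule in_span_trans[OF Wspan]) (rule key)
qed


text \<open>Membership in a view, instead of in a group, selects the basis; this uniform form lets
  one application of \<open>candidate_in_span\<close> treat columns of both views.\<close>

lemma mixed_circuits:
  assumes G: "G1 \<subseteq> Cols1" "G2 \<subseteq> Cols2" "card G1 + card G2 + k0 = n"
    and hall: "hall_surplus k0 \<Omega> (G1 \<union> G2)" "hall_surplus r1 \<Omega> G1" "hall_surplus r2 \<Omega> G2"
  shows "\<exists>a. circuits n (p ` Ib) \<Omega> (G1 \<union> G2) (\<lambda>j. if j \<in> Cols1 then {..<r1} else {..<r2})
      (\<lambda>j. if j \<in> Cols1 then b1 else b2) a"
proof -
  have fin: "finite G1" "finite G2" using G(1,2) cols(1,2) by (auto intro: finite_subset)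
  have disj: "G1 \<inter> G2 = {}" using G(1,2) cols(3) by blast
  have sub: "\<forall>j\<in>G1 \<union> G2. \<Omega> j \<subseteq> {..<n}" using G(1,2) \<Omega>(1) by blast
  have "\<exists>a. circuits n (p ` Ib) \<Omega> (G1 \<union> G2) (\<lambda>j. if j \<in> G1 then {..<r1} else {..<r2})
      (\<lambda>j s i. p (if j \<in> G1 then c1 s i else c2 s i)) a"
    by (rule generic_circuits[OF Ib_indep c fin disj G(3) dims(1,2) sub hall])
  moreover have "circuits n (p ` Ib) \<Omega> (G1 \<union> G2) (\<lambda>j. if j \<in> G1 then {..<r1} else {..<r2})
      (\<lambda>j s i. p (if j \<in> G1 then c1 s i else c2 s i)) a \<longleftrightarrow>
    circuits n (p ` Ib) \<Omega> (G1 \<union> G2) (\<lambda>j. if j \<in> Cols1 then {..<r1} else {..<r2})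
      (\<lambda>j. if j \<in> Cols1 then b1 else b2) a" for a
  proof (rule circuits_cong)
    fix j assume "j \<in> G1 \<union> G2"
    then have "j \<in> G1 \<longleftrightarrow> j \<in> Cols1" using G(1,2) cols(3) by blast
    then show "(if j \<in> G1 then {..<r1} else {..<r2}) = (if j \<in> Cols1 then {..<r1} else {..<r2}) \<and>
      (\<lambda>s i. p (if j \<in> G1 then c1 s i else c2 s i)) = (if j \<in> Cols1 then b1 else b2)" by simp
  qed
  ultimately show ?thesis by simp
qed

text \<open>Inl indexes the mixed groups for the vectors of the intersection of V1 and V2, and Inr the groups
  inside a single view, of which the last one is spare.\<close>

theorem determined_jointly:
  fixes D1 D2 :: "nat + nat \<Rightarrow> nat set"
  assumes D1: "\<And>s. s \<in> {..<k0} <+> {..r1 - k0} \<Longrightarrow> D1 s \<subseteq> Cols1" "disjoint_family_on D1 ({..<k0} <+> {..r1 - k0})"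
    and D2: "\<And>s. s \<in> {..<k0} <+> {..r2 - k0} \<Longrightarrow> D2 s \<subseteq> Cols2" "disjoint_family_on D2 ({..<k0} <+> {..r2 - k0})"
    and card: "\<And>q. q < k0 \<Longrightarrow> card (D1 (Inl q)) + card (D2 (Inl q)) + k0 = n"
      "\<And>q. q \<le> r1 - k0 \<Longrightarrow> card (D1 (Inr q)) + r1 = n" "\<And>q. q \<le> r2 - k0 \<Longrightarrow> card (D2 (Inr q)) + r2 = n"
    and hall: "\<And>q. q < k0 \<Longrightarrow> hall_surplus k0 \<Omega> (D1 (Inl q) \<union> D2 (Inl q))"
      "\<And>s. s \<in> {..<k0} <+> {..r1 - k0} \<Longrightarrow> hall_surplus r1 \<Omega> (D1 s)"
      "\<And>s. s \<in> {..<k0} <+> {..r2 - k0} \<Longrightarrow> hall_surplus r2 \<Omega> (D2 s)"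
    and j: "j \<in> Cols1 \<union> Cols2"
  shows "in_span {..<n} {..<r} bT (X j)"
proof -
  have subs: "lin_subspace (V1 \<inter> V2)"
    unfolding lin_subspace_def using lin_subspaceD[OF V(1)] lin_subspaceD[OF V(2)] by (intro conjI ballI allI IntI) (simp_all only: Int_iff)
  obtain P0 x where P0: "delta_basis {..<n} (V1 \<inter> V2) P0 x" using delta_basis_exists[OF finite_lessThan[of n] subs] by (elim exE)
  have d0: "P0 \<subseteq> {..<n}" "delta_on P0 x" using P0 by (simp_all add: delta_basis_def)
  have xV: "x q \<in> V1" "x q \<in> V2" if "q \<in> P0" for q using P0 that by (simp_all add: delta_basis_def)
  have "\<exists>P v. P0 \<subseteq> P \<and> delta_basis {..<n} V1 P v"
    by (rule delta_basis_extend[OF finite_lessThan V(1) d0(1) _ d0(2)]) (rule xV(1))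
  then obtain P1 v1 where P1: "P0 \<subseteq> P1" "delta_basis {..<n} V1 P1 v1" by (elim exE conjE)
  have "\<exists>P v. P0 \<subseteq> P \<and> delta_basis {..<n} V2 P v"
    by (rule delta_basis_extend[OF finite_lessThan V(2) d0(1) _ d0(2)]) (rule xV(2))
  then obtain P2 v2 where P2: "P0 \<subseteq> P2" "delta_basis {..<n} V2 P2 v2" by (elim exE conjE)
  have d1: "P1 \<subseteq> {..<n}" "delta_on P1 v1" "finite P1" "card P1 = r1"
    using P1 delta_basis_finite[OF P1(2)] rank(1)[OF P1(2)] by (simp_all add: delta_basis_def)
  have d2: "P2 \<subseteq> {..<n}" "delta_on P2 v2" "finite P2" "card P2 = r2"
    using P2 delta_basis_finite[OF P2(2)] rank(2)[OF P2(2)] by (simp_all add: delta_basis_def)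
  have fin0: "finite P0" using d1(3) P1(1) by (rule finite_subset[rotated])
  have v1V: "v1 q \<in> V1" if "q \<in> P1" for q using P1(2) that by (simp add: delta_basis_def)
  have v2V: "v2 q \<in> V2" if "q \<in> P2" for q using P2(2) that by (simp add: delta_basis_def)
  have span1: "in_span {..<n} (P0 <+> (P1 - P0)) (case_sum x v1) u" if "u \<in> V1" for u
    by (rule delta_basis_split[OF V(1) P1(2) finite_lessThan P1(1) xV(1) d0(2) that])
  have span2: "in_span {..<n} (P0 <+> (P2 - P0)) (case_sum x v2) u" if "u \<in> V2" for u
    by (rule delta_basis_split[OF V(2) P2(2) finite_lessThan P2(1) xV(2) d0(2) that])
  \<comment> \<open>Unknown vectors of three kinds: common ones, and those private to the first or
    to the second view.\<close>
  define Qs where "Qs = P0 <+> ((P1 - P0) <+> (P2 - P0))"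
  define v where "v = case_sum x (case_sum v1 v2)"
  have finQ: "finite Qs" using fin0 d1(3) d2(3) by (simp add: Qs_def)
  have base: "in_span R Qs v (v q)" if "q \<in> Qs" for q R using finQ that by (rule in_span_base)
  have base0: "in_span R Qs v (x q)" if "q \<in> P0" for q R
    using base[of "Inl q" R] that by (simp add: Qs_def v_def InlI)
  have base1: "in_span R Qs v (v1 q)" if "q \<in> P1 - P0" for q R
    using base[of "Inr (Inl q)" R, unfolded Qs_def, OF InrI[OF InlI[OF that]]] by (simp add: Qs_def v_def)
  have base2: "in_span R Qs v (v2 q)" if "q \<in> P2 - P0" for q R
    using base[of "Inr (Inr q)" R, unfolded Qs_def, OF InrI[OF InrI[OF that]]] by (simp add: Qs_def v_def)
  have spanQ1: "in_span {..<n} Qs v u" if "u \<in> V1" for u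
    by (rule in_span_trans[OF span1[OF that]]) (elim PlusE; simp add: base0 base1)
  have spanQ2: "in_span {..<n} Qs v u" if "u \<in> V2" for u
    by (rule in_span_trans[OF span2[OF that]]) (elim PlusE; simp add: base0 base2)
  have sumQ: "(\<Sum>q\<in>Qs. f q) = (\<Sum>q\<in>P0. f (Inl q)) + ((\<Sum>q\<in>P1-P0. f (Inr (Inl q))) + (\<Sum>q\<in>P2-P0. f (Inr (Inr q))))"
    for f :: "nat + nat + nat \<Rightarrow> real"
    unfolding Qs_def using fin0 d1(3) d2(3) by (simp add: sum.Plus)
  have indQ: "indep_on {..<n} Qs v"
  proof (rule indep_onI)
    fix c q assume c: "\<And>i. i \<in> {..<n} \<Longrightarrow> (\<Sum>q\<in>Qs. c q * v q i) = 0" and q: "q \<in> Qs"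
    define w0 where "w0 = (\<lambda>i. \<Sum>q\<in>P0. c (Inl q) * x q i)"
    define w1 where "w1 = (\<lambda>i. \<Sum>q\<in>P1-P0. c (Inr (Inl q)) * v1 q i)"
    define w2 where "w2 = (\<lambda>i. \<Sum>q\<in>P2-P0. c (Inr (Inr q)) * v2 q i)"
    have rel: "w0 i + (w1 i + w2 i) = 0" if "i < n" for i
      using c[of i] that unfolding sumQ by (simp add: v_def w0_def w1_def w2_def)
    have V1mem: "w0 \<in> V1" "w1 \<in> V1" "w0 \<in> V2" "w2 \<in> V2"
      unfolding w0_def w1_def w2_def using xV v1V v2V fin0 d1(3) d2(3) by (intro lin_subspace_sum V; simp)+
    have w2P: "w2 q = 0" if q: "q \<in> P0" for q
      unfolding w2_def
    proof (intro sum.neutral ballI)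
      fix q' assume "q' \<in> P2 - P0"
      then have "v2 q' q = 0" using d2(2) P2(1) q unfolding delta_on_def by (metis DiffD1 DiffD2 subsetD)
      then show "c (Inr (Inr q')) * v2 q' q = 0" by simp
    qed
    have w1P: "w1 q = 0" if q: "q \<in> P0" for q
      unfolding w1_def
    proof (intro sum.neutral ballI)
      fix q' assume "q' \<in> P1 - P0"
      then have "v1 q' q = 0" using d1(2) P1(1) q unfolding delta_on_def by (metis DiffD1 DiffD2 subsetD)
      then show "c (Inr (Inl q')) * v1 q' q = 0" by simp
    qed
    \<comment> \<open>The part from the second view is minus the rest, so it lies in both spaces and
      is determined by its entries on \<open>P0\<close>, all of which are zero. At indices from
      \<open>n\<close> on, the equality comes from the zero extension.\<close>
    have "w2 = (\<lambda>i. 0 + (-1) * (w0 i + 1 * w1 i))"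
    proof
      fix i
      show "w2 i = 0 + (-1) * (w0 i + 1 * w1 i)"
      proof (cases "i < n")
        case True
        then show ?thesis using rel[OF True] by simp
      next
        case False
        then show ?thesis using V(6)[of w0 i] V(6)[of w1 i] V(6)[of w2 i] V1mem V(4,5) by (simp add: subset_iff)
      qed
    qed
    moreover have "(\<lambda>i. 0 + (-1) * (w0 i + 1 * w1 i)) \<in> V1"
      by (intro lin_subspaceD(2)[OF V(1) lin_subspaceD(1)[OF V(1)]] lin_subspaceD(2)[OF V(1)] V1mem)
    ultimately have "w2 \<in> V1 \<inter> V2" using V1mem by simp
    then have w2eq: "w2 i = (\<Sum>q\<in>P0. w2 q * x q i)" if "i < n" for i using P0 that by (simp add: delta_basis_def)
    have w20: "w2 i = 0" if "i < n" for i using w2eq[OF that] w2P by simp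
    have "indep_on {..<n} (P2 - P0) v2"
      by (rule indep_on_subset[OF delta_basis_indep[OF P2(2) finite_lessThan] _ d2(3)]) blast
    then have c2: "c (Inr (Inr q)) = 0" if "q \<in> P2 - P0" for q
      using indep_onD[of "{..<n}" "P2 - P0" v2 "\<lambda>q. c (Inr (Inr q))" q] w20 that by (simp add: w2_def)
    have c0: "c (Inl q) = 0" if q: "q \<in> P0" for q
    proof -
      have "q < n" using q d0(1) by auto
      then have "w0 q = 0" using rel[of q] w20[of q] w1P[OF q] by simp
      then show ?thesis using delta_on_combination[OF d0(2) fin0 q, of "\<lambda>q. c (Inl q)"] by (simp add: w0_def)
    qed
    have w10: "w1 i = 0" if "i < n" for i using rel[OF that] w20[OF that] c0 by (simp add: w0_def)
    have "indep_on {..<n} (P1 - P0) v1"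
      by (rule indep_on_subset[OF delta_basis_indep[OF P1(2) finite_lessThan] _ d1(3)]) blast
    then have c1: "c (Inr (Inl q)) = 0" if "q \<in> P1 - P0" for q
      using indep_onD[of "{..<n}" "P1 - P0" v1 "\<lambda>q. c (Inr (Inl q))" q] w10 that by (simp add: w1_def)
    show "c q = 0" using q c0 c1 c2 unfolding Qs_def by (elim PlusE) simp_all
  qed
  \<comment> \<open>The dimension formula: \<open>Qs\<close> indexes a basis of \<open>W\<close>, so
    the rank condition on the whole matrix makes the intersection of the candidate spaces
    \<open>k0\<close>-dimensional.\<close>
  have cardP0: "card P0 = k0"
  proof -
    obtain P vT where P: "delta_basis {..<n} W P vT" using delta_basis_exists[OF finite_lessThan[of n] V(3)] by (elim exE)
    have finP: "finite P" using delta_basis_finite[OF P] by simp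
    have "card Qs \<le> card P"
    proof (rule indep_card_le[OF indQ finQ finP])
      fix q assume "q \<in> Qs"
      then have "v q \<in> W" using xV v1V v2V V(4,5) P1(1) P2(1) unfolding Qs_def v_def by (elim PlusE) (simp_all add: subset_iff)
      then show "in_span {..<n} P vT (v q)" by (rule delta_basis_in_span[OF P])
    qed
    moreover have "card P \<le> card Qs"
    proof (rule indep_card_le[OF delta_basis_indep[OF P finite_lessThan] finP finQ])
      fix q assume "q \<in> P"
      then have "vT q \<in> W" using P by (simp add: delta_basis_def)
      then obtain u1 u2 where u: "u1 \<in> V1" "u2 \<in> V2" "\<forall>i<n. vT q i = u1 i + u2 i" using V(7) by blast
      obtain d1 d2 where "\<forall>i\<in>{..<n}. u1 i = (\<Sum>q\<in>Qs. d1 q * v q i)" "\<forall>i\<in>{..<n}. u2 i = (\<Sum>q\<in>Qs. d2 q * v q i)"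
        using spanQ1[OF u(1)] spanQ2[OF u(2)] unfolding in_span_def by blast
      then show "in_span {..<n} Qs v (vT q)"
        using u(3) by (intro in_span_byI[where c = "\<lambda>q. d1 q + d2 q"]) (simp add: distrib_right sum.distrib)
    qed
    ultimately have "card Qs = r" using rank(3)[OF P] by simp
    moreover have "card Qs = card P0 + ((r1 - card P0) + (r2 - card P0))"
      using fin0 d1(3,4) d2(3,4) P1(1) P2(1) by (simp add: Qs_def card_Plus card_Diff_subset)
    moreover have "card P0 \<le> r1" "card P0 \<le> r2" using card_mono[OF d1(3) P1(1)] card_mono[OF d2(3) P2(1)] d1(4) d2(4) by simp_all
    ultimately show ?thesis using dims by simp
  qed
  have card1: "card (P1 - P0) = r1 - k0" and card2: "card (P2 - P0) = r2 - k0"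
    using fin0 d1(4) d2(4) P1(1) P2(1) cardP0 by (simp_all add: card_Diff_subset)
  have Qs_cases [consumes 1]: thesis
    if "q \<in> Qs" "\<And>q'. q = Inl q' \<Longrightarrow> q' \<in> P0 \<Longrightarrow> thesis" "\<And>q'. q = Inr (Inl q') \<Longrightarrow> q' \<in> P1 - P0 \<Longrightarrow> thesis"
      "\<And>q'. q = Inr (Inr q') \<Longrightarrow> q' \<in> P2 - P0 \<Longrightarrow> thesis" for q thesis
    using that unfolding Qs_def Plus_def by blast
  define \<kappa> where "\<kappa> b = (if b then r1 else r2)" for b
  define K where "K b = (if b then {..<r1} else {..<r2})" for b
  define B where "B b = (if b then b1 else b2)" for b
  define L where "L b = P0 <+> (if b then P1 - P0 else P2 - P0)" for b
  define Vb where "Vb b = case_sum x (if b then v1 else v2)" for b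
  define Cols where "Cols = Cols1 \<union> Cols2"
  \<comment> \<open>A mixed group can be tested only with vectors in both spaces, so a common vector
    is normalised on \<open>P0\<close> alone and keeps \<open>n - k0\<close> free entries. A private
    vector is normalised on all pivots of its view.\<close>
  define Piv :: "nat + nat + nat \<Rightarrow> nat set" where "Piv = case_sum (\<lambda>_. P0) (case_sum (\<lambda>_. P1) (\<lambda>_. P2))"
  have not1: "j \<notin> Cols1" if "j \<in> Cols2" for j using that cols(3) by blast
  have KV: "finite (L b)" "finite (K b)" "card (L b) = card (K b)" "card (K b) = \<kappa> b" "K b = {..<\<kappa> b}" for b
    using fin0 d1(3) d2(3) cardP0 card1 card2 dims by (simp_all add: L_def K_def \<kappa>_def card_Plus)
  have Vspan: "in_span {..<n} (L b) (Vb b) u" if "u \<in> (if b then V1 else V2)" for b u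
    using that span1[of u] span2[of u] by (cases b) (simp_all add: L_def Vb_def)
  have xj: "X j \<in> (if j \<in> Cols1 then V1 else V2)" if "j \<in> Cols" for j
    using X[of j] that by (auto simp: Cols_def)
  have agr: "X j i = (\<Sum>t<\<kappa> (j \<in> Cols1). B (j \<in> Cols1) t i * p (\<tau> j t))" if "j \<in> Cols" "i \<in> \<Omega> j" for j i
    using agree[of j i] that not1[of j] by (auto simp: \<kappa>_def B_def Cols_def)
  have VQ: "Vb b l \<in> v ` Qs" if "l \<in> L b" for b l
    using that
  proof (cases l)
    case (Inl q)
    then have "q \<in> P0" using that by (auto simp: L_def)
    then show ?thesis using Inl by (intro image_eqI[where x = "Inl q"]) (simp_all add: Vb_def v_def Qs_def InlI)
  next
    case (Inr q)
    show ?thesis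
    proof (cases b)
      case True
      then have "q \<in> P1 - P0" using that Inr by (auto simp: L_def)
      then show ?thesis using Inr True unfolding Qs_def
        by (intro image_eqI[where x = "Inr (Inl q)"] InrI InlI) (simp_all add: Vb_def v_def)
    next
      case False
      then have "q \<in> P2 - P0" using that Inr by (auto simp: L_def)
      then show ?thesis using Inr False unfolding Qs_def
        by (intro image_eqI[where x = "Inr (Inr q)"] InrI) (simp_all add: Vb_def v_def)
    qed
  qed
  obtain e0 where e0: "bij_betw e0 P0 {..<k0}"
    using ex_bij_betw_finite_nat[OF fin0] cardP0 by (auto simp: atLeast0LessThan)
  obtain e1 where e1: "bij_betw e1 (P1 - P0) {..<r1 - k0}"
    using ex_bij_betw_finite_nat[of "P1 - P0"] d1(3) card1 by (auto simp: atLeast0LessThan)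
  obtain e2 where e2: "bij_betw e2 (P2 - P0) {..<r2 - k0}"
    using ex_bij_betw_finite_nat[of "P2 - P0"] d2(3) card2 by (auto simp: atLeast0LessThan)
  have e0': "e0 q < k0" if "q \<in> P0" for q using bij_betwE[OF e0] that by auto
  have e1': "e1 q < r1 - k0" if "q \<in> P1 - P0" for q using bij_betwE[OF e1] that by auto
  have e2': "e2 q < r2 - k0" if "q \<in> P2 - P0" for q using bij_betwE[OF e2] that by auto
  define Gr where "Gr = case_sum (\<lambda>q. D1 (Inl (e0 q)) \<union> D2 (Inl (e0 q))) (case_sum (\<lambda>q. D1 (Inr (e1 q))) (\<lambda>q. D2 (Inr (e2 q))))"
  let ?circ = "\<lambda>G. circuits n (p ` Ib) \<Omega> G (\<lambda>j. K (j \<in> Cols1)) (\<lambda>j. B (j \<in> Cols1))"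
  have D1I: "D1 (Inl q) \<subseteq> Cols1" if "q < k0" for q using that by (intro D1(1) InlI) simp
  have D1R: "D1 (Inr q) \<subseteq> Cols1" if "q \<le> r1 - k0" for q using that by (intro D1(1) InrI) simp
  have D2I: "D2 (Inl q) \<subseteq> Cols2" if "q < k0" for q using that by (intro D2(1) InlI) simp
  have D2R: "D2 (Inr q) \<subseteq> Cols2" if "q \<le> r2 - k0" for q using that by (intro D2(1) InrI) simp
  have circ0: "\<exists>a. ?circ (D1 (Inl q) \<union> D2 (Inl q)) a" if q: "q < k0" for q
    unfolding K_def B_def using q
    by (intro mixed_circuits D1I D2I card(1) hall InlI) simp_all
  have circ1: "\<exists>a. ?circ (D1 (Inr q)) a" if q: "q \<le> r1 - k0" for q
  proof -
    have "\<exists>a. circuits n (p ` Ib) \<Omega> (D1 (Inr q)) (\<lambda>_. {..<r1}) (\<lambda>_. b1) a"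
      using c(1,4) D1R[OF q] finite_subset[OF D1R[OF q] cols(1)] card(2)[OF q] hall(2)[OF InrI[of q]] q
      by (intro single_circuits) auto
    moreover have "circuits n (p ` Ib) \<Omega> (D1 (Inr q)) (\<lambda>_. {..<r1}) (\<lambda>_. b1) a \<longleftrightarrow> ?circ (D1 (Inr q)) a" for a
      using D1R[OF q] by (intro circuits_cong) (auto simp: K_def B_def)
    ultimately show ?thesis by simp
  qed
  have circ2: "\<exists>a. ?circ (D2 (Inr q)) a" if q: "q \<le> r2 - k0" for q
  proof -
    have "\<exists>a. circuits n (p ` Ib) \<Omega> (D2 (Inr q)) (\<lambda>_. {..<r2}) (\<lambda>_. b2) a"
      using c(2,5) D2R[OF q] finite_subset[OF D2R[OF q] cols(2)] card(3)[OF q] hall(3)[OF InrI[of q]] q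
      by (intro single_circuits) auto
    moreover have "circuits n (p ` Ib) \<Omega> (D2 (Inr q)) (\<lambda>_. {..<r2}) (\<lambda>_. b2) a \<longleftrightarrow> ?circ (D2 (Inr q)) a" for a
      using D2R[OF q] not1 by (intro circuits_cong) (auto simp: K_def B_def)
    ultimately show ?thesis by simp
  qed
  have "\<forall>q\<in>Qs. \<exists>a. ?circ (Gr q) a"
  proof
    fix q assume "q \<in> Qs"
    then show "\<exists>a. ?circ (Gr q) a"
      by (cases rule: Qs_cases) (simp_all add: Gr_def circ0 e0' circ1[OF less_imp_le] e1' circ2[OF less_imp_le] e2' del: Diff_iff)
  qed
  from bchoice[OF this] obtain a where a: "\<And>q. q \<in> Qs \<Longrightarrow> ?circ (Gr q) (a q)" by (elim exE) blast
  \<comment> \<open>The slot of \<open>D1\<close> or \<open>D2\<close> from which group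
    \<open>q\<close> takes its columns. Private vectors of both views use \<open>Inr\<close> slots,
    so \<open>\<sigma>1\<close> is injective only as long as at most one view contributes private
    vectors.\<close>
  define \<sigma>1 :: "nat + nat + nat \<Rightarrow> nat + nat" where "\<sigma>1 = case_sum (\<lambda>q. Inl (e0 q)) (case_sum (\<lambda>q. Inr (e1 q)) (\<lambda>q. Inr (e2 q)))"
  have GrC: "Gr q \<subseteq> Cols" if "q \<in> Qs" for q
    using that D1I e0' D1R[OF less_imp_le] e1' D2I D2R[OF less_imp_le] e2' unfolding Qs_def
    by (elim PlusE) (simp_all add: Gr_def Cols_def le_supI1 le_supI2 del: Diff_iff)
  have Gr1: "t \<in> D1 (\<sigma>1 q) \<and> \<sigma>1 q \<in> {..<k0} <+> {..<r1 - k0} \<and> (\<forall>q'. q \<noteq> Inr (Inr q'))" if "q \<in> Qs" "t \<in> Gr q" "t \<in> Cols1" for q t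
    using that D2I e0' D2R[OF less_imp_le] e1' e2' cols(3) unfolding Qs_def
    by (elim PlusE) (simp_all add: Gr_def \<sigma>1_def InlI InrI del: Diff_iff, blast+)
  have Gr2: "t \<in> D2 (\<sigma>1 q) \<and> \<sigma>1 q \<in> {..<k0} <+> {..<r2 - k0} \<and> (\<forall>q'. q \<noteq> Inr (Inl q'))" if "q \<in> Qs" "t \<in> Gr q" "t \<in> Cols2" for q t
    using that D1I e0' D1R[OF less_imp_le] e1' e2' cols(3) unfolding Qs_def
    by (elim PlusE) (simp_all add: Gr_def \<sigma>1_def InlI InrI del: Diff_iff, blast+)
  have inj0: "inj_on e0 P0" "inj_on e1 (P1 - P0)" "inj_on e2 (P2 - P0)" using e0 e1 e2 by (simp_all add: bij_betw_def)
  have \<sigma>inj: "q = q'" if "q \<in> Qs" "q' \<in> Qs" "\<sigma>1 q = \<sigma>1 q'"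
     "(\<forall>s. q \<noteq> Inr (Inr s)) \<and> (\<forall>s. q' \<noteq> Inr (Inr s)) \<or> (\<forall>s. q \<noteq> Inr (Inl s)) \<and> (\<forall>s. q' \<noteq> Inr (Inl s))" for q q'
    using that inj0 unfolding Qs_def
    by (elim PlusE) (auto simp: \<sigma>1_def inj_on_def)
  have disj: "disjoint_family_on Gr Qs"
    unfolding disjoint_family_on_def
  proof (intro ballI impI equals0I)
    fix q q' t assume q: "q \<in> Qs" "q' \<in> Qs" "q \<noteq> q'" and t: "t \<in> Gr q \<inter> Gr q'"
    then consider "t \<in> Cols1" | "t \<in> Cols2" using GrC[OF q(1)] by (auto simp: Cols_def)
    then show False
    proof cases
      case 1
      have g: "t \<in> D1 (\<sigma>1 q)" "t \<in> D1 (\<sigma>1 q')" "\<sigma>1 q \<noteq> \<sigma>1 q'"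
        using Gr1[OF q(1) _ 1] Gr1[OF q(2) _ 1] t \<sigma>inj[OF q(1,2)] q(3) by auto
      have "\<sigma>1 q \<in> {..<k0} <+> {..r1 - k0}" "\<sigma>1 q' \<in> {..<k0} <+> {..r1 - k0}"
        using Gr1[OF q(1) _ 1] Gr1[OF q(2) _ 1] t by (auto simp: less_imp_le)
      from disjoint_family_onD[OF D1(2) this g(3)] g show False by blast
    next
      case 2
      have g: "t \<in> D2 (\<sigma>1 q)" "t \<in> D2 (\<sigma>1 q')" "\<sigma>1 q \<noteq> \<sigma>1 q'"
        using Gr2[OF q(1) _ 2] Gr2[OF q(2) _ 2] t \<sigma>inj[OF q(1,2)] q(3) by auto
      have "\<sigma>1 q \<in> {..<k0} <+> {..r2 - k0}" "\<sigma>1 q' \<in> {..<k0} <+> {..r2 - k0}"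
        using Gr2[OF q(1) _ 2] Gr2[OF q(2) _ 2] t by (auto simp: less_imp_le)
      from disjoint_family_onD[OF D2(2) this g(3)] g show False by blast
    qed
  qed
  have spare1: "D1 (Inr (r1 - k0)) \<inter> Gr q = {}" if q: "q \<in> Qs" for q
  proof (rule equals0I)
    fix t assume t: "t \<in> D1 (Inr (r1 - k0)) \<inter> Gr q"
    then have t1: "t \<in> Cols1" using D1R[of "r1 - k0"] by auto
    have g: "t \<in> D1 (\<sigma>1 q)" "\<sigma>1 q \<in> {..<k0} <+> {..<r1 - k0}" using Gr1[OF q _ t1] t by auto
    then have m: "\<sigma>1 q \<in> {..<k0} <+> {..r1 - k0}" "\<sigma>1 q \<noteq> Inr (r1 - k0)" by (auto simp: less_imp_le)
    have "Inr (r1 - k0) \<in> {..<k0} <+> {..r1 - k0}" by (intro InrI) simp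
    from disjoint_family_onD[OF D1(2) m(1) this m(2)] g t show False by blast
  qed
  have spare2: "D2 (Inr (r2 - k0)) \<inter> Gr q = {}" if q: "q \<in> Qs" for q
  proof (rule equals0I)
    fix t assume t: "t \<in> D2 (Inr (r2 - k0)) \<inter> Gr q"
    then have t1: "t \<in> Cols2" using D2R[of "r2 - k0"] by auto
    have g: "t \<in> D2 (\<sigma>1 q)" "\<sigma>1 q \<in> {..<k0} <+> {..<r2 - k0}" using Gr2[OF q _ t1] t by auto
    then have m: "\<sigma>1 q \<in> {..<k0} <+> {..r2 - k0}" "\<sigma>1 q \<noteq> Inr (r2 - k0)" by (auto simp: less_imp_le)
    have "Inr (r2 - k0) \<in> {..<k0} <+> {..r2 - k0}" by (intro InrI) simp
    from disjoint_family_onD[OF D2(2) m(1) this m(2)] g t show False by blast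
  qed
  \<comment> \<open>The unknown vectors and their groups are the same for both views; only the spare
    group \<open>E\<close>, and with it the view \<open>b\<close>, varies.\<close>
  have key: "in_span {..<n} (K b) (B b) (Vb b l)"
    if E: "E \<subseteq> Cols" "\<And>q. q \<in> Qs \<Longrightarrow> E \<inter> Gr q = {}" "\<And>j. j \<in> E \<Longrightarrow> (j \<in> Cols1) = b" "card E + \<kappa> b = n" "?circ E e"
      and l: "l \<in> L b" for b l E e
  proof (rule candidate_in_span[OF I, where Cols = Cols and \<tau> = \<tau> and view = "\<lambda>j. j \<in> Cols1" and \<kappa> = \<kappa>
        and B = B and L = L and V = Vb and Qs = Qs and v = v and K = K and C = B
        and \<Omega> = \<Omega> and Gr = Gr and Piv = Piv and a = a and E = E and e = e and \<nu> = b])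
    show "finite Cols" using cols by (simp add: Cols_def)
    show "\<tau> j t \<in> I - Ib" if "j \<in> Cols" "t < \<kappa> (j \<in> Cols1)" for j t
      using \<tau>(1,2)[of j t] that by (auto simp: Cols_def \<kappa>_def split: if_splits)
    show "j = j' \<and> t = t'" if "j \<in> Cols" "j' \<in> Cols" "\<tau> j t = \<tau> j' t'" for j j' t t'
      using \<tau>(3) that unfolding Cols_def .
    show "B (j \<in> Cols1) t i \<in> ratgen (p ` Ib)" if "t < \<kappa> (j \<in> Cols1)" "i < n" for j t i
      using that c(1,2)[of t i] by (auto simp: B_def \<kappa>_def intro!: ratgen_base split: if_splits)
    show "Vb (j \<in> Cols1) l i \<in> ratgen (p ` Ib \<union> {v q i |q i. q \<in> Qs \<and> i < n})"
      if "l \<in> L (j \<in> Cols1)" "i < n" for j l i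
    proof -
      have "Vb (j \<in> Cols1) l \<in> v ` Qs" by (rule VQ[OF that(1)])
      then obtain q where "q \<in> Qs" "Vb (j \<in> Cols1) l = v q" by blast
      then show ?thesis using that(2) by (intro ratgen_base) auto
    qed
    show "\<Omega> j \<subseteq> {..<n}" if "j \<in> Cols" for j using \<Omega>(1) that unfolding Cols_def .
    show "indep_on (\<Omega> j) (K (j \<in> Cols1)) (B (j \<in> Cols1))" if "j \<in> Cols" for j
      using observed_indep[of j] that by (simp add: Cols_def K_def B_def)
    show "in_span (\<Omega> j) (L (j \<in> Cols1)) (Vb (j \<in> Cols1)) (B (j \<in> Cols1) k)"
      if "\<And>t. t < \<kappa> (j \<in> Cols1) \<Longrightarrow> in_span (\<Omega> j) (L (j \<in> Cols1)) (Vb (j \<in> Cols1)) (B (j \<in> Cols1) t)"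
         "k \<in> K (j \<in> Cols1)" for j k
      using that(2) by (intro that(1)) (simp add: KV(5))
    show "in_span (\<Omega> j) (L (j \<in> Cols1)) (Vb (j \<in> Cols1)) (\<lambda>i. \<Sum>t<\<kappa> (j \<in> Cols1). B (j \<in> Cols1) t i * p (\<tau> j t))"
      if j: "j \<in> Cols" for j
    proof -
      have "in_span (\<Omega> j) (L (j \<in> Cols1)) (Vb (j \<in> Cols1)) (X j)"
        using \<Omega>(1) j by (intro in_span_mono[OF Vspan[OF xj[OF j]]]) (simp add: Cols_def)
      then show ?thesis using agr[OF j] unfolding in_span_def by simp
    qed
    show "Piv q \<subseteq> {..<n}" if "q \<in> Qs" for q
      using that d0(1) d1(1) d2(1) unfolding Qs_def by (elim PlusE) (simp_all add: Piv_def)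
    show "card (Gr q) + card (Piv q) = n" if "q \<in> Qs" for q
    proof -
      have "card (D1 (Inl (e0 q)) \<union> D2 (Inl (e0 q))) = card (D1 (Inl (e0 q))) + card (D2 (Inl (e0 q)))" if "q \<in> P0" for q
        using D1I[OF e0'[OF that]] D2I[OF e0'[OF that]] cols by (intro card_Un_disjoint) (auto intro: finite_subset)
      then show ?thesis using \<open>q \<in> Qs\<close> card(1)[OF e0'] card(2)[OF less_imp_le[OF e1']] card(3)[OF less_imp_le[OF e2']]
          cardP0 d1(4) d2(4) unfolding Qs_def
        by (elim PlusE) (simp_all add: Gr_def Piv_def del: Diff_iff)
    qed
    show "v q i \<in> ratgen (p ` Ib)" if "q \<in> Qs" "i \<in> Piv q" for q i
      using that delta_in_ratgen[OF d0(2)] delta_in_ratgen[OF d1(2)] delta_in_ratgen[OF d2(2)] unfolding Qs_def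
      by (elim PlusE) (simp_all add: v_def Piv_def)
    have side: "j \<in> Cols1 \<and> q \<in> P1 - P0" if "Inr (Inl q) \<in> Qs" "j \<in> Gr (Inr (Inl q))" for q j
      using that D1R[OF less_imp_le[OF e1']] by (auto simp: Qs_def Gr_def)
    have side': "j \<notin> Cols1 \<and> q \<in> P2 - P0" if "Inr (Inr q) \<in> Qs" "j \<in> Gr (Inr (Inr q))" for q j
      using that D2R[OF less_imp_le[OF e2']] not1 by (auto simp: Qs_def Gr_def)
    show "in_span {..<n} (L (j \<in> Cols1)) (Vb (j \<in> Cols1)) (v q)" if "q \<in> Qs" "j \<in> Gr q" for q j
    proof (rule Vspan)
      show "v q \<in> (if j \<in> Cols1 then V1 else V2)"
        using that(1)
      proof (cases rule: Qs_cases)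
        case (1 q')
        then show ?thesis using xV by (simp add: v_def)
      next
        case (2 q')
        then show ?thesis using that v1V side[of q' j] by (simp add: v_def)
      next
        case (3 q')
        then show ?thesis using that v2V side'[of q' j] by (simp add: v_def)
      qed
    qed
    show "\<exists>u. (\<forall>j\<in>Gr q. in_span {..<n} (L (j \<in> Cols1)) (Vb (j \<in> Cols1)) u) \<and> (\<forall>i'\<in>Piv q. u i' = (if i' = i then 1 else 0))"
      if q: "q \<in> Qs" and i: "i \<in> Piv q" for q i
    proof -
      have un: "\<exists>u. (\<forall>j\<in>Gr q. in_span {..<n} (L (j \<in> Cols1)) (Vb (j \<in> Cols1)) u) \<and> (\<forall>i'\<in>Piv q. u i' = (if i' = i then 1 else 0))"
        if "\<And>j. j \<in> Gr q \<Longrightarrow> u \<in> (if j \<in> Cols1 then V1 else V2)" "\<And>i'. i' \<in> Piv q \<Longrightarrow> u i' = (if i' = i then 1 else 0)" for u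
        using Vspan[OF that(1)] that(2) by (intro exI[of _ u]) simp
      show ?thesis using q
      proof (cases rule: Qs_cases)
        case 1
        show ?thesis by (rule un[of "x i"]) (use i 1 xV d0(2) in \<open>auto simp: Piv_def delta_on_def\<close>)
      next
        case 2
        show ?thesis by (rule un[of "v1 i"]) (use i q 2 v1V d1(2) side in \<open>auto simp: Piv_def delta_on_def\<close>)
      next
        case 3
        show ?thesis by (rule un[of "v2 i"]) (use i q 3 v2V d2(2) side' in \<open>auto simp: Piv_def delta_on_def\<close>)
      qed
    qed
    show "indep_on {..<n} (K b) (B b)" using rows_indep[of "{..<n}"] dims by (simp add: K_def B_def)
    show "card E + card (K b) = n" using E(4) by (simp add: KV(4))
  qed (use a E finQ disj GrC KV(1-3) l in simp_all)
  have key1: "in_span {..<n} {..<r1} b1 (Vb True l)" if "l \<in> L True" for l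
  proof -
    obtain e where e: "?circ (D1 (Inr (r1 - k0))) e" using circ1[OF order_refl] by (elim exE)
    have "in_span {..<n} (K True) (B True) (Vb True l)"
      by (rule key[OF _ spare1 _ _ e that])
        (use D1R[of "r1 - k0"] card(2)[of "r1 - k0"] in \<open>auto simp: Cols_def \<kappa>_def\<close>)
    then show ?thesis by (simp add: K_def B_def)
  qed
  have key2: "in_span {..<n} {..<r2} b2 (Vb False l)" if "l \<in> L False" for l
  proof -
    obtain e where e: "?circ (D2 (Inr (r2 - k0))) e" using circ2[OF order_refl] by (elim exE)
    have "in_span {..<n} (K False) (B False) (Vb False l)"
      by (rule key[OF _ spare2 _ _ e that])
        (use D2R[of "r2 - k0"] card(3)[of "r2 - k0"] not1 in \<open>auto simp: Cols_def \<kappa>_def\<close>)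
    then show ?thesis by (simp add: K_def B_def)
  qed
  show ?thesis
  proof (cases "j \<in> Cols1")
    case True
    then have "in_span {..<n} {..<r1} b1 (X j)" using X(1) by (intro in_span_trans[OF Vspan[of _ True] key1]) simp_all
    then show ?thesis by (rule in_span_trans) (simp add: b1_in_bT)
  next
    case False
    then have "in_span {..<n} {..<r2} b2 (X j)" using X(2) j by (intro in_span_trans[OF Vspan[of _ False] key2]) simp_all
    then show ?thesis by (rule in_span_trans) (simp add: b2_in_bT)
  qed
qed


abbreviation (input) "truth j i \<equiv> if j \<in> Cols1 then \<Sum>t<r1. p (c1 t i) * p (\<tau> j t) else \<Sum>t<r2. p (c2 t i) * p (\<tau> j t)"

lemma unique_sequentially:
  assumes "\<And>q. q \<le> r2 \<Longrightarrow> g q \<subseteq> Cols2" "disjoint_family_on g {..r2}" "\<And>q. q \<le> r2 \<Longrightarrow> card (g q) + r2 = n"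
      "\<And>q. q \<le> r2 \<Longrightarrow> hall_surplus r2 \<Omega> (g q)"
    and "\<And>q. q \<le> r1 - k0 \<Longrightarrow> g1 q \<subseteq> Cols1" "disjoint_family_on g1 {..r1 - k0}" "\<And>q. q \<le> r1 - k0 \<Longrightarrow> card (g1 q) + r = n"
      "\<And>q. q \<le> r1 - k0 \<Longrightarrow> hall_surplus r \<Omega> (g1 q)"
    and j: "j \<in> Cols1 \<union> Cols2" "i < n"
  shows "X j i = truth j i"
  by (rule candidate_unique[OF j(1) _ j(2)], rule determined_sequentially[where g = g and ?g1.0 = g1]) (fact assms)+

lemma unique_sequentially_swapped:
  assumes "\<And>q. q \<le> r1 \<Longrightarrow> g q \<subseteq> Cols1" "disjoint_family_on g {..r1}" "\<And>q. q \<le> r1 \<Longrightarrow> card (g q) + r1 = n"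
      "\<And>q. q \<le> r1 \<Longrightarrow> hall_surplus r1 \<Omega> (g q)"
    and "\<And>q. q \<le> r2 - k0 \<Longrightarrow> g1 q \<subseteq> Cols2" "disjoint_family_on g1 {..r2 - k0}" "\<And>q. q \<le> r2 - k0 \<Longrightarrow> card (g1 q) + r = n"
      "\<And>q. q \<le> r2 - k0 \<Longrightarrow> hall_surplus r \<Omega> (g1 q)"
    and j: "j \<in> Cols1 \<union> Cols2" "i < n"
  shows "X j i = truth j i"
proof -
  have j': "j \<in> Cols2 \<union> Cols1" using j(1) by (simp only: Un_commute)
  have "X j i = (if j \<in> Cols2 then \<Sum>t<r2. p (c2 t i) * p (\<tau> j t) else \<Sum>t<r1. p (c1 t i) * p (\<tau> j t))"
    by (rule two_view_candidate.unique_sequentially[OF swap, where g = g and ?g1.0 = g1])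
      (use assms j' in \<open>simp_all only: add.commute\<close>)
  then show ?thesis using j(1) cols(3) by auto
qed

lemma unique_jointly:
  fixes D1 D2 :: "nat + nat \<Rightarrow> nat set"
  assumes "\<And>s. s \<in> {..<k0} <+> {..r1 - k0} \<Longrightarrow> D1 s \<subseteq> Cols1" "disjoint_family_on D1 ({..<k0} <+> {..r1 - k0})"
    and "\<And>s. s \<in> {..<k0} <+> {..r2 - k0} \<Longrightarrow> D2 s \<subseteq> Cols2" "disjoint_family_on D2 ({..<k0} <+> {..r2 - k0})"
    and "\<And>q. q < k0 \<Longrightarrow> card (D1 (Inl q)) + card (D2 (Inl q)) + k0 = n"
      "\<And>q. q \<le> r1 - k0 \<Longrightarrow> card (D1 (Inr q)) + r1 = n" "\<And>q. q \<le> r2 - k0 \<Longrightarrow> card (D2 (Inr q)) + r2 = n"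
    and "\<And>q. q < k0 \<Longrightarrow> hall_surplus k0 \<Omega> (D1 (Inl q) \<union> D2 (Inl q))"
      "\<And>s. s \<in> {..<k0} <+> {..r1 - k0} \<Longrightarrow> hall_surplus r1 \<Omega> (D1 s)"
      "\<And>s. s \<in> {..<k0} <+> {..r2 - k0} \<Longrightarrow> hall_surplus r2 \<Omega> (D2 s)"
    and j: "j \<in> Cols1 \<union> Cols2" "i < n"
  shows "X j i = truth j i"
  by (rule candidate_unique[OF j(1) _ j(2)], rule determined_jointly[where ?D1.0 = D1 and ?D2.0 = D2]) (fact assms)+

end

section \<open>From matrix completions to candidates\<close>

lemma sum_lessThan_add: "(\<Sum>j<m1 + m2. f j) = (\<Sum>j<m1. f j) + (\<Sum>j<m2. f (m1 + j :: nat) :: real)"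
  by (induction m2) simp_all

lemma colspace_views:
  assumes A: "A \<in> carrier_mat n (m1 + m2)"
  shows "colspace (view1 m1 A) \<subseteq> colspace A" "colspace (view2 m1 A) \<subseteq> colspace A"
    "u \<in> colspace A \<Longrightarrow> \<exists>u1\<in>colspace (view1 m1 A). \<exists>u2\<in>colspace (view2 m1 A). \<forall>i<n. u i = u1 i + u2 i"
proof -
  have v1: "colspace (view1 m1 A) = range (\<lambda>c i. if i < n then \<Sum>j<m1. c j * A $$ (i, j) else 0)"
    unfolding colspace_def
  proof (intro arg_cong[where f = range] ext)
    fix c i show "(if i < dim_row (view1 m1 A) then \<Sum>j<dim_col (view1 m1 A). c j * view1 m1 A $$ (i, j) else 0)
      = (if i < n then \<Sum>j<m1. c j * A $$ (i, j) else 0)"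
      using A by (auto simp: view1_def)
  qed
  have v2: "colspace (view2 m1 A) = range (\<lambda>c i. if i < n then \<Sum>j<m2. c j * A $$ (i, m1 + j) else 0)"
    unfolding colspace_def
  proof (intro arg_cong[where f = range] ext)
    fix c i show "(if i < dim_row (view2 m1 A) then \<Sum>j<dim_col (view2 m1 A). c j * view2 m1 A $$ (i, j) else 0)
      = (if i < n then \<Sum>j<m2. c j * A $$ (i, m1 + j) else 0)"
      using A by (auto simp: view2_def)
  qed
  have v: "colspace A = range (\<lambda>c i. if i < n then (\<Sum>j<m1. c j * A $$ (i, j)) + (\<Sum>j<m2. c (m1 + j) * A $$ (i, m1 + j)) else 0)"
    by (simp only: colspace_def carrier_matD[OF A] sum_lessThan_add)
  show "colspace (view1 m1 A) \<subseteq> colspace A"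
  proof
    fix u assume "u \<in> colspace (view1 m1 A)"
    then obtain c where "u = (\<lambda>i. if i < n then \<Sum>j<m1. c j * A $$ (i, j) else 0)" unfolding v1 by (elim rangeE)
    then show "u \<in> colspace A" unfolding v
      by (intro range_eqI[where x = "\<lambda>j. if j < m1 then c j else 0"]) (simp add: fun_eq_iff)
  qed
  show "colspace (view2 m1 A) \<subseteq> colspace A"
  proof
    fix u assume "u \<in> colspace (view2 m1 A)"
    then obtain c where "u = (\<lambda>i. if i < n then \<Sum>j<m2. c j * A $$ (i, m1 + j) else 0)" unfolding v2 by (elim rangeE)
    then show "u \<in> colspace A" unfolding v
      by (intro range_eqI[where x = "\<lambda>j. if j < m1 then 0 else c (j - m1)"]) (simp add: fun_eq_iff)
  qed
  assume "u \<in> colspace A"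
  then obtain c where c: "u = (\<lambda>i. if i < n then (\<Sum>j<m1. c j * A $$ (i, j)) + (\<Sum>j<m2. c (m1 + j) * A $$ (i, m1 + j)) else 0)"
    unfolding v by (elim rangeE)
  show "\<exists>u1\<in>colspace (view1 m1 A). \<exists>u2\<in>colspace (view2 m1 A). \<forall>i<n. u i = u1 i + u2 i"
  proof (intro bexI)
    show "\<forall>i<n. u i = (if i < n then \<Sum>j<m1. c j * A $$ (i, j) else 0) + (if i < n then \<Sum>j<m2. c (m1 + j) * A $$ (i, m1 + j) else 0)"
      by (simp add: c)
    show "(\<lambda>i. if i < n then \<Sum>j<m1. c j * A $$ (i, j) else 0) \<in> colspace (view1 m1 A)"
      unfolding v1 by (rule range_eqI[where x = c]) simp
    show "(\<lambda>i. if i < n then \<Sum>j<m2. c (m1 + j) * A $$ (i, m1 + j) else 0) \<in> colspace (view2 m1 A)"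
      unfolding v2 by (rule range_eqI[where x = "\<lambda>j. c (m1 + j)"]) simp
  qed
qed

text \<open>Follows the tags of \<open>gen_index\<close>: 0 for the common block, and the number
  \<open>t\<close> of the view for its private block.\<close>

definition basis_var :: "nat \<Rightarrow> nat \<Rightarrow> nat \<Rightarrow> nat \<Rightarrow> nat \<times> nat \<times> nat" where
  "basis_var k0 t s i = (if s < k0 then (0, i, s) else (t, i, s - k0))"

definition coeff_var :: "nat \<Rightarrow> nat \<Rightarrow> nat \<Rightarrow> nat \<times> nat \<times> nat" where
  "coeff_var m1 j t = (if j < m1 then (3, t, j) else (4, t, j - m1))"

lemma finite_gen_index: "finite (gen_index n m1 m2 r1 r2 r)"
  unfolding gen_index_def
  by (rule finite_subset[of _ "{..4} \<times> {..n + r1 + r2} \<times> {..r1 + r2 + r + m1 + m2}"]) auto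

lemma gen_U_entry:
  assumes "i < n" "j < m1 + m2"
  shows "gen_U n m1 m2 r1 r2 r p $$ (i, j) =
    (if j < m1 then \<Sum>t<r1. p (basis_var (r1 + r2 - r) 1 t i) * p (coeff_var m1 j t)
     else \<Sum>t<r2. p (basis_var (r1 + r2 - r) 2 t i) * p (coeff_var m1 j t))"
  using assms by (simp add: gen_U_def Let_def basis_var_def coeff_var_def if_distrib if_distribR del: One_nat_def)

text \<open>Every completion fits the abstract setting, with the parameters of tag below 3 as the
  known basis parameters. Genericity is demanded of \<open>p\<close> alone and never of
  \<open>Y\<close>.\<close>

lemma completion_two_view_candidate:
  assumes r: "r1 \<le> r" "r2 \<le> r" "r \<le> n" "r \<le> r1 + r2"
    and p: "alg_indep (gen_index n m1 m2 r1 r2 r) p"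
    and \<Omega>: "\<And>j. j < m1 + m2 \<Longrightarrow> \<Omega> j \<subseteq> {..<n}" "\<And>j. j < m1 + m2 \<Longrightarrow> r \<le> card (\<Omega> j)"
    and Y: "Y \<in> completions m1 r1 r2 r (gen_U n m1 m2 r1 r2 r p) \<Omega>"
  shows "two_view_candidate n (r1 + r2 - r) r1 r2 (gen_index n m1 m2 r1 r2 r) {x \<in> gen_index n m1 m2 r1 r2 r. fst x < 3} p
    (basis_var (r1 + r2 - r) 1) (basis_var (r1 + r2 - r) 2) (coeff_var m1) {..<m1} {m1..<m1 + m2} \<Omega>
    (\<lambda>j i. if i < n then Y $$ (i, j) else 0) (colspace (view1 m1 Y)) (colspace (view2 m1 Y)) (colspace Y)"
proof -
  define k0 where "k0 = r1 + r2 - r"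
  have k0: "r1 + r2 - k0 = r" "k0 \<le> r1" "k0 \<le> r2" "r1 - k0 = r - r2" "r2 - k0 = r - r1" using r by (auto simp: k0_def)
  have dim: "dim_row (gen_U n m1 m2 r1 r2 r p) = n" "dim_col (gen_U n m1 m2 r1 r2 r p) = m1 + m2"
    by (simp_all add: gen_U_def Let_def)
  have carr: "Y \<in> carrier_mat n (m1 + m2)" "view1 m1 Y \<in> carrier_mat n m1" "view2 m1 Y \<in> carrier_mat n m2"
    using Y by (auto simp: completions_def dim view1_def view2_def)
  have obs: "Y $$ (i, j) = gen_U n m1 m2 r1 r2 r p $$ (i, j)" if "j < m1 + m2" "i \<in> \<Omega> j" for i j
    using Y \<Omega>(1)[OF that(1)] that by (auto simp: completions_def dim)
  have rk: "mrank (view1 m1 Y) = r1" "mrank (view2 m1 Y) = r2" "mrank Y = r" using Y by (auto simp: completions_def)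
  have agr: "(if i < n then Y $$ (i, j) else 0) = (if j < m1 then \<Sum>t<r1. p (basis_var k0 1 t i) * p (coeff_var m1 j t)
     else \<Sum>t<r2. p (basis_var k0 2 t i) * p (coeff_var m1 j t))" if "j < m1 + m2" "i \<in> \<Omega> j" for i j
  proof -
    have "i < n" using \<Omega>(1)[OF that(1)] that(2) by auto
    then show ?thesis using obs[OF that] gen_U_entry[of i n j m1 m2] that(1) by (simp add: k0_def)
  qed
  have col1: "(\<lambda>i. if i < n then Y $$ (i, j) else 0) \<in> colspace (view1 m1 Y)" if "j < m1" for j
  proof -
    have "(\<lambda>i. if i < n then Y $$ (i, j) else 0) = (\<lambda>i. if i < dim_row (view1 m1 Y) then view1 m1 Y $$ (i, j) else 0)"
      using carr that by (auto simp: view1_def fun_eq_iff)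
    then show ?thesis using column_in_colspace[of j "view1 m1 Y"] carr(2) that by simp
  qed
  have col2: "(\<lambda>i. if i < n then Y $$ (i, j) else 0) \<in> colspace (view2 m1 Y)" if "m1 \<le> j" "j < m1 + m2" for j
  proof -
    have "(\<lambda>i. if i < n then Y $$ (i, j) else 0) = (\<lambda>i. if i < dim_row (view2 m1 Y) then view2 m1 Y $$ (i, j - m1) else 0)"
      using carr that by (auto simp: view2_def fun_eq_iff)
    moreover have "j - m1 < dim_col (view2 m1 Y)" using carr(3) that by auto
    ultimately show ?thesis using column_in_colspace[of "j - m1" "view2 m1 Y"] by simp
  qed
  show ?thesis
    unfolding k0_def[symmetric]
  proof (rule two_view_candidate.intro)
    show "card P = r1" if "delta_basis {..<n} (colspace (view1 m1 Y)) P v" for P v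
      using mrank_eq_card_delta_basis[OF carr(2) that] rk by simp
    show "card P = r2" if "delta_basis {..<n} (colspace (view2 m1 Y)) P v" for P v
      using mrank_eq_card_delta_basis[OF carr(3) that] rk by simp
    show "card P = r1 + r2 - k0" if "delta_basis {..<n} (colspace Y) P v" for P v
      using mrank_eq_card_delta_basis[OF carr(1) that] rk k0(1) by simp
    show "u i = 0" if "u \<in> colspace Y" "n \<le> i" for u i using colspace_outside[OF that(1)] that(2) carr(1) by simp
    show "j = j' \<and> t = t'" if "coeff_var m1 j t = coeff_var m1 j' t'" for j t j' t'
      using that by (auto simp: coeff_var_def split: if_splits)
    show "(if i < n then Y $$ (i, j) else 0) = (\<Sum>t<r1. p (basis_var k0 1 t i) * p (coeff_var m1 j t))"
      if "j \<in> {..<m1}" "i \<in> \<Omega> j" for j i using agr[of j i] that by simp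
    show "(if i < n then Y $$ (i, j) else 0) = (\<Sum>t<r2. p (basis_var k0 2 t i) * p (coeff_var m1 j t))"
      if "j \<in> {m1..<m1 + m2}" "i \<in> \<Omega> j" for j i using agr[of j i] that by simp
    show "coeff_var m1 j t \<in> gen_index n m1 m2 r1 r2 r - {x \<in> gen_index n m1 m2 r1 r2 r. fst x < 3}"
      if "j \<in> {..<m1}" "t < r1" for j t using that by (auto simp: coeff_var_def gen_index_def)
    show "coeff_var m1 j t \<in> gen_index n m1 m2 r1 r2 r - {x \<in> gen_index n m1 m2 r1 r2 r. fst x < 3}"
      if "j \<in> {m1..<m1 + m2}" "t < r2" for j t using that by (auto simp: coeff_var_def gen_index_def)
    show "basis_var k0 1 s i \<in> {x \<in> gen_index n m1 m2 r1 r2 r. fst x < 3}" if "s < r1" "i < n" for s i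
      using that k0 by (auto simp: basis_var_def gen_index_def k0_def)
    show "basis_var k0 2 s i \<in> {x \<in> gen_index n m1 m2 r1 r2 r. fst x < 3}" if "s < r2" "i < n" for s i
      using that k0 by (auto simp: basis_var_def gen_index_def k0_def)
    show "s = s' \<and> i = i'" if "basis_var k0 1 s i = basis_var k0 1 s' i'" for s i s' i'
      using that by (auto simp: basis_var_def split: if_splits)
    show "s = s' \<and> i = i'" if "basis_var k0 2 s i = basis_var k0 2 s' i'" for s i s' i'
      using that by (auto simp: basis_var_def split: if_splits)
    show "s = s' \<and> i = i' \<and> s < k0" if "basis_var k0 1 s i = basis_var k0 2 s' i'" for s i s' i'
      using that by (auto simp: basis_var_def split: if_splits)
    show "\<Omega> j \<subseteq> {..<n}" "r1 + r2 - k0 \<le> card (\<Omega> j)" if "j \<in> {..<m1} \<union> {m1..<m1 + m2}" for j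
    proof -
      have "j < m1 + m2" using that by auto
      then show "\<Omega> j \<subseteq> {..<n}" "r1 + r2 - k0 \<le> card (\<Omega> j)" using \<Omega>[of j] k0(1) by auto
    qed
    show "(\<lambda>i. if i < n then Y $$ (i, j) else 0) \<in> colspace (view1 m1 Y)" if "j \<in> {..<m1}" for j
      using col1 that by simp
    show "(\<lambda>i. if i < n then Y $$ (i, j) else 0) \<in> colspace (view2 m1 Y)" if "j \<in> {m1..<m1 + m2}" for j
      using col2 that by simp
  qed (use p k0 r finite_gen_index colspace_views[OF carr(1)] lin_subspace_colspace in \<open>simp_all add: basis_var_def disjoint_iff\<close>)
qed

section \<open>Column groups and the union bound\<close>

lemma disjoint_subsets_of_sizes:
  fixes s :: "'q \<Rightarrow> nat"
  assumes "finite J" "finite A" "(\<Sum>q\<in>J. s q) \<le> card A"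
  shows "\<exists>g. (\<forall>q\<in>J. g q \<subseteq> A \<and> card (g q) = s q) \<and> disjoint_family_on g J"
  using assms(1,3)
proof (induction J)
  case empty
  then show ?case by (simp add: disjoint_family_on_def)
next
  case (insert q J)
  then obtain g where g: "\<forall>q\<in>J. g q \<subseteq> A \<and> card (g q) = s q" "disjoint_family_on g J" by auto
  define B where "B = (\<Union>q\<in>J. g q)"
  have B: "B \<subseteq> A" using g(1) by (auto simp: B_def)
  have "card B \<le> (\<Sum>q\<in>J. card (g q))" unfolding B_def using insert(1) by (rule card_UN_le)
  also have "\<dots> = (\<Sum>q\<in>J. s q)" using g(1) by (intro sum.cong) auto
  finally have "s q \<le> card (A - B)"
    using insert(1,2,4) B assms(2) by (simp add: card_Diff_subset finite_subset)
  then obtain T where T: "T \<subseteq> A - B" "card T = s q" by (meson obtain_subset_with_card_n)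
  have "disjoint_family_on (g(q := T)) (insert q J)"
    unfolding disjoint_family_on_def
  proof (intro ballI impI)
    fix m m' assume m: "m \<in> insert q J" "m' \<in> insert q J" "m \<noteq> m'"
    show "(g(q := T)) m \<inter> (g(q := T)) m' = {}"
    proof (cases "m = q \<or> m' = q")
      case True
      then show ?thesis using m T(1) by (auto simp: B_def)
    next
      case False
      then show ?thesis using m disjoint_family_onD[OF g(2)] by simp
    qed
  qed
  moreover have "\<forall>q'\<in>insert q J. (g(q := T)) q' \<subseteq> A \<and> card ((g(q := T)) q') = s q'" using g(1) T by auto
  ultimately show ?case by blast
qed

text \<open>Greedy choice: the last part is as large as \<open>b\<close> allows while leaving at
  least \<open>k * a\<close> for the others.\<close>

lemma bounded_composition:
  fixes a b x :: nat
  assumes "k * a \<le> x" "x \<le> k * b"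
  shows "\<exists>f. (\<forall>q<k. a \<le> f q \<and> f q \<le> b) \<and> (\<Sum>q<k. f q) = x"
  using assms
proof (induction k arbitrary: x)
  case (Suc k)
  define t where "t = min b (x - k * a)"
  have "(Suc k) * a \<le> (Suc k) * b" using Suc.prems by linarith
  then have ab: "a \<le> b" by (simp only: mult_le_cancel1)
  have "k * a \<le> k * b" using ab by simp
  then have t: "a \<le> t" "t \<le> b" "t \<le> x" "k * a \<le> x - t" using Suc.prems ab by (auto simp: t_def)
  have t5: "x - t \<le> k * b"
    using Suc.prems \<open>k * a \<le> k * b\<close> by (cases "b \<le> x - k * a") (simp_all add: t_def min_def del: mult_le_cancel1 mult_le_mono2)
  from Suc.IH[OF t(4) t5] obtain f where f: "\<forall>q<k. a \<le> f q \<and> f q \<le> b" "(\<Sum>q<k. f q) = x - t" by blast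
  then show ?case using t(1-3) by (intro exI[of _ "f(k := t)"]) (auto simp: less_Suc_eq)
qed simp

text \<open>Mixed group \<open>q\<close> takes \<open>f q\<close> columns from the first view and
  \<open>n - k0 - f q\<close> from the second. The bounds on \<open>f q\<close> keep these shares
  below \<open>n - r1\<close> and \<open>n - r2\<close>, leaving room for surplus \<open>r1\<close>
  and \<open>r2\<close>. Enough columns of the first view remain for the lower bound because the
  second view is too narrow to be found alone.\<close>

lemma mixed_group_sizes:
  fixes n m1 m2 r1 r2 k0 :: nat
  assumes k0: "k0 \<le> r1" "k0 \<le> r2" "r1 + r2 - k0 \<le> n"
    and m: "(r1 - k0 + 1) * (n - r1) \<le> m1" "(r2 - k0 + 1) * (n - r2) \<le> m2"
      "(r1 - k0 + 1) * (n - r1) + (r2 - k0 + 1) * (n - r2) + k0 * (n - k0) \<le> m1 + m2"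
    and small: "m1 < (r1 + 1) * (n - r1)" "m2 < (r2 + 1) * (n - r2)"
  shows "\<exists>f. (\<forall>q<k0. r2 - k0 \<le> f q \<and> f q \<le> n - r1)
    \<and> (\<Sum>q<k0. f q) + (r1 - k0 + 1) * (n - r1) \<le> m1
    \<and> (\<Sum>q<k0. n - k0 - f q) + (r2 - k0 + 1) * (n - r2) \<le> m2"
proof -
  \<comment> \<open>\<open>x\<close> and \<open>y\<close> are the numbers of columns left over by
    the groups inside a single view.\<close>
  define x where "x = m1 - (r1 - k0 + 1) * (n - r1)"
  define y where "y = m2 - (r2 - k0 + 1) * (n - r2)"
  have x: "m1 = (r1 - k0 + 1) * (n - r1) + x" and y: "m2 = (r2 - k0 + 1) * (n - r2) + y"
    using m by (simp_all add: x_def y_def)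
  have "r1 + 1 = (r1 - k0 + 1) + k0" "r2 + 1 = (r2 - k0 + 1) + k0" using k0 by simp_all
  then have xs: "x < k0 * (n - r1)" and ys: "y < k0 * (n - r2)"
    using small unfolding x y by (simp_all only: add_mult_distrib nat_add_left_cancel_less)
  have xy: "k0 * (n - k0) \<le> x + y" using m(3) unfolding x y by linarith
  have "n - k0 = (r2 - k0) + (n - r2)" using k0 by simp
  then have "k0 * (n - k0) = k0 * (r2 - k0) + k0 * (n - r2)" by (simp only: add_mult_distrib2)
  then have "k0 * (r2 - k0) \<le> x" using xy ys by linarith
  then obtain f where f: "\<forall>q<k0. r2 - k0 \<le> f q \<and> f q \<le> n - r1" "(\<Sum>q<k0. f q) = x"
    using bounded_composition[of k0 "r2 - k0" x "n - r1"] xs by auto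
  have "(\<Sum>q<k0. n - k0 - f q) + (\<Sum>q<k0. f q) = (\<Sum>q<k0. n - k0)"
    unfolding sum.distrib[symmetric]
  proof (intro sum.cong refl)
    fix q assume "q \<in> {..<k0}"
    then have "f q \<le> n - r1" using f(1) by simp
    then show "n - k0 - f q + f q = n - k0" using k0 by simp
  qed
  then have "(\<Sum>q<k0. n - k0 - f q) + x = k0 * (n - k0)" using f(2) by simp
  then have "(\<Sum>q<k0. n - k0 - f q) \<le> y" using xy by linarith
  then show ?thesis using f x y by (intro exI[of _ f]) simp
qed

text \<open>Union bound over at most \<open>24 * \<mu>\<close> required conditions, each failing
  with probability at most \<open>\<epsilon> / (24 * \<mu>)\<close>.\<close>

lemma prob_all_hall_surplus:
  fixes n m l :: nat and k :: "nat \<Rightarrow> nat" and \<epsilon> \<mu> :: real and S :: "(nat \<times> nat set) set"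
  assumes S: "finite S" "real (card S) \<le> 24 * \<mu>"
      "\<And>\<rho> G. (\<rho>, G) \<in> S \<Longrightarrow> G \<subseteq> {..<m} \<and> card G + \<rho> \<le> n \<and> \<rho> + 1 \<le> l \<and> 3 * \<rho> \<le> n"
    and k: "\<And>j. j < m \<Longrightarrow> l \<le> k j \<and> k j \<le> n"
    and l: "real l > 9 * ln (real n / \<epsilon>) + 3 * ln (6 * \<mu> / \<epsilon>) + 6"
    and \<epsilon>: "0 < \<epsilon>" "\<epsilon> < 1" and \<mu>: "1 \<le> \<mu>"
    and Q: "\<And>\<Omega>. \<Omega> \<in> set_pmf (sampling n m k) \<Longrightarrow> (\<And>\<rho> G. (\<rho>, G) \<in> S \<Longrightarrow> hall_surplus \<rho> \<Omega> G) \<Longrightarrow> Q \<Omega>"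
  shows "1 - \<epsilon> \<le> measure_pmf.prob (sampling n m k) {\<Omega>. Q \<Omega>}"
proof -
  let ?M = "sampling n m k"
  have "\<exists>s\<in>S. \<not> hall_surplus (fst s) \<Omega> (snd s)" if "\<Omega> \<in> set_pmf ?M" "\<not> Q \<Omega>" for \<Omega>
    using Q[OF that(1)] that(2) by force
  then have "measure_pmf.prob ?M {\<Omega>. \<not> Q \<Omega>} \<le> measure_pmf.prob ?M (\<Union>s\<in>S. {\<Omega>. \<not> hall_surplus (fst s) \<Omega> (snd s)})"
    by (intro measure_pmf.finite_measure_mono_AE) (auto simp: AE_measure_pmf_iff)
  also have "\<dots> \<le> (\<Sum>s\<in>S. measure_pmf.prob ?M {\<Omega>. \<not> hall_surplus (fst s) \<Omega> (snd s)})"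
    by (rule measure_pmf.finite_measure_subadditive_finite[OF S(1)]) simp
  also have "\<dots> \<le> (\<Sum>s\<in>S. \<epsilon> / (24 * \<mu>))"
  proof (rule sum_mono)
    fix s assume "s \<in> S"
    then have s: "snd s \<subseteq> {..<m}" "card (snd s) + fst s \<le> n" "fst s + 1 \<le> l" "3 * fst s \<le> n"
      using S(3)[of "fst s" "snd s"] by simp_all
    show "measure_pmf.prob ?M {\<Omega>. \<not> hall_surplus (fst s) \<Omega> (snd s)} \<le> \<epsilon> / (24 * \<mu>)"
      by (rule prob_hall_surplus_fails[OF s(1,2) k s(3) l s(4) \<epsilon> \<mu>])
  qed
  also have "\<dots> = real (card S) * \<epsilon> / (24 * \<mu>)" by simp
  also have "\<dots> \<le> 24 * \<mu> * \<epsilon> / (24 * \<mu>)"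
    using S(2) \<epsilon> \<mu> by (intro divide_right_mono mult_right_mono) simp_all
  also have "\<dots> = \<epsilon>" using \<mu> by simp
  finally have "measure_pmf.prob ?M {\<Omega>. \<not> Q \<Omega>} \<le> \<epsilon>" .
  moreover have "measure_pmf.prob ?M {\<Omega>. \<not> Q \<Omega>} = 1 - measure_pmf.prob ?M {\<Omega>. Q \<Omega>}"
    using measure_pmf.prob_compl[of "{\<Omega>. Q \<Omega>}" ?M] by (simp add: Compl_eq_Diff_UNIV[symmetric] Collect_neg_eq)
  ultimately show ?thesis by simp
qed

text \<open>The rank hypotheses make the matrix a completion of itself, so existence is settled and
  \<open>eq\<close> gives uniqueness entry by entry.\<close>

lemma unique_completionI:
  assumes r: "r1 \<le> r" "r2 \<le> r" "r \<le> n" "r \<le> r1 + r2"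
    and rank: "mrank (view1 m1 (gen_U n m1 m2 r1 r2 r p)) = r1" "mrank (view2 m1 (gen_U n m1 m2 r1 r2 r p)) = r2"
      "mrank (gen_U n m1 m2 r1 r2 r p) = r"
    and eq: "\<And>Y j i. Y \<in> completions m1 r1 r2 r (gen_U n m1 m2 r1 r2 r p) \<Omega> \<Longrightarrow> j \<in> {..<m1} \<union> {m1..<m1 + m2} \<Longrightarrow> i < n \<Longrightarrow>
      (if i < n then Y $$ (i, j) else 0) =
      (if j \<in> {..<m1} then \<Sum>t<r1. p (basis_var (r1 + r2 - r) 1 t i) * p (coeff_var m1 j t)
       else \<Sum>t<r2. p (basis_var (r1 + r2 - r) 2 t i) * p (coeff_var m1 j t))"
  shows "has_unique_completion m1 r1 r2 r (gen_U n m1 m2 r1 r2 r p) \<Omega>"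
proof -
  let ?U = "gen_U n m1 m2 r1 r2 r p"
  have dim: "dim_row ?U = n" "dim_col ?U = m1 + m2" by (simp_all add: gen_U_def Let_def)
  have "?U \<in> completions m1 r1 r2 r ?U \<Omega>" using rank by (auto simp: completions_def)
  moreover have "Y = ?U" if Y: "Y \<in> completions m1 r1 r2 r ?U \<Omega>" for Y
  proof (rule eq_matI)
    fix i j assume ij: "i < dim_row ?U" "j < dim_col ?U"
    then have ij': "i < n" "j < m1 + m2" by (simp_all add: dim)
    then have "j \<in> {..<m1} \<union> {m1..<m1 + m2}" by auto
    from eq[OF Y this ij'(1)] show "Y $$ (i, j) = ?U $$ (i, j)" using ij' gen_U_entry[OF ij'] by simp
  qed (use Y in \<open>auto simp: completions_def\<close>)
  ultimately show ?thesis unfolding has_unique_completion_def by blast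
qed

theorem theorem5:
  fixes n m1 m2 r r1 r2 l :: nat and \<epsilon> :: real and k :: "nat \<Rightarrow> nat"
  assumes "1 \<le> r1" and "1 \<le> r2" and "r1 \<le> r" and "r2 \<le> r"
    and "r \<le> n" and "r \<le> r1 + r2"
    and "0 < \<epsilon>" and "\<epsilon> < 1"
    and "real n / 6 \<ge> real (max r1 (max r2 (r1 + r2 - r)))"
    and "m1 \<ge> ((r - r2) + 1) * (n - r1)"
    and "m2 \<ge> ((r - r1) + 1) * (n - r2)"
    and "m1 + m2 \<ge> ((r - r2) + 1) * (n - r1) + ((r - r1) + 1) * (n - r2)
                    + (r1 + r2 - r) * (n - (r1 + r2 - r))"
    and "real l > max (9 * ln (real n / \<epsilon>)
                       + 3 * max (ln (6 * real (r - r2) / \<epsilon>))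
                                 (max (ln (6 * real (r - r1) / \<epsilon>))
                                      (ln (6 * real (r1 + r2 - r) / \<epsilon>)))
                       + 6)
                      (max (2 * real r1) (2 * real r2))"
    and "\<forall>j < m1 + m2. l \<le> k j \<and> k j \<le> n"
  shows "\<exists>N \<in> null_sets (gen_param_space n m1 m2 r1 r2 r).
           \<forall>p \<in> space (gen_param_space n m1 m2 r1 r2 r) - N.
             (let U = gen_U n m1 m2 r1 r2 r p in
               mrank (view1 m1 U) = r1 \<and> mrank (view2 m1 U) = r2 \<and> mrank U = r \<longrightarrow>
               measure_pmf.prob (sampling n (m1 + m2) k)
                 {\<Omega>. has_unique_completion m1 r1 r2 r U \<Omega>} \<ge> 1 - \<epsilon>)"
proof -
  define k0 where "k0 = r1 + r2 - r"
  have r: "r = r1 + r2 - k0" "r - r2 = r1 - k0" "r - r1 = r2 - k0" "k0 \<le> r1" "k0 \<le> r2" "r1 + r2 - k0 \<le> n"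
    using assms(3-6) by (auto simp: k0_def)
  \<comment> \<open>Being one of the three arguments, \<open>\<mu>\<close> is covered by the maximum
    of logarithms in the bound on \<open>l\<close>, whatever \<open>ln\<close> yields for an
    argument 0.\<close>
  define \<mu> where "\<mu> = real (max (r1 - k0) (max (r2 - k0) k0))"
  have \<mu>_ge: "real r1 - real k0 \<le> \<mu>" "real r2 - real k0 \<le> \<mu>" "real k0 \<le> \<mu>" using r(4,5) by (auto simp: \<mu>_def)
  \<comment> \<open>\<open>r1 = k0 + (r1 - k0)\<close> is positive, hence one of the summands
    is.\<close>
  have \<mu>: "1 \<le> \<mu>" using assms(1) r(4) by (auto simp: \<mu>_def)
  have "ln (6 * \<mu> / \<epsilon>) \<le> max (ln (6 * real (r1 - k0) / \<epsilon>)) (max (ln (6 * real (r2 - k0) / \<epsilon>)) (ln (6 * real k0 / \<epsilon>)))"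
  proof -
    have "\<mu> = real (r1 - k0) \<or> \<mu> = real (r2 - k0) \<or> \<mu> = real k0" unfolding \<mu>_def max_def by (simp split: if_split)
    then show ?thesis by (elim disjE) simp_all
  qed
  then have l: "real l > 9 * ln (real n / \<epsilon>) + 3 * ln (6 * \<mu> / \<epsilon>) + 6" "2 * r1 < l" "2 * r2 < l"
    using assms(13) unfolding k0_def[symmetric] r(2,3) max_less_iff_conj by simp_all
  have n: "6 * r1 \<le> n" "6 * r2 \<le> n" using assms(9) by auto
  \<comment> \<open>The bounds \<open>2 * r1, 2 * r2 < l\<close> and
    \<open>6 * r1, 6 * r2 \<le> n\<close> are averaged to control \<open>r1 + r2\<close>, and with
    it the largest surplus \<open>r\<close>.\<close>
  have small: "\<rho> + 1 \<le> l \<and> 3 * \<rho> \<le> n" if "\<rho> \<le> r1 + r2 - k0" for \<rho>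
  proof -
    have "\<rho> \<le> r1 + r2" using that by simp
    then show ?thesis using l(2,3) n by linarith
  qed
  let ?I = "gen_index n m1 m2 r1 r2 r"
  let ?cand = "\<lambda>p \<Omega> Y. two_view_candidate n k0 r1 r2 ?I {x \<in> ?I. fst x < 3} p (basis_var k0 1) (basis_var k0 2) (coeff_var m1)
     {..<m1} {m1..<m1 + m2} \<Omega> (\<lambda>j i. if i < n then Y $$ (i, j) else 0) (colspace (view1 m1 Y)) (colspace (view2 m1 Y)) (colspace Y)"
  \<comment> \<open>Common conclusion of the three cases: it suffices to exhibit a small set
    \<open>S\<close> of Hall conditions that forces every candidate to be the true matrix.\<close>
  have finish: "1 - \<epsilon> \<le> measure_pmf.prob (sampling n (m1 + m2) k)
      {\<Omega>. has_unique_completion m1 r1 r2 r (gen_U n m1 m2 r1 r2 r p) \<Omega>}"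
    if p: "alg_indep ?I p" and rank: "mrank (view1 m1 (gen_U n m1 m2 r1 r2 r p)) = r1"
        "mrank (view2 m1 (gen_U n m1 m2 r1 r2 r p)) = r2" "mrank (gen_U n m1 m2 r1 r2 r p) = r"
      and S: "finite S" "real (card S) \<le> 24 * \<mu>"
        "\<And>\<rho> G. (\<rho>, G) \<in> S \<Longrightarrow> G \<subseteq> {..<m1 + m2} \<and> card G + \<rho> \<le> n \<and> \<rho> \<le> r1 + r2 - k0"
      and uniq: "\<And>\<Omega> Y j i. ?cand p \<Omega> Y \<Longrightarrow> (\<And>\<rho> G. (\<rho>, G) \<in> S \<Longrightarrow> hall_surplus \<rho> \<Omega> G) \<Longrightarrow>
        j \<in> {..<m1} \<union> {m1..<m1 + m2} \<Longrightarrow> i < n \<Longrightarrow> (if i < n then Y $$ (i, j) else 0) =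
        (if j \<in> {..<m1} then \<Sum>t<r1. p (basis_var k0 1 t i) * p (coeff_var m1 j t)
         else \<Sum>t<r2. p (basis_var k0 2 t i) * p (coeff_var m1 j t))" for p S
  proof (rule prob_all_hall_surplus[OF S(1,2) _ _ l(1) assms(7,8) \<mu>])
    show "G \<subseteq> {..<m1 + m2} \<and> card G + \<rho> \<le> n \<and> \<rho> + 1 \<le> l \<and> 3 * \<rho> \<le> n" if "(\<rho>, G) \<in> S" for \<rho> G
      using S(3)[OF that] small by simp
    show kj: "l \<le> k j \<and> k j \<le> n" if "j < m1 + m2" for j using assms(14) that by simp
    fix \<Omega> assume \<Omega>: "\<Omega> \<in> set_pmf (sampling n (m1 + m2) k)" and hall: "\<And>\<rho> G. (\<rho>, G) \<in> S \<Longrightarrow> hall_surplus \<rho> \<Omega> G"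
    have sub: "\<Omega> j \<subseteq> {..<n}" and crd: "r \<le> card (\<Omega> j)" if "j < m1 + m2" for j
      using set_pmf_sampling[OF \<Omega> _ that] kj kj[OF that] small[OF order_refl] r(1) by auto
    show "has_unique_completion m1 r1 r2 r (gen_U n m1 m2 r1 r2 r p) \<Omega>"
    proof (rule unique_completionI[OF assms(3-6) rank])
      fix Y j i
      assume Y: "Y \<in> completions m1 r1 r2 r (gen_U n m1 m2 r1 r2 r p) \<Omega>" and j: "j \<in> {..<m1} \<union> {m1..<m1 + m2}" and i: "i < n"
      have c: "?cand p \<Omega> Y"
        using completion_two_view_candidate[OF assms(3-6) p sub crd Y] by (simp only: k0_def[symmetric])
      show "(if i < n then Y $$ (i, j) else 0) =
        (if j \<in> {..<m1} then \<Sum>t<r1. p (basis_var (r1 + r2 - r) 1 t i) * p (coeff_var m1 j t)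
         else \<Sum>t<r2. p (basis_var (r1 + r2 - r) 2 t i) * p (coeff_var m1 j t))"
        unfolding k0_def[symmetric] by (rule uniq[OF c hall j i])
    qed
  qed
  have main: "1 - \<epsilon> \<le> measure_pmf.prob (sampling n (m1 + m2) k)
      {\<Omega>. has_unique_completion m1 r1 r2 r (gen_U n m1 m2 r1 r2 r p) \<Omega>}"
    if p: "alg_indep ?I p" and rank: "mrank (view1 m1 (gen_U n m1 m2 r1 r2 r p)) = r1"
        "mrank (view2 m1 (gen_U n m1 m2 r1 r2 r p)) = r2" "mrank (gen_U n m1 m2 r1 r2 r p) = r" for p
  proof -
    have m: "(r1 - k0 + 1) * (n - r1) \<le> m1" "(r2 - k0 + 1) * (n - r2) \<le> m2"
      using assms(10,11) r(2,3) by simp_all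
    have m': "(r1 - k0 + 1) * (n - (r1 + r2 - k0)) \<le> m1" "(r2 - k0 + 1) * (n - (r1 + r2 - k0)) \<le> m2"
    proof -
      have "n - (r1 + r2 - k0) \<le> n - r1" "n - (r1 + r2 - k0) \<le> n - r2" using r(4-6) by simp_all
      then show "(r1 - k0 + 1) * (n - (r1 + r2 - k0)) \<le> m1" "(r2 - k0 + 1) * (n - (r1 + r2 - k0)) \<le> m2"
        using order_trans[OF mult_le_mono2 m(1)] order_trans[OF mult_le_mono2 m(2)] by blast+
    qed
    \<comment> \<open>Either one view is wide enough to be found by itself, or both fall short and
      the bound on \<open>m1 + m2\<close> provides the mixed groups.\<close>
    consider (seq) "(r2 + 1) * (n - r2) \<le> m2" | (seq_swapped) "(r1 + 1) * (n - r1) \<le> m1"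
      | (joint) "m1 < (r1 + 1) * (n - r1)" "m2 < (r2 + 1) * (n - r2)" by linarith
    then show ?thesis
    proof cases
      case seq
      have "\<exists>g. (\<forall>q\<in>{..r2}. g q \<subseteq> {m1..<m1 + m2} \<and> card (g q) = n - r2) \<and> disjoint_family_on g {..r2}"
        by (rule disjoint_subsets_of_sizes) (use seq in simp_all)
      then obtain g where g: "\<forall>q\<in>{..r2}. g q \<subseteq> {m1..<m1 + m2} \<and> card (g q) = n - r2" "disjoint_family_on g {..r2}" by (elim exE conjE)
      have "\<exists>g1. (\<forall>q\<in>{..r1 - k0}. g1 q \<subseteq> {..<m1} \<and> card (g1 q) = n - (r1 + r2 - k0)) \<and> disjoint_family_on g1 {..r1 - k0}"
        by (rule disjoint_subsets_of_sizes) (use m'(1) in simp_all)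
      then obtain g1 where g1: "\<forall>q\<in>{..r1 - k0}. g1 q \<subseteq> {..<m1} \<and> card (g1 q) = n - (r1 + r2 - k0)" "disjoint_family_on g1 {..r1 - k0}" by (elim exE conjE)
      let ?S = "(\<lambda>q. (r2, g q)) ` {..r2} \<union> (\<lambda>q. (r1 + r2 - k0, g1 q)) ` {..r1 - k0}"
      \<comment> \<open>As \<open>r2 = (r2 - k0) + k0 \<le> 2 * \<mu>\<close> and
        \<open>1 \<le> \<mu>\<close>, at most \<open>5 * \<mu>\<close> conditions are
        imposed.\<close>
      have "card ?S \<le> (r2 + 1) + (r1 - k0 + 1)"
        by (rule order_trans[OF card_Un_le] add_mono)+ (use card_image_le[of "{..r2}"] card_image_le[of "{..r1 - k0}"] in simp_all)
      then have crd: "real (card ?S) \<le> 24 * \<mu>" using \<mu> \<mu>_ge r(4) by linarith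
      show ?thesis
      proof (rule finish[OF p rank _ crd])
        show "G \<subseteq> {..<m1 + m2} \<and> card G + \<rho> \<le> n \<and> \<rho> \<le> r1 + r2 - k0" if "(\<rho>, G) \<in> ?S" for \<rho> G
          using that
        proof
          assume "(\<rho>, G) \<in> (\<lambda>q. (r2, g q)) ` {..r2}"
          then show ?thesis using g(1) r(4,6) n by fastforce
        next
          assume "(\<rho>, G) \<in> (\<lambda>q. (r1 + r2 - k0, g1 q)) ` {..r1 - k0}"
          then show ?thesis using g1(1) r(6) by fastforce
        qed
        show "(if i < n then Y $$ (i, j) else 0) = (if j \<in> {..<m1} then \<Sum>t<r1. p (basis_var k0 1 t i) * p (coeff_var m1 j t)
            else \<Sum>t<r2. p (basis_var k0 2 t i) * p (coeff_var m1 j t))"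
          if "?cand p \<Omega> Y" "\<And>\<rho> G. (\<rho>, G) \<in> ?S \<Longrightarrow> hall_surplus \<rho> \<Omega> G" "j \<in> {..<m1} \<union> {m1..<m1 + m2}" "i < n" for \<Omega> Y j i
          by (rule two_view_candidate.unique_sequentially[OF that(1) _ g(2) _ _ _ g1(2) _ _ that(3,4)])
            (use g(1) g1(1) r(6) n that(2) in auto)
      qed simp
    next
      case seq_swapped
      have "\<exists>g. (\<forall>q\<in>{..r1}. g q \<subseteq> {..<m1} \<and> card (g q) = n - r1) \<and> disjoint_family_on g {..r1}"
        by (rule disjoint_subsets_of_sizes) (use seq_swapped in simp_all)
      then obtain g where g: "\<forall>q\<in>{..r1}. g q \<subseteq> {..<m1} \<and> card (g q) = n - r1" "disjoint_family_on g {..r1}" by (elim exE conjE)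
      have "\<exists>g1. (\<forall>q\<in>{..r2 - k0}. g1 q \<subseteq> {m1..<m1 + m2} \<and> card (g1 q) = n - (r1 + r2 - k0)) \<and> disjoint_family_on g1 {..r2 - k0}"
        by (rule disjoint_subsets_of_sizes) (use m'(2) in simp_all)
      then obtain g1 where g1: "\<forall>q\<in>{..r2 - k0}. g1 q \<subseteq> {m1..<m1 + m2} \<and> card (g1 q) = n - (r1 + r2 - k0)" "disjoint_family_on g1 {..r2 - k0}" by (elim exE conjE)
      let ?S = "(\<lambda>q. (r1, g q)) ` {..r1} \<union> (\<lambda>q. (r1 + r2 - k0, g1 q)) ` {..r2 - k0}"
      have "card ?S \<le> (r1 + 1) + (r2 - k0 + 1)"
        by (rule order_trans[OF card_Un_le] add_mono)+ (use card_image_le[of "{..r1}"] card_image_le[of "{..r2 - k0}"] in simp_all)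
      then have crd: "real (card ?S) \<le> 24 * \<mu>" using \<mu> \<mu>_ge r(5) by linarith
      show ?thesis
      proof (rule finish[OF p rank _ crd])
        show "G \<subseteq> {..<m1 + m2} \<and> card G + \<rho> \<le> n \<and> \<rho> \<le> r1 + r2 - k0" if "(\<rho>, G) \<in> ?S" for \<rho> G
          using that
        proof
          assume "(\<rho>, G) \<in> (\<lambda>q. (r1, g q)) ` {..r1}"
          then show ?thesis using g(1) r(5,6) n by fastforce
        next
          assume "(\<rho>, G) \<in> (\<lambda>q. (r1 + r2 - k0, g1 q)) ` {..r2 - k0}"
          then show ?thesis using g1(1) r(6) by fastforce
        qed
        show "(if i < n then Y $$ (i, j) else 0) = (if j \<in> {..<m1} then \<Sum>t<r1. p (basis_var k0 1 t i) * p (coeff_var m1 j t)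
            else \<Sum>t<r2. p (basis_var k0 2 t i) * p (coeff_var m1 j t))"
          if "?cand p \<Omega> Y" "\<And>\<rho> G. (\<rho>, G) \<in> ?S \<Longrightarrow> hall_surplus \<rho> \<Omega> G" "j \<in> {..<m1} \<union> {m1..<m1 + m2}" "i < n" for \<Omega> Y j i
          by (rule two_view_candidate.unique_sequentially_swapped[OF that(1) _ g(2) _ _ _ g1(2) _ _ that(3,4)])
            (use g(1) g1(1) r(6) n that(2) in auto)
      qed simp
    next
      case joint
      have m3: "(r1 - k0 + 1) * (n - r1) + (r2 - k0 + 1) * (n - r2) + k0 * (n - k0) \<le> m1 + m2"
        using assms(12) unfolding k0_def[symmetric] r(2,3) .
      obtain f where f: "\<forall>q<k0. r2 - k0 \<le> f q \<and> f q \<le> n - r1"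
          "(\<Sum>q<k0. f q) + (r1 - k0 + 1) * (n - r1) \<le> m1"
          "(\<Sum>q<k0. n - k0 - f q) + (r2 - k0 + 1) * (n - r2) \<le> m2"
        using mixed_group_sizes[OF r(4-6) m m3 joint] by (elim exE conjE)
      let ?J1 = "{..<k0} <+> {..r1 - k0}" and ?J2 = "{..<k0} <+> {..r2 - k0}"
      let ?s1 = "case_sum f (\<lambda>_. n - r1)" and ?s2 = "case_sum (\<lambda>q. n - k0 - f q) (\<lambda>_. n - r2)"
      have s: "(\<Sum>s\<in>?J1. ?s1 s) \<le> card {..<m1}" "(\<Sum>s\<in>?J2. ?s2 s) \<le> card {m1..<m1 + m2}"
        using f(2,3) by (simp_all add: sum.Plus)
      have "\<exists>D1. (\<forall>s\<in>?J1. D1 s \<subseteq> {..<m1} \<and> card (D1 s) = ?s1 s) \<and> disjoint_family_on D1 ?J1"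
        by (rule disjoint_subsets_of_sizes[OF _ _ s(1)]) simp_all
      then obtain D1 where D1: "\<forall>s\<in>?J1. D1 s \<subseteq> {..<m1} \<and> card (D1 s) = ?s1 s" "disjoint_family_on D1 ?J1" by (elim exE conjE)
      have "\<exists>D2. (\<forall>s\<in>?J2. D2 s \<subseteq> {m1..<m1 + m2} \<and> card (D2 s) = ?s2 s) \<and> disjoint_family_on D2 ?J2"
        by (rule disjoint_subsets_of_sizes[OF _ _ s(2)]) simp_all
      then obtain D2 where D2: "\<forall>s\<in>?J2. D2 s \<subseteq> {m1..<m1 + m2} \<and> card (D2 s) = ?s2 s" "disjoint_family_on D2 ?J2" by (elim exE conjE)
      have D1': "D1 (Inl q) \<subseteq> {..<m1}" "card (D1 (Inl q)) = f q" if "q < k0" for q using D1(1) that by force+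
      have D2': "D2 (Inl q) \<subseteq> {m1..<m1 + m2}" "card (D2 (Inl q)) = n - k0 - f q" if "q < k0" for q using D2(1) that by force+
      have sizes: "card (D1 (Inl q)) + card (D2 (Inl q)) + k0 = n" if "q < k0" for q
        using D1'(2)[OF that] D2'(2)[OF that] f(1) r(4,6) n that by fastforce
      \<comment> \<open>A mixed group needs surplus \<open>k0\<close> as a whole, and surplus
        \<open>r1\<close> and \<open>r2\<close> on its two shares so that the special bases stay
        independent on the observed rows. There are at most \<open>7 * \<mu>\<close>
        conditions.\<close>
      let ?S = "(\<lambda>q. (k0, D1 (Inl q) \<union> D2 (Inl q))) ` {..<k0} \<union> ((\<lambda>s. (r1, D1 s)) ` ?J1 \<union> (\<lambda>s. (r2, D2 s)) ` ?J2)"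
      have "card ((\<lambda>q. (k0, D1 (Inl q) \<union> D2 (Inl q))) ` {..<k0}) \<le> k0" using card_image_le[of "{..<k0}"] by simp
      moreover have "card ((\<lambda>s. (r1, D1 s)) ` ?J1) \<le> k0 + (r1 - k0 + 1)" using card_image_le[of ?J1] by (simp add: card_Plus)
      moreover have "card ((\<lambda>s. (r2, D2 s)) ` ?J2) \<le> k0 + (r2 - k0 + 1)" using card_image_le[of ?J2] by (simp add: card_Plus)
      ultimately have "card ?S \<le> k0 + ((k0 + (r1 - k0 + 1)) + (k0 + (r2 - k0 + 1)))"
        by (intro order_trans[OF card_Un_le] add_mono)
      then have crd: "real (card ?S) \<le> 24 * \<mu>" using \<mu> \<mu>_ge r(4,5) by linarith
      have S1: "card (D1 s) + r1 \<le> n" if "s \<in> ?J1" for s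
        using that
      proof (cases s)
        case (Inl q)
        then have "q < k0" using that by auto
        then have "card (D1 s) = f q" "f q \<le> n - r1" using D1'(2) f(1) Inl by simp_all
        then show ?thesis using n by linarith
      next
        case (Inr q)
        then have "card (D1 s) = n - r1" using bspec[OF D1(1) that] by simp
        then show ?thesis using n by simp
      qed
      have S2: "card (D2 s) + r2 \<le> n" if "s \<in> ?J2" for s
        using that
      proof (cases s)
        case (Inl q)
        then have "q < k0" using that by auto
        then have "card (D2 s) = n - k0 - f q" "r2 - k0 \<le> f q" using D2'(2) f(1) Inl by simp_all
        then show ?thesis using n r(5) by linarith
      next
        case (Inr q)
        then have "card (D2 s) = n - r2" using bspec[OF D2(1) that] by simp
        then show ?thesis using n by simp
      qed
      show ?thesis
      proof (rule finish[OF p rank _ crd])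
        show "G \<subseteq> {..<m1 + m2} \<and> card G + \<rho> \<le> n \<and> \<rho> \<le> r1 + r2 - k0" if "(\<rho>, G) \<in> ?S" for \<rho> G
          using that
        proof (elim UnE imageE)
          fix q assume q: "(\<rho>, G) = (k0, D1 (Inl q) \<union> D2 (Inl q))" "q \<in> {..<k0}"
          then have "card G \<le> card (D1 (Inl q)) + card (D2 (Inl q))" by (simp add: card_Un_le)
          then show ?thesis using q sizes[of q] D1'(1)[of q] D2'(1)[of q] r(4,5) by auto
        next
          fix s assume "(\<rho>, G) = (r1, D1 s)" "s \<in> ?J1"
          then show ?thesis using S1[of s] bspec[OF D1(1), of s] r(5) by auto
        next
          fix s assume "(\<rho>, G) = (r2, D2 s)" "s \<in> ?J2"
          then show ?thesis using S2[of s] bspec[OF D2(1), of s] r(4) by auto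
        qed
        show "(if i < n then Y $$ (i, j) else 0) = (if j \<in> {..<m1} then \<Sum>t<r1. p (basis_var k0 1 t i) * p (coeff_var m1 j t)
            else \<Sum>t<r2. p (basis_var k0 2 t i) * p (coeff_var m1 j t))"
          if c: "?cand p \<Omega> Y" and h: "\<And>\<rho> G. (\<rho>, G) \<in> ?S \<Longrightarrow> hall_surplus \<rho> \<Omega> G" and ji: "j \<in> {..<m1} \<union> {m1..<m1 + m2}" "i < n" for \<Omega> Y j i
        proof (rule two_view_candidate.unique_jointly[OF c _ D1(2) _ D2(2) sizes _ _ _ _ _ ji])
          show "D1 s \<subseteq> {..<m1}" "hall_surplus r1 \<Omega> (D1 s)" if "s \<in> ?J1" for s using D1(1) that by (blast, intro h, blast)
          show "D2 s \<subseteq> {m1..<m1 + m2}" "hall_surplus r2 \<Omega> (D2 s)" if "s \<in> ?J2" for s using D2(1) that by (blast, intro h, blast)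
          show "hall_surplus k0 \<Omega> (D1 (Inl q) \<union> D2 (Inl q))" if "q < k0" for q using that by (intro h) blast
          show "card (D1 (Inr q)) + r1 = n" if "q \<le> r1 - k0" for q
            using bspec[OF D1(1), of "Inr q"] that n by (auto simp: InrI)
          show "card (D2 (Inr q)) + r2 = n" if "q \<le> r2 - k0" for q
            using bspec[OF D2(1), of "Inr q"] that n by (auto simp: InrI)
        qed
      qed simp
    qed
  qed
  show ?thesis
  proof (rule bexI[where x = "{p \<in> space (gen_param_space n m1 m2 r1 r2 r). \<not> alg_indep ?I p}"])
    show "{p \<in> space (gen_param_space n m1 m2 r1 r2 r). \<not> alg_indep ?I p} \<in> null_sets (gen_param_space n m1 m2 r1 r2 r)"
      unfolding gen_param_space_def by (rule alg_dependent_null_set[OF finite_gen_index])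
  qed (use main in \<open>simp add: Let_def\<close>)
qed

end
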